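(* Let $T$ be a tournament. Then $T$ is $(-1)$-critical if and only if $T$ is isomorphic to one of the tournaments $E_{2n+1}^{2k+1}$, $F_{2n+1}^{2k+1}$, $(F_{2n+1}^{2k+1})^*$, $G_{2n+1}^{2k+1}$, $(G_{2n+1}^{2k+1})^*$, $H_{2n+1}^{2k+1}$ for some integers $n\ge 3$ and $1\le k\le n-2$. Moreover, in each of these tournaments the vertex $2k+1$ is the unique non-critical vertex.
   Context: A tournament $T=(S,A)$ consists of a finite set $S$ and a set $A$ of ordered pairs of distinct elements of $S$ such that for all distinct $x,y\in S$ exactly one of $(x,y),(y,x)$ lies in $A$; write $x\to y$ for $(x,y)\in A$. For $X\subseteq S$, $T(X)$ is the induced subtournament on $X$, $T-X=T(S\setminus X)$ and $T-x=T(S\setminus\{x\})$. The dual of $T$ is $T^*=(S,\{(x,y):(y,x)\in A\})$. A subset $I\subseteq S$ is an interval of $T$ if for all $a,b\in I$ and $x\in S\setminus I$, $(a,x)\in A$ iff $(b,x)\in A$. The sets $\emptyset$, $\{x\}$ ($x\in S$) and $S$ are the trivial intervals; $T$ is indecomposable if all its intervals are trivial, and decomposable otherwise. A vertex $x$ of an indecomposable tournament $T$ is critical if $T-x$ is decomposable. An indecomposable tournament with at least $5$ vertices is $(-1)$-critical if exactly one of its vertices is non-critical. For an integer $p\ge1$, the tournaments $U_{2p+1}$ and $V_{2p+1}$ on $\{0,\dots,2p\}$ are: in $U_{2p+1}$, for $i<j$, $i\to j$ if $i$ or $j$ is odd, and $j\to i$ if $i$ and $j$ are both even; in $V_{2p+1}$,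 $i\to j$ for $0\le i<j\le 2p-1$, and for $0\le i\le 2p-1$, $2p\to i$ if $i$ is even and $i\to 2p$ if $i$ is odd. For integers $n\ge 3$ and $1\le k\le n-2$, the tournaments $E_{2n+1}^{2k+1},F_{2n+1}^{2k+1},G_{2n+1}^{2k+1},H_{2n+1}^{2k+1}$ are defined on $\{0,\dots,2n\}$; put $P=\{0,\dots,2k\}$ and $Q=\{2k+2,\dots,2n\}$. In each of them, every vertex of $P$ dominates $2k+1$ and $2k+1$ dominates every vertex of $Q$. Further: (E) $E_{2n+1}^{2k+1}$: on $P$, $i\to j$ iff $i<j$; on $Q$, $i\to j$ iff $i<j$; for $x\in Q$, $y\in P$: $x\to y$ if $x$ and $y$ are both even, and $y\to x$ otherwise. (F) $F_{2n+1}^{2k+1}$: on $P$ the arcs are those of $U_{2k+1}$; on $Q$ and between $Q$ and $P$ exactly as in $E_{2n+1}^{2k+1}$. (G) $G_{2n+1}^{2k+1}$: on $P$ the arcs are those of $U_{2k+1}$; on $Q$: $i\to j$ for $2k+2\le i<j\le 2n-1$, and for $j\in\{2k+2,\dots,2n-1\}$, $2n\to j$ if $j$ is even and $j\to 2n$ if $j$ is odd; for $x\in Q$, $y\in P$: $x\to y$ if $x=2n$ and $y$ is even, and $y\to x$ otherwise. (H) $H_{2n+1}^{2k+1}$: on $P$ the arcs are those of $V_{2k+1}$; on $Q$ exactly as in $G_{2n+1}^{2k+1}$; for $x\in Q$, $y\in P$: $x\to y$ if $x=2n$ and $y=2k$, and $y\to x$ otherwise. *)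

theory Defs
  imports "Graph_Theory.Graph_Theory"
begin

section \<open>Tournaments, intervals and critical vertices\<close>

text \<open>A tournament \<open>T = (S, A)\<close> is a digraph without parallel arcs, so it is represented by the
  record type of digraphs whose arcs are pairs: \<open>S\<close> is \<open>pverts T\<close> and \<open>A\<close> is \<open>parcs T\<close>.
  The locale \<open>pair_digraph\<close> supplies finiteness, \<open>A \<subseteq> S \<times> S\<close> and the absence of loops.\<close>

locale tournament = pair_digraph T for T :: "'a pair_pre_digraph" +
  assumes exactly_one_arc:
    "\<lbrakk>x \<in> pverts T; y \<in> pverts T; x \<noteq> y\<rbrakk> \<Longrightarrow> (x, y) \<in> parcs T \<longleftrightarrow> (y, x) \<notin> parcs T"

definition subtournament :: "'a pair_pre_digraph \<Rightarrow> 'a set \<Rightarrow> 'a pair_pre_digraph" where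
  "subtournament T X = \<lparr>pverts = X, parcs = {(x, y) \<in> parcs T. x \<in> X \<and> y \<in> X}\<rparr>"

definition delete_vertex :: "'a pair_pre_digraph \<Rightarrow> 'a \<Rightarrow> 'a pair_pre_digraph" where
  "delete_vertex T x = subtournament T (pverts T - {x})"

definition dual :: "'a pair_pre_digraph \<Rightarrow> 'a pair_pre_digraph" where
  "dual T = \<lparr>pverts = pverts T, parcs = (parcs T)\<inverse>\<rparr>"

definition tournament_iso :: "'a pair_pre_digraph \<Rightarrow> 'b pair_pre_digraph \<Rightarrow> bool" where
  "tournament_iso T T' \<longleftrightarrow> digraph_iso (with_proj T) (with_proj T')"

definition interval :: "'a pair_pre_digraph \<Rightarrow> 'a set \<Rightarrow> bool" where
  "interval T I \<longleftrightarrow> I \<subseteq> pverts T \<and>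
     (\<forall>a\<in>I. \<forall>b\<in>I. \<forall>x\<in>pverts T - I. (a, x) \<in> parcs T \<longleftrightarrow> (b, x) \<in> parcs T)"

definition trivial_interval :: "'a pair_pre_digraph \<Rightarrow> 'a set \<Rightarrow> bool" where
  "trivial_interval T I \<longleftrightarrow> I = {} \<or> (\<exists>x\<in>pverts T. I = {x}) \<or> I = pverts T"

definition indecomposable :: "'a pair_pre_digraph \<Rightarrow> bool" where
  "indecomposable T \<longleftrightarrow> (\<forall>I. interval T I \<longrightarrow> trivial_interval T I)"

abbreviation decomposable :: "'a pair_pre_digraph \<Rightarrow> bool" where
  "decomposable T \<equiv> \<not> indecomposable T"

text \<open>Critical and non-critical vertices are only defined in an indecomposable tournament, so both
  predicates carry this condition.\<close>

definition critical_vertex :: "'a pair_pre_digraph \<Rightarrow> 'a \<Rightarrow> bool" where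
  "critical_vertex T x \<longleftrightarrow>
     indecomposable T \<and> x \<in> pverts T \<and> decomposable (delete_vertex T x)"

definition noncritical_vertex :: "'a pair_pre_digraph \<Rightarrow> 'a \<Rightarrow> bool" where
  "noncritical_vertex T x \<longleftrightarrow> indecomposable T \<and> x \<in> pverts T \<and> \<not> critical_vertex T x"

definition minus_one_critical :: "'a pair_pre_digraph \<Rightarrow> bool" where
  "minus_one_critical T \<longleftrightarrow> tournament T \<and> indecomposable T \<and> card (pverts T) \<ge> 5 \<and>
     (\<exists>!x. noncritical_vertex T x)"


section \<open>The tournaments \<open>U\<close>, \<open>V\<close>, \<open>E\<close>, \<open>F\<close>, \<open>G\<close> and \<open>H\<close>\<close>

definition U_tournament :: "nat \<Rightarrow> nat pair_pre_digraph" where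
  "U_tournament p = \<lparr>pverts = {0..2*p},
     parcs = {(i, j). i \<le> 2*p \<and> j \<le> 2*p \<and>
       (i < j \<and> (odd i \<or> odd j) \<or> j < i \<and> even i \<and> even j)}\<rparr>"

definition V_tournament :: "nat \<Rightarrow> nat pair_pre_digraph" where
  "V_tournament p = \<lparr>pverts = {0..2*p},
     parcs = {(i, j). i < j \<and> j < 2*p}
       \<union> {(2*p, i) | i. i < 2*p \<and> even i}
       \<union> {(i, 2*p) | i. i < 2*p \<and> odd i}\<rparr>"

definition linear_arcs :: "nat set \<Rightarrow> nat rel" where
  "linear_arcs X = {(i, j). i \<in> X \<and> j \<in> X \<and> i < j}"

definition lower_part :: "nat \<Rightarrow> nat set" where
  "lower_part k = {0..2*k}"

definition upper_part :: "nat \<Rightarrow> nat \<Rightarrow> nat set" where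
  "upper_part n k = {2*k+2..2*n}"

text \<open>The arcs on \<open>Q = {2k+2,\<dots>,2n}\<close> in \<open>G\<close> and \<open>H\<close>.\<close>

definition upper_V_arcs :: "nat \<Rightarrow> nat \<Rightarrow> nat rel" where
  "upper_V_arcs n k = linear_arcs {2*k+2..<2*n}
     \<union> {(2*n, j) | j. j \<in> {2*k+2..<2*n} \<and> even j}
     \<union> {(j, 2*n) | j. j \<in> {2*k+2..<2*n} \<and> odd j}"

text \<open>The common shape of the four families: \<open>A\<^sub>P\<close> and \<open>A\<^sub>Q\<close> are the arcs on \<open>P\<close> and \<open>Q\<close>, and
  \<open>B x y\<close> says that \<open>x \<in> Q\<close> dominates \<open>y \<in> P\<close>.\<close>

definition glued_tournament ::
    "nat \<Rightarrow> nat \<Rightarrow> nat rel \<Rightarrow> nat rel \<Rightarrow> (nat \<Rightarrow> nat \<Rightarrow> bool) \<Rightarrow> nat pair_pre_digraph" where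
  "glued_tournament n k A\<^sub>P A\<^sub>Q B = \<lparr>pverts = {0..2*n},
     parcs = A\<^sub>P \<union> A\<^sub>Q
       \<union> lower_part k \<times> {2*k+1}
       \<union> {2*k+1} \<times> upper_part n k
       \<union> {(x, y). x \<in> upper_part n k \<and> y \<in> lower_part k \<and> B x y}
       \<union> {(y, x). x \<in> upper_part n k \<and> y \<in> lower_part k \<and> \<not> B x y}\<rparr>"

text \<open>In the following definitions the arguments \<open>n\<close> and \<open>k\<close> stand for the subscript \<open>2n+1\<close> and
  the superscript \<open>2k+1\<close>; they are meaningful for \<open>n \<ge> 3\<close> and \<open>1 \<le> k \<le> n - 2\<close>.\<close>

definition E_tournament :: "nat \<Rightarrow> nat \<Rightarrow> nat pair_pre_digraph" where
  "E_tournament n k = glued_tournament n k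
     (linear_arcs (lower_part k)) (linear_arcs (upper_part n k)) (\<lambda>x y. even x \<and> even y)"

definition F_tournament :: "nat \<Rightarrow> nat \<Rightarrow> nat pair_pre_digraph" where
  "F_tournament n k = glued_tournament n k
     (parcs (U_tournament k)) (linear_arcs (upper_part n k)) (\<lambda>x y. even x \<and> even y)"

definition G_tournament :: "nat \<Rightarrow> nat \<Rightarrow> nat pair_pre_digraph" where
  "G_tournament n k = glued_tournament n k
     (parcs (U_tournament k)) (upper_V_arcs n k) (\<lambda>x y. x = 2*n \<and> even y)"

definition H_tournament :: "nat \<Rightarrow> nat \<Rightarrow> nat pair_pre_digraph" where
  "H_tournament n k = glued_tournament n k
     (parcs (V_tournament k)) (upper_V_arcs n k) (\<lambda>x y. x = 2*n \<and> y = 2*k)"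

end

theory Submission
  imports Defs
begin

text \<open>Let \<open>x\<close> be the non-critical vertex, and call \<open>{c, d}\<close> an edge if \<open>T - {c, d}\<close> is indecomposable.
  By the extension theorem of Ehrenfeucht and Rozenberg, the complement of an indecomposable
  subtournament containing \<open>x\<close> has even size and, unless it is empty, contains an edge.
  If \<open>a \<noteq> x\<close> lies on an edge \<open>{a, b}\<close>, then, as \<open>a\<close> is critical, either \<open>b\<close> is a source or a sink of
  \<open>T - a\<close>, or \<open>b\<close> has a twin \<open>u\<close> in \<open>T - a\<close> and \<open>{a, u}\<close> is the only other edge at \<open>a\<close>. So the edges
  avoiding \<open>x\<close> form paths, and each path is an arm \<open>x = a\<^sub>0, a\<^sub>1, \<dots>, a\<^sub>m\<close>: the vertices \<open>a\<^sub>i\<close> and \<open>a\<^sub>i\<^sub>+\<^sub>2\<close>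
  are twins up to \<open>a\<^sub>i\<^sub>+\<^sub>1\<close>, and \<open>a\<^sub>m\<^sub>-\<^sub>1\<close> is a source or a sink up to \<open>a\<^sub>m\<close>. Arcs between an arm and a vertex
  outside depend only on parities, and the arcs inside the arm are determined up to one bit.

  There are exactly two arms, one ending in a source and one in a sink. Both of odd length leave no
  further vertex (\<open>E\<close>, \<open>F\<close>); one odd and one even leave a single vertex (\<open>G\<close>); both even leave two
  (\<open>H\<close>). The remaining values of the bits produce twins in \<open>T - x\<close> or break the parity condition.
  Conversely, prolonging an arm by two vertices preserves indecomposability, which reduces the
  families and their subtournaments \<open>T - x\<close> to sets of three and six vertices.\<close>

section \<open>Intervals and indecomposable vertex sets\<close>

text \<open>The evenness has one cause: adding pairs to an indecomposable set through
  \<open>x\<close> never stops one vertex short of \<open>S\<close>, since that vertex would be a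
  second non-critical one. The edges describe \<open>T\<close> only locally, and the work lies in
  making this global. A longest path of edges avoiding \<open>x\<close> can neither close up, nor
  have extreme vertices at both ends, nor return to \<open>x\<close> at both ends: each of these
  yields clashing sources, twins, an interval missing \<open>x\<close>, or a decomposable
  \<open>T - x\<close>. Arms are then found outside a growing indecomposable set, and two even arms
  of the same kind clash, because the first vertex of each would dominate that of the other. The
  open bit of an arm is the common orientation between its vertices whose index has the parity of
  the length. An even arm has its vertex 0, which is \<open>x\<close>, among them, so its bit shows
  in the arcs at \<open>x\<close> and is decided there. Two odd arms have two bits that do not
  involve \<open>x\<close>; one of the four combinations makes the first vertices of the arms twins
  in \<open>T - x\<close>, and the other three are \<open>E\<close>, \<open>F\<close> and the dual
  of \<open>F\<close>.\<close>

text \<open>The arc relation and the vertex set are kept apart, so that a subtournament is just a subset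
  and the dual tournament is just the converse relation.\<close>

definition intv :: "('a \<Rightarrow> 'a \<Rightarrow> bool) \<Rightarrow> 'a set \<Rightarrow> 'a set \<Rightarrow> bool" where
  "intv A Z J \<longleftrightarrow> J \<subseteq> Z \<and> (\<forall>a\<in>J. \<forall>b\<in>J. \<forall>w\<in>Z - J. A a w \<longleftrightarrow> A b w)"

definition ind :: "('a \<Rightarrow> 'a \<Rightarrow> bool) \<Rightarrow> 'a set \<Rightarrow> bool" where
  "ind A Z \<longleftrightarrow> (\<forall>J. intv A Z J \<longrightarrow> J = {} \<or> (\<exists>z. J = {z}) \<or> J = Z)"

definition twins :: "('a \<Rightarrow> 'a \<Rightarrow> bool) \<Rightarrow> 'a set \<Rightarrow> 'a \<Rightarrow> 'a \<Rightarrow> bool" where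
  "twins A Z p q \<longleftrightarrow> (\<forall>w\<in>Z - {p, q}. A p w \<longleftrightarrow> A q w)"

definition source :: "('a \<Rightarrow> 'a \<Rightarrow> bool) \<Rightarrow> 'a set \<Rightarrow> 'a \<Rightarrow> bool" where
  "source A Z p \<longleftrightarrow> (\<forall>w\<in>Z - {p}. A p w)"

abbreviation sink :: "('a \<Rightarrow> 'a \<Rightarrow> bool) \<Rightarrow> 'a set \<Rightarrow> 'a \<Rightarrow> bool" where
  "sink A \<equiv> source (\<lambda>x y. A y x)"

lemma ex_two_elements: "2 \<le> card X \<Longrightarrow> \<exists>a\<in>X. \<exists>b\<in>X. a \<noteq> b"
  using card_le_Suc0_iff_eq[of X] by (cases "finite X") auto

locale tour =
  fixes S :: "'a set" and A :: "'a \<Rightarrow> 'a \<Rightarrow> bool"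
  assumes fin: "finite S"
    and asym: "\<lbrakk>x \<in> S; y \<in> S; x \<noteq> y\<rbrakk> \<Longrightarrow> A x y \<longleftrightarrow> \<not> A y x"
begin

lemma dual_tour: "tour S (\<lambda>x y. A y x)"
  using fin asym by unfold_locales blast+

lemma intv_dual:
  assumes "Z \<subseteq> S" shows "intv (\<lambda>x y. A y x) Z J \<longleftrightarrow> intv A Z J"
proof -
  have "A a w = A b w \<longleftrightarrow> A w a = A w b" if "J \<subseteq> Z" "a \<in> J" "b \<in> J" "w \<in> Z - J" for a b w
    using asym[of a w] asym[of b w] that assms by blast
  then show ?thesis unfolding intv_def by (smt (verit, best))
qed

lemma ind_dual: "Z \<subseteq> S \<Longrightarrow> ind (\<lambda>x y. A y x) Z \<longleftrightarrow> ind A Z"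
  by (simp add: ind_def intv_dual)

lemma twins_dual:
  assumes "Z \<subseteq> S" "p \<in> S" "q \<in> S" shows "twins (\<lambda>x y. A y x) Z p q \<longleftrightarrow> twins A Z p q"
proof -
  have "A p w = A q w \<longleftrightarrow> A w p = A w q" if "w \<in> Z - {p, q}" for w
    using asym[of p w] asym[of q w] that assms by blast
  then show ?thesis unfolding twins_def by blast
qed

lemma twins_sym: "twins A Z p q \<longleftrightarrow> twins A Z q p"
  unfolding twins_def by blast

lemma twinsD:
  assumes "twins A Z p q" "w \<in> Z" "w \<noteq> p" "w \<noteq> q" "Z \<subseteq> S" "p \<in> S" "q \<in> S"
  shows "A p w = A q w" "A w p = A w q"
  using assms twins_dual[of Z p q] unfolding twins_def by blast+

lemma twins_mono: "twins A Z p q \<Longrightarrow> Y \<subseteq> Z \<Longrightarrow> twins A Y p q"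
  unfolding twins_def by blast

lemma source_mono: "source A Z p \<Longrightarrow> Y \<subseteq> Z \<Longrightarrow> source A Y p"
  unfolding source_def by blast

lemma indD: "ind A Z \<Longrightarrow> intv A Z J \<Longrightarrow> a \<in> J \<Longrightarrow> b \<in> J \<Longrightarrow> a \<noteq> b \<Longrightarrow> J = Z"
  unfolding ind_def by blast

lemma intvI_twins: "twins A Z p q \<Longrightarrow> p \<in> Z \<Longrightarrow> q \<in> Z \<Longrightarrow> intv A Z {p, q}"
  unfolding twins_def intv_def by auto

lemma ind_no_twins:
  assumes "ind A Z" "3 \<le> card Z" "p \<in> Z" "q \<in> Z" "p \<noteq> q" shows "\<not> twins A Z p q"
proof
  assume "twins A Z p q"
  then have "Z = {p, q}" using indD[OF assms(1) intvI_twins] assms by blast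
  then show False using assms(2,5) by simp
qed

lemma ind_no_source:
  assumes "ind A Z" "3 \<le> card Z" "p \<in> Z" "Z \<subseteq> S" shows "\<not> source A Z p"
proof
  assume *: "source A Z p"
  have "A a p = A b p" if "a \<in> Z - {p}" "b \<in> Z - {p}" for a b
    using that * asym[of a p] asym[of b p] assms unfolding source_def by blast
  then have "intv A Z (Z - {p})" unfolding intv_def by blast
  moreover obtain a b where "a \<in> Z - {p}" "b \<in> Z - {p}" "a \<noteq> b"
  proof -
    have "2 \<le> card (Z - {p})" using assms(2,3) by simp
    from ex_two_elements[OF this] show ?thesis using that by blast
  qed
  ultimately have "Z - {p} = Z" using indD[OF assms(1)] by blast
  then show False using assms(3) by blast
qed

lemma ind_no_sink:
  assumes "ind A Z" "3 \<le> card Z" "p \<in> Z" "Z \<subseteq> S" shows "\<not> sink A Z p"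
proof -
  interpret D: tour S "\<lambda>x y. A y x" by (rule dual_tour)
  show ?thesis using D.ind_no_source[of Z p] assms ind_dual by blast
qed

lemma intv_Int: "intv A Z J \<Longrightarrow> Y \<subseteq> Z \<Longrightarrow> intv A Y (J \<inter> Y)"
  unfolding intv_def by blast

lemma intvD:
  assumes "intv A Z J" "a \<in> J" "b \<in> J" "w \<in> Z" "w \<notin> J" "Z \<subseteq> S"
  shows "A a w = A b w" "A w a = A w b"
  using assms intv_dual[of Z J] unfolding intv_def by blast+

text \<open>Over \<open>Z\<close> the vertices \<open>b\<close> and \<open>w\<close> have the same
  arcs, so renaming \<open>b\<close> to \<open>w\<close> is an isomorphism of the two induced
  subtournaments; the proof pulls an interval back along it.\<close>

lemma ind_twin_replace:
  assumes Z: "Z \<subseteq> S" "b \<notin> Z" "w \<notin> Z" "b \<in> S" "w \<in> S" and tw: "twins A Z b w" and i: "ind A (insert b Z)"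
  shows "ind A (insert w Z)"
  unfolding ind_def
proof (intro allI impI)
  fix J assume J: "intv A (insert w Z) J"
  define J' where "J' = (if w \<in> J then insert b (J - {w}) else J)"
  have eq: "A b z = A w z" "A z b = A z w" if "z \<in> Z" for z
    using twinsD[OF tw that] that Z by blast+
  have JZ: "J \<subseteq> insert w Z" using J unfolding intv_def by blast
  have "intv A (insert b Z) J'"
    unfolding intv_def
  proof (intro conjI ballI)
    show "J' \<subseteq> insert b Z" using JZ unfolding J'_def by auto
    fix p q v assume pq: "p \<in> J'" "q \<in> J'" "v \<in> insert b Z - J'"
    let ?f = "\<lambda>z. if z = b then w else z"
    have f: "?f p \<in> J" "?f q \<in> J" "?f v \<in> insert w Z - J"
      using pq JZ Z unfolding J'_def by (auto split: if_splits)
    have "A (?f p) (?f v) = A (?f q) (?f v)" using J f unfolding intv_def by blast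
    moreover have "A (?f p) (?f v) = A p v" if "p \<in> J'" for p
    proof -
      have "p \<in> insert b Z" using that JZ unfolding J'_def by (auto split: if_splits)
      moreover have "p \<noteq> v" using that pq by blast
      ultimately show ?thesis using eq pq(3) by auto
    qed
    ultimately show "A p v = A q v" using pq by blast
  qed
  then have "J' = {} \<or> (\<exists>z. J' = {z}) \<or> J' = insert b Z" using i unfolding ind_def by blast
  then show "J = {} \<or> (\<exists>z. J = {z}) \<or> J = insert w Z"
  proof (elim disjE exE)
    assume "J' = {}" then show ?thesis unfolding J'_def by (auto split: if_splits)
  next
    fix z assume *: "J' = {z}"
    have "J = {if w \<in> J then w else z}"
    proof (cases "w \<in> J")
      case True
      then have "insert b (J - {w}) = {z}" using * J'_def by simp
      moreover have "b \<notin> J \<or> b = w" using JZ Z by blast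
      ultimately have "J - {w} = {}" by blast
      then show ?thesis using True by auto
    qed (use * J'_def in auto)
    then show ?thesis by blast
  next
    assume *: "J' = insert b Z"
    have "w \<in> J"
    proof (rule ccontr)
      assume "w \<notin> J"
      then have "b \<in> J" "J \<subseteq> Z" using * JZ unfolding J'_def by auto
      then show False using Z by blast
    qed
    then show ?thesis using * JZ Z unfolding J'_def by auto
  qed
qed

text \<open>An interval of \<open>insert v Z\<close> meets \<open>Z\<close> in an interval of
  \<open>Z\<close>, hence in nothing, one vertex or everything. A nontrivial one therefore either
  pairs \<open>v\<close> with a twin or is \<open>Z\<close> itself, and then \<open>v\<close> is a
  source or a sink.\<close>

lemma ind_insert:
  assumes i: "ind A Z" "3 \<le> card Z" "Z \<subseteq> S" "v \<in> S" "v \<notin> Z"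
    and s: "\<not> source A Z v" "\<not> sink A Z v" and t: "\<And>u. u \<in> Z \<Longrightarrow> \<not> twins A Z v u"
  shows "ind A (insert v Z)"
  unfolding ind_def
proof (intro allI impI)
  fix J assume J: "intv A (insert v Z) J"
  have "intv A Z (J \<inter> Z)" by (rule intv_Int[OF J]) blast
  then consider "J \<inter> Z = {}" | z where "J \<inter> Z = {z}" | "J \<inter> Z = Z" using i(1) unfolding ind_def by blast
  moreover have JZ: "J \<subseteq> insert v Z" using J unfolding intv_def by blast
  ultimately show "J = {} \<or> (\<exists>z. J = {z}) \<or> J = insert v Z"
  proof cases
    case 1 then show ?thesis using JZ by blast
  next
    case (2 z)
    have "\<not> (v \<in> J)"
    proof
      assume "v \<in> J"
      then have "J = {v, z}" using 2 JZ by blast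
      then have "twins A Z v z" using J i(5) unfolding intv_def twins_def by blast
      then show False using t 2 by blast
    qed
    then show ?thesis using 2 JZ by blast
  next
    case 3
    have "v \<in> J"
    proof (rule ccontr)
      assume v: "v \<notin> J"
      then have "J = Z" using 3 JZ by blast
      then have "A v a = A v b" if "a \<in> Z" "b \<in> Z" for a b
        using intvD(2)[OF J, of a b v] that v i by auto
      then have "source A Z v \<or> (\<forall>a\<in>Z. \<not> A v a)" unfolding source_def by blast
      then have "source A Z v \<or> sink A Z v" using asym i(3-5) unfolding source_def by blast
      then show False using s by blast
    qed
    then show ?thesis using 3 JZ by blast
  qed
qed

text \<open>The smallest seed from which larger indecomposable sets are grown.\<close>

lemma ind_cycle:
  assumes "x \<in> S" "y \<in> S" "z \<in> S" "A x y" "A y z" "A z x" "x \<noteq> y" "y \<noteq> z" "x \<noteq> z"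
  shows "ind A {x, y, z}"
  unfolding ind_def
proof (intro allI impI)
  fix J assume J: "intv A {x, y, z} J"
  have n: "\<not> A y x" "\<not> A z y" "\<not> A x z" using assms asym by blast+
  have J3: "J \<subseteq> {x, y, z}" using J unfolding intv_def by blast
  have D: "A a w = A b w" if "a \<in> J" "b \<in> J" "w \<in> {x,y,z}" "w \<notin> J" for a b w
    using J that unfolding intv_def by blast
  have "\<not> (x \<in> J \<and> y \<in> J \<and> z \<notin> J)" using D[of x y z] assms n by blast
  moreover have "\<not> (y \<in> J \<and> z \<in> J \<and> x \<notin> J)" using D[of y z x] assms n by blast
  moreover have "\<not> (x \<in> J \<and> z \<in> J \<and> y \<notin> J)" using D[of x z y] assms n by blast
  ultimately have "J \<subseteq> {} \<or> J \<subseteq> {x} \<or> J \<subseteq> {y} \<or> J \<subseteq> {z} \<or> {x, y, z} \<subseteq> J" using J3 by blast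
  then show "J = {} \<or> (\<exists>z. J = {z}) \<or> J = {x, y, z}" using J3 by (auto simp: subset_singleton_iff)
qed

end

text \<open>Vertices two steps apart may be told apart only by the vertex between them; this is what
  two edges at a common critical vertex give.\<close>

definition chain :: "('a \<Rightarrow> 'a \<Rightarrow> bool) \<Rightarrow> 'a set \<Rightarrow> nat \<Rightarrow> (nat \<Rightarrow> 'a) \<Rightarrow> bool" where
  "chain A S m v \<longleftrightarrow> inj_on v {..m} \<and> v ` {..m} \<subseteq> S \<and>
     (\<forall>i. i + 2 \<le> m \<longrightarrow> twins A (S - {v (i + 1)}) (v i) (v (i + 2)))"

section \<open>Extending an indecomposable set by a pair of vertices\<close>

context tour
begin

text \<open>Used in the contrapositive: if no pair can be added to \<open>Z\<close>, then an outside
  vertex that is not a twin of \<open>u\<close> must treat \<open>a\<close> and \<open>u\<close>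
  alike.\<close>

lemma ind_pair_twin:
  assumes i: "ind A Z" "3 \<le> card Z" "Z \<subseteq> S" "u \<in> Z" "a \<in> S" "b \<in> S" "a \<notin> Z" "b \<notin> Z" "a \<noteq> b"
    and ta: "twins A Z a u" and tb: "\<not> twins A Z b u" and ne: "A b a \<noteq> A b u"
  shows "ind A (insert a (insert b Z))"
  unfolding ind_def
proof (intro allI impI)
  let ?Y = "insert a (insert b Z)"
  fix J assume J: "intv A ?Y J"
  have YS: "?Y \<subseteq> S" using i by blast
  have JY: "J \<subseteq> ?Y" using J unfolding intv_def by blast
  have eq: "A a z = A u z" "A z a = A z u" if "z \<in> Z" "z \<noteq> u" for z
    using twinsD[OF ta, of z] that i by blast+
  have ab: "A a b \<noteq> A u b" using ne asym[of a b] asym[of u b] i by blast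
  have no_tw: "\<not> (z \<in> J \<and> a \<in> J)" if "J \<inter> Z = {z}" "z \<noteq> u" for z
  proof
    assume *: "z \<in> J \<and> a \<in> J"
    have "A z w = A u w" if "w \<in> Z - {z, u}" for w
    proof -
      have "A z w = A a w" using intvD(1)[OF J, of z a w] * that \<open>J \<inter> Z = {z}\<close> YS by blast
      then show ?thesis using eq that by blast
    qed
    then have "twins A Z z u" unfolding twins_def by blast
    then show False using ind_no_twins i that by blast
  qed
  have no_b: False if "u \<in> J" "b \<in> J" "J \<inter> Z \<subseteq> {u}"
  proof -
    have "A b w = A u w" if "w \<in> Z - {b, u}" for w
      using intvD(1)[OF J \<open>b \<in> J\<close> \<open>u \<in> J\<close>, of w] that \<open>J \<inter> Z \<subseteq> {u}\<close> YS by blast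
    then show False using tb unfolding twins_def by blast
  qed
  have "intv A Z (J \<inter> Z)" by (rule intv_Int[OF J]) blast
  then consider "J \<inter> Z = {}" | z where "J \<inter> Z = {z}" | "J \<inter> Z = Z" using i(1) unfolding ind_def by blast
  then show "J = {} \<or> (\<exists>z. J = {z}) \<or> J = ?Y"
  proof cases
    case 1
    have False if "a \<in> J" "b \<in> J"
    proof -
      have "A b w = A u w" if "w \<in> Z - {b, u}" for w
        using intvD(1)[OF J \<open>b \<in> J\<close> \<open>a \<in> J\<close>, of w] that 1 YS eq(1)[of w] by blast
      then show False using tb unfolding twins_def by blast
    qed
    then show ?thesis using 1 JY by (cases "a \<in> J"; cases "b \<in> J") blast+
  next
    case (2 z)
    have b: "b \<notin> J"
    proof
      assume b: "b \<in> J"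
      show False
      proof (cases "z = u")
        case True then show False using no_b b 2 by blast
      next
        case False
        have zJ: "z \<in> J" "z \<in> Z" using 2 by blast+
        have "a \<notin> J" using no_tw[OF 2 False] zJ(1) by simp
        have "u \<notin> J"
        proof
          assume "u \<in> J"
          then have "u \<in> J \<inter> Z" using i(4) by simp
          then show False using 2 False by simp
        qed
        have "A z a = A b a" "A z u = A b u"
          using intvD(1)[OF J zJ(1) b] \<open>a \<notin> J\<close> \<open>u \<notin> J\<close> YS i(4) by simp_all
        then show False using eq(2)[OF zJ(2) False] ne by blast
      qed
    qed
    have "a \<notin> J"
    proof
      assume a: "a \<in> J"
      then have "u \<in> J" using no_tw 2 by blast
      then show False using intvD(1)[OF J a, of u b] b YS ab by blast
    qed
    then show ?thesis using b 2 JY by blast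
  next
    case 3
    have "2 \<le> card (Z - {u})" using i by simp
    from ex_two_elements[OF this] obtain z1 z2 where z: "z1 \<in> Z" "z2 \<in> Z" "z1 \<noteq> z2" "z1 \<noteq> u" "z2 \<noteq> u" by blast
    \<comment> \<open>Exchanging the twins \<open>u\<close> and \<open>a\<close> gives a second
      indecomposable set, which \<open>J\<close> meets in at least two vertices. This forces
      \<open>a\<close> into \<open>J\<close>, and then \<open>b\<close>, which separates
      \<open>a\<close> from \<open>u\<close>, follows.\<close>
    have "intv A (insert a (Z - {u})) (J \<inter> insert a (Z - {u}))" by (rule intv_Int[OF J]) blast
    moreover have "ind A (insert a (Z - {u}))"
      by (rule ind_twin_replace[where b = u]) (use i ta in \<open>auto simp: insert_absorb twins_def\<close>)
    ultimately have "J \<inter> insert a (Z - {u}) = insert a (Z - {u})"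
      using indD[of "insert a (Z - {u})" _ z1 z2] z 3 by blast
    then have a: "a \<in> J" by blast
    have u: "u \<in> J" using 3 i by blast
    have "b \<in> J"
      using intvD(1)[OF J a u, of b] ab YS by blast
    then show ?thesis using 3 a JY by blast
  qed
qed

text \<open>Counterpart of \<open>ind_pair_twin\<close> with a source in place of a twin: the only
  nontrivial interval of \<open>insert a Z\<close> is \<open>Z\<close>, and the arc from
  \<open>b\<close> to \<open>a\<close> spoils it.\<close>

lemma ind_pair_source:
  assumes i: "ind A Z" "3 \<le> card Z" "Z \<subseteq> S" "a \<in> S" "b \<in> S" "a \<notin> Z" "b \<notin> Z" "a \<noteq> b"
    and sa: "source A Z a" and sb: "\<not> source A Z b" "\<not> sink A Z b" and ba: "A b a"
  shows "ind A (insert a (insert b Z))"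
  unfolding ind_def
proof (intro allI impI)
  let ?Y = "insert a (insert b Z)"
  fix J assume J: "intv A ?Y J"
  have YS: "?Y \<subseteq> S" using i by blast
  have JY: "J \<subseteq> ?Y" using J unfolding intv_def by blast
  have az: "A a z" "\<not> A z a" if "z \<in> Z" for z
    using sa that i asym[of a z] unfolding source_def by auto
  have "intv A Z (J \<inter> Z)" by (rule intv_Int[OF J]) blast
  then consider "J \<inter> Z = {}" | z where "J \<inter> Z = {z}" | "J \<inter> Z = Z" using i(1) unfolding ind_def by blast
  then show "J = {} \<or> (\<exists>z. J = {z}) \<or> J = ?Y"
  proof cases
    case 1
    have False if "a \<in> J" "b \<in> J"
    proof -
      have "A b w" if "w \<in> Z" for w
        using intvD(1)[OF J \<open>b \<in> J\<close> \<open>a \<in> J\<close>, of w] that 1 YS az by blast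
      then show False using sb unfolding source_def by blast
    qed
    then show ?thesis using 1 JY by (cases "a \<in> J"; cases "b \<in> J") blast+
  next
    case (2 z)
    have zJ: "z \<in> J" "z \<in> Z" using 2 by blast+
    have a: "a \<notin> J"
    proof
      assume a: "a \<in> J"
      have "A z w" if "w \<in> Z - {z}" for w
        using intvD(1)[OF J zJ(1) a, of w] that 2 YS az by blast
      then have "source A Z z" unfolding source_def by blast
      then show False using ind_no_source i zJ by blast
    qed
    have "b \<notin> J"
    proof
      assume b: "b \<in> J"
      show False using intvD(1)[OF J b zJ(1), of a] a az zJ ba YS by blast
    qed
    then show ?thesis using a 2 JY by blast
  next
    case 3
    obtain z where z: "z \<in> Z" using i by fastforce
    have b: "b \<in> J"
    proof (rule ccontr)
      assume b: "b \<notin> J"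
      have "A b z1 = A b z2" if "z1 \<in> Z" "z2 \<in> Z" for z1 z2
        using intvD(2)[OF J, of z1 z2 b] that 3 YS b by blast
      then have "source A Z b \<or> (\<forall>a\<in>Z. \<not> A b a)" unfolding source_def by blast
      then have "source A Z b \<or> sink A Z b" using asym i(3-7) unfolding source_def by blast
      then show False using sb by blast
    qed
    have "a \<in> J"
      using intvD(1)[OF J b, of z a] z 3 ba az YS by blast
    then show ?thesis using 3 b JY by blast
  qed
qed

text \<open>The form in which arms grow: \<open>q\<close> copies \<open>w\<close> up to the arc
  between them, so it inherits from \<open>w\<close> that it is neither a source nor a sink of
  \<open>Z\<close>. That arc stays free, which is where the bit of an arm comes from.\<close>

lemma ind_extend_pair_source:
  assumes i: "ind A Z" "3 \<le> card Z" "Z \<subseteq> S" "w \<in> Z" "p \<in> S" "q \<in> S" "p \<notin> Z" "q \<notin> Z"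
    and s: "source A Z p" and t: "twins A (Z - {w}) q w" and qp: "A q p" and pq: "p \<noteq> q"
  shows "ind A (insert p (insert q Z))"
proof (rule ind_pair_source[OF i(1-3,5-8) pq s _ _ qp])
  have eq: "A q z = A w z" "A z q = A z w" if "z \<in> Z" "z \<noteq> w" for z
    using twinsD[OF t, of z] that i by blast+
  show "\<not> source A Z q" using ind_no_source[OF i(1,2,4,3)] eq(1) i(8) unfolding source_def by blast
  show "\<not> sink A Z q" using ind_no_sink[OF i(1,2,4,3)] eq(2) i(8) unfolding source_def by blast
qed

text \<open>An interval containing \<open>a\<close> and \<open>b\<close> but not all of
  \<open>Z\<close> would avoid \<open>Z\<close> and make \<open>a\<close> and \<open>b\<close>
  twins. Every other interval contains \<open>Z\<close> or lies inside one of the two given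
  sets.\<close>

lemma ind_pair_extensible:
  assumes i: "ind A (insert a Z)" "ind A (insert b Z)" "2 \<le> card Z" "a \<notin> Z" "b \<notin> Z" "a \<noteq> b"
    and t: "\<not> twins A Z a b"
  shows "ind A (insert a (insert b Z))"
  unfolding ind_def
proof (intro allI impI)
  let ?Y = "insert a (insert b Z)"
  fix J assume J: "intv A ?Y J"
  have JY: "J \<subseteq> ?Y" using J unfolding intv_def by blast
  obtain z1 z2 where z: "z1 \<in> Z" "z2 \<in> Z" "z1 \<noteq> z2" using ex_two_elements[OF i(3)] by blast
  have "intv A (insert a Z) (J \<inter> insert a Z)" "intv A (insert b Z) (J \<inter> insert b Z)"
    by (rule intv_Int[OF J]; blast)+
  then have a: "J \<inter> insert a Z = {} \<or> (\<exists>z. J \<inter> insert a Z = {z}) \<or> insert a Z \<subseteq> J"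
    and b: "J \<inter> insert b Z = {} \<or> (\<exists>z. J \<inter> insert b Z = {z}) \<or> insert b Z \<subseteq> J"
    using i unfolding ind_def by blast+
  show "J = {} \<or> (\<exists>z. J = {z}) \<or> J = ?Y"
  proof (cases "Z \<subseteq> J")
    case True
    then have "z1 \<in> J \<inter> insert a Z" "z2 \<in> J \<inter> insert a Z" "z1 \<in> J \<inter> insert b Z" "z2 \<in> J \<inter> insert b Z"
      using z by auto
    then have "insert a Z \<subseteq> J" "insert b Z \<subseteq> J" using a b z(3) by (metis empty_iff singletonD)+
    then show ?thesis using JY by blast
  next
    case False
    then have a': "J \<inter> insert a Z = {} \<or> (\<exists>z. J \<inter> insert a Z = {z})"
      and b': "J \<inter> insert b Z = {} \<or> (\<exists>z. J \<inter> insert b Z = {z})" using a b by blast+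
    have "\<not> {a, b} \<subseteq> J"
    proof
      assume ab: "{a, b} \<subseteq> J"
      then have "a \<in> J \<inter> insert a Z" by blast
      then have "J \<inter> insert a Z = {a}" using a' by (metis empty_iff singletonD)
      then have "J \<inter> Z = {}" using i(4) by auto
      then have "twins A Z a b" using J ab unfolding intv_def twins_def by blast
      then show False using t by blast
    qed
    then have "J \<inter> insert a Z = J \<or> J \<inter> insert b Z = J" using JY by auto
    then show ?thesis using a' b' by metis
  qed
qed

text \<open>The theorem of Ehrenfeucht and Rozenberg. If no pair can be added, three intervals of
  \<open>S\<close> arise in turn: the complement of the extreme outside vertices, the twin class of
  a vertex of \<open>Z\<close>, and \<open>S - Z\<close>. The first two show that no outside vertex
  is extreme or a twin; the third is nontrivial.\<close>

lemma ind_extend_by_two: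
  assumes S: "ind A S" and Z: "ind A Z" "Z \<subseteq> S" "3 \<le> card Z" and two: "2 \<le> card (S - Z)"
  shows "\<exists>a\<in>S - Z. \<exists>b\<in>S - Z. a \<noteq> b \<and> ind A (insert a (insert b Z))"
proof (rule ccontr)
  assume "\<not> ?thesis"
  then have no: "\<not> ind A (insert a (insert b Z))" if "a \<in> S - Z" "b \<in> S - Z" "a \<noteq> b" for a b
    using that by blast
  interpret D: tour S "\<lambda>x y. A y x" by (rule dual_tour)
  obtain z1 z2 where z: "z1 \<in> Z" "z2 \<in> Z" "z1 \<noteq> z2" using ex_two_elements[of Z] Z by force
  have no_ext: "\<not> source A Z a \<and> \<not> sink A Z a" if a: "a \<in> S - Z" for a
  proof -
    \<comment> \<open>\<open>X\<close> collects the outside vertices that are extreme over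
      \<open>Z\<close>. As no pair extends \<open>Z\<close>, each of them is extreme over all of
      \<open>S - X\<close>, so \<open>S - X\<close> is an interval containing
      \<open>Z\<close>.\<close>
    define X where "X = {v\<in>S - Z. source A Z v \<or> sink A Z v}"
    have "A p w = A q w" if "p \<in> S - X" "q \<in> S - X" "w \<in> X" for p q w
    proof -
      have w: "w \<in> S - Z" using that X_def by blast
      have src: "\<not> A p w" if "source A Z w" "p \<in> S - X" for p
      proof (cases "p \<in> Z")
        case True then show ?thesis using that w Z asym[of p w] unfolding source_def by blast
      next
        case False
        then show ?thesis
          using ind_pair_source[of Z w p] no[of w p] Z that w \<open>w \<in> X\<close> unfolding X_def by blast
      qed
      have snk: "A p w" if "sink A Z w" "p \<in> S - X" for p
      proof (cases "p \<in> Z")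
        case True then show ?thesis using that w Z asym[of p w] unfolding source_def by blast
      next
        case False
        have "\<not> A w p"
        proof
          assume wp: "A w p"
          have "ind (\<lambda>x y. A y x) (insert w (insert p Z))"
            by (rule D.ind_pair_source) (use Z that w \<open>w \<in> X\<close> False wp ind_dual in \<open>auto simp: X_def\<close>)
          then show False using ind_dual[of "insert w (insert p Z)"] no[of w p] Z that w False \<open>w \<in> X\<close> by auto
        qed
        then show ?thesis using asym[of p w] that w \<open>w \<in> X\<close> by blast
      qed
      show ?thesis using src snk that unfolding X_def by blast
    qed
    then have "intv A S (S - X)" unfolding intv_def by blast
    moreover have "z1 \<in> S - X" "z2 \<in> S - X" using z Z X_def by auto
    ultimately have "S - X = S" using indD[OF S] z by blast
    then show ?thesis using a unfolding X_def by blast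
  qed
  have no_twin: "\<not> twins A Z a u" if a: "a \<in> S - Z" and u: "u \<in> Z" for a u
  proof
    assume au: "twins A Z a u"
    \<comment> \<open>The twin class of \<open>u\<close>. By \<open>ind_pair_twin\<close> a vertex
      outside both this class and \<open>Z\<close> cannot separate two of its members.\<close>
    define J where "J = insert u {v\<in>S - Z. twins A Z v u}"
    have "A p w = A u w" if p: "p \<in> J" and w: "w \<in> S - J" for p w
    proof (cases "p = u \<or> w \<in> Z")
      case True
      then show ?thesis using that unfolding J_def twins_def by blast
    next
      case False
      then have "p \<in> S - Z" "w \<in> S - Z" "p \<noteq> w" "twins A Z p u" "\<not> twins A Z w u" using p w unfolding J_def by blast+
      then have "A w p = A w u" using ind_pair_twin[of Z u p w] no[of p w] Z u by blast
      then show ?thesis using asym[of w p] asym[of w u] p w u Z unfolding J_def by blast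
    qed
    moreover have "J \<subseteq> S" using u Z J_def by blast
    ultimately have "intv A S J" unfolding intv_def by simp
    moreover have "a \<in> J" "u \<in> J" "a \<noteq> u" using a u au unfolding J_def by auto
    ultimately have "J = S" using indD[OF S] by simp
    then have "z1 \<in> J" "z2 \<in> J" using z Z by auto
    then have "z1 = u" "z2 = u" using z unfolding J_def by auto
    then show False using z by simp
  qed
  \<comment> \<open>By now every outside vertex extends \<open>Z\<close> on its own, so
    \<open>ind_pair_extensible\<close> makes any two of them twins over \<open>Z\<close>.\<close>
  have "A a w = A b w" if ab: "a \<in> S - Z" "b \<in> S - Z" "w \<in> S - (S - Z)" for a b w
  proof (cases "a = b")
    case False
    have "ind A (insert v Z)" if "v \<in> S - Z" for v
      using ind_insert[of Z v] no_ext no_twin Z that by blast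
    then have "twins A Z a b" using ind_pair_extensible[of a Z b] no[of a b] ab False Z by auto
    then show ?thesis using ab unfolding twins_def by blast
  qed simp
  then have "intv A S (S - Z)" unfolding intv_def by blast
  moreover obtain a b where "a \<in> S - Z" "b \<in> S - Z" "a \<noteq> b" using ex_two_elements[OF two] by blast
  ultimately have "S - Z = S" using indD[OF S] by blast
  then show False using z Z by blast
qed

section \<open>Chains of successive twins\<close>

lemma chain_dual: "chain (\<lambda>x y. A y x) S m v \<longleftrightarrow> chain A S m v"
proof -
  have "twins (\<lambda>x y. A y x) (S - {v (i + 1)}) (v i) (v (i + 2)) = twins A (S - {v (i + 1)}) (v i) (v (i + 2))"
    if "v ` {..m} \<subseteq> S" "i + 2 \<le> m" for i
    by (rule twins_dual) (use that in auto)
  then show ?thesis unfolding chain_def by blast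
qed

lemma chain_neq: "chain A S m v \<Longrightarrow> i \<le> m \<Longrightarrow> j \<le> m \<Longrightarrow> i \<noteq> j \<Longrightarrow> v i \<noteq> v j"
  unfolding chain_def inj_on_def by auto

lemma chain_in: "chain A S m v \<Longrightarrow> i \<le> m \<Longrightarrow> v i \<in> S"
  unfolding chain_def by auto

text \<open>Moves along the chain in steps of two. Only the segment from \<open>v i\<close> to
  \<open>v j\<close> has to be avoided, so \<open>w\<close> may be another vertex of the chain; the
  arcs inside a chain are computed this way.\<close>

lemma chain_shift:
  assumes c: "chain A S m v" and ij: "i \<le> j" "j \<le> m" "even (i + j)" and w: "w \<in> S" "w \<notin> v ` {i..j}"
  shows "A w (v i) = A w (v j)" "A (v i) w = A (v j) w"
proof -
  obtain k where k: "j = i + 2 * k" using ij by (metis dvd_def even_add le_Suc_ex even_iff_mod_2_eq_zero mult_2 add.assoc odd_add)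
  have "i + 2 * k \<le> m \<Longrightarrow> w \<notin> v ` {i..i + 2 * k} \<Longrightarrow> A w (v i) = A w (v (i + 2 * k)) \<and> A (v i) w = A (v (i + 2 * k)) w"
  proof (induction k)
    case (Suc k)
    let ?j = "i + 2 * k"
    have "twins A (S - {v (?j + 1)}) (v ?j) (v (?j + 2))" using c Suc.prems unfolding chain_def by auto
    moreover have "w \<noteq> v ?j" "w \<noteq> v (?j + 1)" "w \<noteq> v (?j + 2)" using Suc.prems(2) by auto
    moreover have "v ?j \<in> S" "v (?j + 2) \<in> S" using chain_in[OF c] Suc.prems by auto
    ultimately have "A (v ?j) w = A (v (?j + 2)) w" "A w (v ?j) = A w (v (?j + 2))"
      using twinsD[of "S - {v (?j + 1)}" "v ?j" "v (?j + 2)" w] w by auto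
    moreover have "A w (v i) = A w (v ?j) \<and> A (v i) w = A (v ?j) w" using Suc by (auto simp: image_iff)
    ultimately show ?case by simp
  qed simp
  then show "A w (v i) = A w (v j)" "A (v i) w = A (v j) w" using ij w k by auto
qed

lemma chain_notin:
  assumes "chain A S m v" "j \<le> m" "k \<le> m" "k < i \<or> j < k" shows "v k \<notin> v ` {i..j}"
proof
  assume "v k \<in> v ` {i..j}"
  then obtain l where "v k = v l" "i \<le> l" "l \<le> j" by auto
  then show False using chain_neq[OF assms(1), of k l] assms by auto
qed

lemma intvI_const:
  assumes "J \<subseteq> S" "\<And>a w. a \<in> J \<Longrightarrow> w \<in> S - J \<Longrightarrow> A a w = c w" shows "intv A S J"
  using assms unfolding intv_def by blast

end

section \<open>Tournaments with a single non-critical vertex\<close>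

locale critical_except = tour +
  fixes x
  assumes x_in: "x \<in> S"
    and ind_S: "ind A S"
    and critical: "\<lbrakk>v \<in> S; v \<noteq> x\<rbrakk> \<Longrightarrow> \<not> ind A (S - {v})"
    and ind_del: "ind A (S - {x})"
    and card_S: "5 \<le> card S"
begin

lemma dual_critical_except: "critical_except S (\<lambda>x y. A y x) x"
proof -
  interpret D: tour S "\<lambda>x y. A y x" by (rule dual_tour)
  show ?thesis
    by unfold_locales (use x_in ind_S critical ind_del card_S ind_dual in auto)
qed

lemma no_twins: "p \<in> S \<Longrightarrow> q \<in> S \<Longrightarrow> p \<noteq> q \<Longrightarrow> \<not> twins A S p q"
  using ind_no_twins[OF ind_S] card_S by simp

lemma no_source: "p \<in> S \<Longrightarrow> \<not> source A S p"
  using ind_no_source[OF ind_S] card_S by simp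

lemma no_sink: "p \<in> S \<Longrightarrow> \<not> sink A S p"
  using ind_no_sink[OF ind_S] card_S by simp

lemma card_del: "4 \<le> card (S - {v})"
  using card_S fin by (cases "v \<in> S") auto

lemma intv_trivial: "intv A S J \<Longrightarrow> a \<in> J \<Longrightarrow> b \<in> J \<Longrightarrow> a \<noteq> b \<Longrightarrow> v \<in> S \<Longrightarrow> v \<in> J"
  using indD[OF ind_S] by blast

text \<open>The complement of \<open>Z\<close> cannot be a single vertex: that vertex would be
  non-critical and different from \<open>x\<close>.\<close>

lemma extend_by_two:
  assumes Z: "ind A Z" "x \<in> Z" "Z \<subseteq> S" "3 \<le> card Z" "Z \<noteq> S"
  obtains a b where "a \<in> S - Z" "b \<in> S - Z" "a \<noteq> b" "ind A (insert a (insert b Z))"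
proof -
  obtain v where v: "v \<in> S" "v \<notin> Z" using Z by blast
  have "card (S - Z) \<noteq> 1"
  proof
    assume "card (S - Z) = 1"
    then obtain u where "S - Z = {u}" by (auto simp: card_1_singleton_iff)
    then have "Z = S - {u}" "u \<in> S" "u \<noteq> x" using Z by auto
    then show False using critical Z by blast
  qed
  moreover have "card (S - Z) \<noteq> 0" using v fin by auto
  ultimately have "2 \<le> card (S - Z)" by linarith
  from ind_extend_by_two[OF ind_S Z(1,3,4) this] show ?thesis using that by blast
qed

text \<open>Pairs are added until \<open>S\<close> is reached, and by \<open>extend_by_two\<close>
  the process stops nowhere else.\<close>

lemma parity:
  assumes Z: "ind A Z" "x \<in> Z" "Z \<subseteq> S" "3 \<le> card Z"
  shows "even (card (S - Z))"
  using Z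
proof (induction "card (S - Z)" arbitrary: Z rule: less_induct)
  case less
  show ?case
  proof (cases "Z = S")
    case False
    obtain a b where ab: "a \<in> S - Z" "b \<in> S - Z" "a \<noteq> b" "ind A (insert a (insert b Z))"
      using extend_by_two[OF less.prems False] .
    let ?Y = "insert a (insert b Z)"
    have "finite Z" using finite_subset less.prems fin by blast
    then have cY: "card ?Y = card Z + 2" using ab by simp
    have "card ?Y \<le> card S" using ab less.prems fin by (intro card_mono) auto
    then have c: "card (S - Z) = card (S - ?Y) + 2"
      using cY card_Diff_subset[of Z S] card_Diff_subset[of ?Y S] \<open>finite Z\<close> ab less.prems(3) by auto
    have "even (card (S - ?Y))"
      by (rule less.hyps) (use c ab less.prems cY in auto)
    then show ?thesis using c by simp
  qed simp
qed

text \<open>Adjacency in what is known as the indecomposability graph of the tournament.\<close>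

definition edge :: "'a \<Rightarrow> 'a \<Rightarrow> bool" where
  "edge a b \<longleftrightarrow> a \<in> S \<and> b \<in> S \<and> a \<noteq> b \<and> ind A (S - {a, b})"

section \<open>Edges at a critical vertex\<close>

lemma edge_sym: "edge a b \<longleftrightarrow> edge b a"
  unfolding edge_def by (auto simp: insert_commute)

text \<open>When \<open>Z\<close> grows to \<open>S\<close> by pairs, the pair added last is an
  edge, because its complement is the last set before \<open>S\<close>.\<close>

lemma edge_outside:
  assumes Z: "ind A Z" "x \<in> Z" "Z \<subseteq> S" "3 \<le> card Z" "Z \<noteq> S"
  shows "\<exists>c\<in>S - Z. \<exists>d\<in>S - Z. edge c d"
  using Z
proof (induction "card (S - Z)" arbitrary: Z rule: less_induct)
  case less
  obtain a b where ab: "a \<in> S - Z" "b \<in> S - Z" "a \<noteq> b" "ind A (insert a (insert b Z))"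
    using extend_by_two[OF less.prems] .
  let ?Y = "insert a (insert b Z)"
  show ?case
  proof (cases "?Y = S")
    case True
    then have "S - {a, b} = Z" using ab by auto
    then show ?thesis using ab less.prems unfolding edge_def by auto
  next
    case False
    have "finite Z" using finite_subset less.prems fin by blast
    then have cY: "card ?Y = card Z + 2" using ab by simp
    have "card (S - ?Y) < card (S - Z)"
      using ab fin by (intro psubset_card_mono) auto
    from less.hyps[OF this] have "\<exists>c\<in>S - ?Y. \<exists>d\<in>S - ?Y. edge c d"
      using ab less.prems cY False by auto
    then show ?thesis by blast
  qed
qed

lemma edge_card: "edge a b \<Longrightarrow> 3 \<le> card (S - {a, b})"
  using card_S card_Diff_subset[of "{a, b}" S] unfolding edge_def by auto

text \<open>Putting \<open>b\<close> back into \<open>S - {a, b}\<close> gives the decomposable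
  \<open>S - {a}\<close>, so one of the obstructions of \<open>ind_insert\<close> occurs. In the
  twin case, exchanging \<open>b\<close> and \<open>u\<close> turns the edge to \<open>b\<close>
  into an edge to \<open>u\<close>.\<close>

lemma edge_cases:
  assumes e: "edge a b" and a: "a \<noteq> x"
  obtains "source A (S - {a}) b" | "sink A (S - {a}) b"
  | u where "u \<in> S" "u \<noteq> a" "u \<noteq> b" "twins A (S - {a}) b u" "edge a u"
proof -
  have ab: "a \<in> S" "b \<in> S" "a \<noteq> b" "ind A (S - {a, b})" using e unfolding edge_def by auto
  have eq: "insert b (S - {a, b}) = S - {a}" using ab by auto
  have "\<not> ind A (insert b (S - {a, b}))" unfolding eq using critical ab a by blast
  then consider "source A (S - {a, b}) b" | "sink A (S - {a, b}) b" | u where "u \<in> S - {a, b}" "twins A (S - {a, b}) b u"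
    using ind_insert[OF ab(4) edge_card[OF e], of b] ab by auto
  then show ?thesis
  proof cases
    case 1 then show ?thesis using that(1) unfolding source_def by auto
  next
    case 2 then show ?thesis using that(2) unfolding source_def by auto
  next
    case (3 u)
    have t: "twins A (S - {a}) b u" using 3 unfolding twins_def by auto
    have "ind A (insert b (S - {a, b, u}))"
    proof (rule ind_twin_replace[where b = u])
      have "insert u (S - {a, b, u}) = S - {a, b}" using 3 ab by auto
      then show "ind A (insert u (S - {a, b, u}))" using ab by simp
      show "twins A (S - {a, b, u}) u b" using t twins_sym twins_mono[of _ u b "S - {a, b, u}"] by blast
    qed (use 3 ab in auto)
    moreover have "insert b (S - {a, b, u}) = S - {a, u}" using 3 ab by auto
    ultimately have "edge a u" using 3 ab unfolding edge_def by auto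
    then show ?thesis using that(3)[of u] 3 t by auto
  qed
qed

text \<open>The vertex \<open>b\<close> survives in the indecomposable set
  \<open>S - {a, c}\<close>, where it is neither extreme nor a twin of another vertex; so the twin
  found by \<open>edge_cases\<close> must be the deleted vertex \<open>c\<close>.\<close>

lemma edge_unique:
  assumes e: "edge a b" "edge a c" and "b \<noteq> c" "a \<noteq> x"
  shows "twins A (S - {a}) b c"
proof -
  have ab: "a \<in> S" "b \<in> S" "a \<noteq> b" "c \<in> S" "a \<noteq> c" "ind A (S - {a, c})" using e unfolding edge_def by auto
  have b: "b \<in> S - {a, c}" using ab assms by auto
  show ?thesis
    using e(1) \<open>a \<noteq> x\<close>
  proof (cases rule: edge_cases)
    case 1
    then have "source A (S - {a, c}) b" by (rule source_mono) blast
    then show ?thesis using ind_no_source[OF ab(6) edge_card[OF e(2)] b] by blast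
  next
    case 2
    then have "sink A (S - {a, c}) b" unfolding source_def by auto
    then show ?thesis using ind_no_sink[OF ab(6) edge_card[OF e(2)] b] by blast
  next
    case (3 u)
    show ?thesis
    proof (cases "u = c")
      case False
      have "twins A (S - {a, c}) b u" using 3(4) by (rule twins_mono) blast
      then show ?thesis using ind_no_twins[OF ab(6) edge_card[OF e(2)] b, of u] 3 False by blast
    qed (use 3 in simp)
  qed
qed

text \<open>The twins \<open>b\<close> and \<open>c\<close> would both lie in the indecomposable set
  \<open>S - {a, d}\<close>.\<close>

lemma edge_no_three:
  assumes "edge a b" "edge a c" "edge a d" "b \<noteq> c" "b \<noteq> d" "c \<noteq> d" "a \<noteq> x" shows False
proof -
  have "ind A (S - {a, d})" "c \<in> S - {a, d}" "b \<in> S - {a, d}" using assms unfolding edge_def by auto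
  moreover have "twins A (S - {a, d}) b c" using edge_unique[OF assms(1,2,4,7)] by (rule twins_mono) blast
  ultimately show False using ind_no_twins edge_card assms by blast
qed

text \<open>Rules out a closed path of edges avoiding \<open>x\<close>. With an odd number of
  vertices the closing twins merge the two parity classes, so the path is an interval missing
  \<open>x\<close>. With an even number, going round the path shows that \<open>v 2\<close> does not
  separate \<open>v 1\<close> from \<open>v 3\<close>, which are then twins in
  \<open>S\<close>.\<close>

lemma no_cycle:
  assumes c: "chain A S m v" and m: "2 \<le> m" and x: "x \<notin> v ` {..m}"
    and t0: "twins A (S - {v 0}) (v 1) (v m)" and tm: "twins A (S - {v m}) (v (m - 1)) (v 0)"
  shows False
proof -
  note ci = chain_in[OF c] and cn = chain_neq[OF c]
  show False
  proof (cases "even m")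
    case True
    have "A (v i) w = A (v 0) w" if "i \<le> m" "w \<in> S - v ` {..m}" for i w
    proof -
      have w: "w \<notin> v ` {i..j}" if "j \<le> m" for i j using \<open>w \<in> _\<close> that by auto
      have wn: "w \<noteq> v j" if "j \<le> m" for j using \<open>w \<in> _\<close> that by auto
      show ?thesis
      proof (cases "even i")
        case True
        then show ?thesis using chain_shift(2)[OF c, of 0 i w] w that by simp
      next
        case False
        then have "A (v i) w = A (v 1) w" using chain_shift(2)[OF c, of 1 i w] w that by (cases i) simp_all
        also have "\<dots> = A (v m) w" using twinsD(1)[OF t0, of w] wn m that ci by simp
        also have "\<dots> = A (v 0) w" using chain_shift(2)[OF c, of 0 m w] w that \<open>even m\<close> by simp
        finally show ?thesis .
      qed
    qed
    then have "intv A S (v ` {..m})" using ci by (intro intvI_const[where c = "A (v 0)"]) blast+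
    then have "x \<in> v ` {..m}" using intv_trivial[of "v ` {..m}" "v 0" "v 1" x] cn[of 0 1] m x_in by auto
    then show False using x by blast
  next
    case False
    then have m3: "3 \<le> m" using m by (cases "m = 2") auto
    have "A (v 2) (v 3) = A (v 2) (v m)"
      using chain_shift(1)[OF c, of 3 m "v 2"] chain_notin[OF c, of m 2 3] m3 False ci by auto
    also have "\<dots> = A (v 2) (v 1)"
      using twinsD(2)[OF t0, of "v 2"] m3 cn[of 2 0] cn[of 2 1] cn[of 2 m] ci[of 1] ci[of 2] ci[of m] False by auto
    finally have eq: "A (v 3) (v 2) = A (v 1) (v 2)"
      using asym[of "v 2" "v 3"] asym[of "v 2" "v 1"] cn[of 2 3] cn[of 2 1] ci m3 by simp
    have "twins A (S - {v 2}) (v 1) (v 3)"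
      using c m3 unfolding chain_def by (auto dest: spec[of _ 1] simp: numeral_eq_Suc)
    then have "twins A S (v 1) (v 3)" using eq unfolding twins_def by auto
    then show False using no_twins cn[of 1 3] ci m3 by simp
  qed
qed

text \<open>For even \<open>m\<close> the vertices \<open>v 1\<close> and \<open>v (m - 1)\<close>
  treat \<open>x\<close> alike, so both are sources, which clashes between them or at
  \<open>v 0\<close>. For odd \<open>m\<close> each parity class has constant arcs to the outside:
  two sources make the path an interval missing \<open>x\<close>, a source and a sink make its
  complement an interval.\<close>

lemma no_two_extreme_ends_source:
  assumes c: "chain A S m v" and m: "1 \<le> m" and x: "x \<notin> v ` {..m}"
    and e0: "source A (S - {v 0}) (v 1)"
    and em: "source A (S - {v m}) (v (m - 1)) \<or> sink A (S - {v m}) (v (m - 1))"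
  shows False
proof -
  note ci = chain_in[OF c] and cn = chain_neq[OF c]
  have v01: "A (v 0) (v 1)"
  proof (rule ccontr)
    assume "\<not> A (v 0) (v 1)"
    then have "A (v 1) (v 0)" using asym[of "v 0" "v 1"] cn[of 0 1] ci m by simp
    then have "source A S (v 1)" using e0 unfolding source_def by auto
    then show False using no_source ci m by simp
  qed
  have out: "w \<noteq> v j" "w \<notin> v ` {i..j}" if "w \<in> S - v ` {..m}" "j \<le> m" for w i j using that by auto
  have odd_out: "A (v i) w" if "w \<in> S - v ` {..m}" "i \<le> m" "odd i" for i w
  proof -
    have "A (v 1) w" using e0 out[OF that(1)] that m unfolding source_def by auto
    then show ?thesis using chain_shift(2)[OF c, of 1 i w] out[OF that(1)] that by (cases i) simp_all
  qed
  have xo: "x \<in> S - v ` {..m}" using x x_in by simp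
  show False
  proof (cases "even m")
    case True
    then have m2: "2 \<le> m" using m by (cases "m = 1") auto
    have "A (v (m - 1)) x" using odd_out[OF xo, of "m - 1"] True m2 by simp
    then have "\<not> A x (v (m - 1))" using asym[of x "v (m - 1)"] xo out(1)[OF xo, of "m - 1"] ci[of "m - 1"] by auto
    then have "\<not> sink A (S - {v m}) (v (m - 1))" using xo unfolding source_def by auto
    then have s: "source A (S - {v m}) (v (m - 1))" using em by blast
    show False
    proof (cases "m = 2")
      case True
      then have "A (v 1) (v 0)" using s cn[of 0 2] cn[of 0 1] ci unfolding source_def by auto
      then show False using v01 asym[of "v 0" "v 1"] cn[of 0 1] ci m2 by simp
    next
      case False
      then have m3: "3 < m" using m2 True by (cases "m = 3") auto
      have ne: "v (m - 1) \<noteq> v 1" "v (m - 1) \<noteq> v 0" "v 1 \<noteq> v m" using cn[of "m - 1" 1] cn[of "m - 1" 0] cn[of 1 m] m3 by auto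
      have "A (v 1) (v (m - 1))" using e0 ne ci[of "m - 1"] unfolding source_def by auto
      moreover have "A (v (m - 1)) (v 1)" using s ne ci[of 1] m3 unfolding source_def by auto
      ultimately show False using asym[of "v 1" "v (m - 1)"] ne ci m3 by simp
    qed
  next
    case False
    have even_out: "A (v i) w = A (v (m - 1)) w" if "w \<in> S - v ` {..m}" "i \<le> m" "even i" for i w
      using chain_shift(2)[OF c, of i "m - 1" w] out[OF that(1)] that False by (cases "i = m") auto
    have bd: "v (m - 1) \<noteq> v m" using cn[of "m - 1" m] m by simp
    from em show False
    proof
      assume s: "source A (S - {v m}) (v (m - 1))"
      have "A (v i) w" if "w \<in> S - v ` {..m}" "i \<le> m" for i w
      proof (cases "even i")
        case True
        have "A (v (m - 1)) w" using s out(1)[OF that(1)] that unfolding source_def by auto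
        then show ?thesis using even_out that True by blast
      qed (use odd_out that in blast)
      then have "intv A S (v ` {..m})" using ci by (intro intvI_const[where c = "\<lambda>_. True"]) auto
      then have "x \<in> v ` {..m}" using intv_trivial[of "v ` {..m}" "v 0" "v 1" x] cn[of 0 1] m x_in by auto
      then show False using x by blast
    next
      assume s: "sink A (S - {v m}) (v (m - 1))"
      have even_in: "A w (v i)" if "w \<in> S - v ` {..m}" "i \<le> m" "even i" for i w
      proof -
        have "A w (v (m - 1))" using s out(1)[OF that(1)] that unfolding source_def by auto
        then have "\<not> A (v (m - 1)) w" using asym[of w "v (m - 1)"] out(1)[OF that(1), of "m - 1"] that ci by auto
        then have "\<not> A (v i) w" using even_out that by blast
        then show ?thesis using asym[of w "v i"] out(1)[OF that(1), of i] that ci by auto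
      qed
      have "A p w = A q w" if "p \<in> S - v ` {..m}" "q \<in> S - v ` {..m}" "w \<in> v ` {..m}" for p q w
      proof -
        obtain i where i: "w = v i" "i \<le> m" using \<open>w \<in> v ` {..m}\<close> by auto
        show ?thesis
        proof (cases "even i")
          case True then show ?thesis using even_in i that by blast
        next
          case False
          then have "A w p" "A w q" using odd_out i that by blast+
          then show ?thesis using asym[of w p] asym[of w q] that i ci by blast
        qed
      qed
      then have iv: "intv A S (S - v ` {..m})" unfolding intv_def by blast
      \<comment> \<open>The complement of the path is an interval and misses the path, so it is a
        single vertex; then \<open>v 0\<close> turns out to be a source of
        \<open>T - x\<close>.\<close>
      have "S - v ` {..m} = {x}"
      proof (rule ccontr)
        assume "S - v ` {..m} \<noteq> {x}"
        then obtain y where "y \<in> S - v ` {..m}" "y \<noteq> x" using xo by auto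
        then have "v 0 \<in> S - v ` {..m}" using intv_trivial[OF iv xo, of y "v 0"] ci by auto
        then show False by simp
      qed
      then have Sx: "S - {x} = v ` {..m}" using ci by auto
      have "A (v 0) (v j)" if j: "0 < j" "j \<le> m" for j
      proof (cases "even j")
        case True
        have "v 0 \<notin> v ` {j..m - 1}" using chain_notin[OF c, of "m - 1" 0 j] j by auto
        then have "A (v 0) (v j) = A (v 0) (v (m - 1))"
          using chain_shift(1)[OF c, of j "m - 1" "v 0"] True False j ci by (cases "j = m") auto
        moreover have "A (v 0) (v (m - 1))"
          using s cn[of 0 "m - 1"] cn[of 0 m] ci[of 0] j True False m unfolding source_def by (cases "m = 1") auto
        ultimately show ?thesis by simp
      next
        case False
        have "v 0 \<notin> v ` {1..j}" using chain_notin[OF c, of "j" 0 1] j by auto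
        then have "A (v 0) (v j) = A (v 0) (v 1)"
          using chain_shift(1)[OF c, of 1 j "v 0"] False j ci by simp
        then show ?thesis using v01 by simp
      qed
      then have "source A (S - {x}) (v 0)" unfolding Sx source_def by (metis DiffE atMost_iff gr0I imageE singletonI)
      then show False using ind_no_source[OF ind_del, of "v 0"] card_del[of x] Sx by auto
    qed
  qed
qed

lemma no_two_extreme_ends:
  assumes c: "chain A S m v" and m: "1 \<le> m" and x: "x \<notin> v ` {..m}"
    and e0: "source A (S - {v 0}) (v 1) \<or> sink A (S - {v 0}) (v 1)"
    and em: "source A (S - {v m}) (v (m - 1)) \<or> sink A (S - {v m}) (v (m - 1))"
  shows False
proof -
  interpret D: critical_except S "\<lambda>x y. A y x" x by (rule dual_critical_except)
  show False
    using no_two_extreme_ends_source[OF c m x _ em] D.no_two_extreme_ends_source[of m v] e0 em c m x chain_dual by blast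
qed

text \<open>For even \<open>m\<close> the vertex \<open>v m\<close> does not separate
  \<open>x\<close> from \<open>v (m - 1)\<close>, so these are twins in \<open>S\<close>. For odd
  \<open>m\<close> the path together with \<open>x\<close> is an interval, hence all of
  \<open>S\<close>, and then \<open>v 0\<close> and \<open>v m\<close> are twins in
  \<open>T - x\<close>.\<close>

lemma no_cycle_through_x:
  assumes c: "chain A S m v" and m: "1 \<le> m" and x: "x \<notin> v ` {..m}"
    and t0: "twins A (S - {v 0}) (v 1) x" and tm: "twins A (S - {v m}) (v (m - 1)) x"
  shows False
proof -
  note ci = chain_in[OF c] and cn = chain_neq[OF c]
  have xn: "v i \<noteq> x" if "i \<le> m" for i using x that by auto
  show False
  proof (cases "even m")
    case True
    then have m2: "2 \<le> m" using m by (cases "m = 1") auto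
    have "A (v m) x = A (v m) (v 1)"
      using twinsD(2)[OF t0, of "v m"] cn[of m 0] cn[of m 1] ci[of m] ci[of 1] xn[of m] m2 x_in by auto
    also have "\<dots> = A (v m) (v (m - 1))"
      using chain_shift(1)[OF c, of 1 "m - 1" "v m"] chain_notin[OF c, of "m - 1" m 1] m2 True ci by auto
    finally have "A x (v m) = A (v (m - 1)) (v m)"
      using asym[of x "v m"] asym[of "v m" "v (m - 1)"] xn[of m] cn[of m "m - 1"] ci m2 x_in by auto
    then have "twins A S (v (m - 1)) x" using tm unfolding twins_def by auto
    then show False using no_twins xn[of "m - 1"] ci x_in by simp
  next
    case False
    have "A (v i) w = A x w" if "i \<le> m" "w \<in> S - insert x (v ` {..m})" for i w
    proof -
      have w: "w \<notin> v ` {i..j}" if "j \<le> m" for i j using \<open>w \<in> _\<close> that by auto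
      have wn: "w \<noteq> v j" if "j \<le> m" for j using \<open>w \<in> _\<close> that by auto
      show ?thesis
      proof (cases "even i")
        case True
        then have "A (v i) w = A (v (m - 1)) w"
          using chain_shift(2)[OF c, of i "m - 1" w] w that False by (cases "i = m") auto
        also have "\<dots> = A x w" using twinsD(1)[OF tm, of w] wn m that ci x_in by auto
        finally show ?thesis .
      next
        case odd: False
        then have "A (v i) w = A (v 1) w" using chain_shift(2)[OF c, of 1 i w] w that by (cases i) simp_all
        also have "\<dots> = A x w" using twinsD(1)[OF t0, of w] wn m that ci x_in by auto
        finally show ?thesis .
      qed
    qed
    then have "intv A S (insert x (v ` {..m}))" using ci x_in by (intro intvI_const[where c = "A x"]) blast+
    then have "w \<in> insert x (v ` {..m})" if "w \<in> S" for w
      using intv_trivial[of _ x "v 0" w] xn[of 0] that by auto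
    then have Sx: "S - {x} = v ` {..m}" using ci xn by auto
    have "A (v j) (v 0) = A (v j) (v m)" if j: "0 < j" "j < m" for j
    proof (cases "even j")
      case True
      have "A (v j) (v 0) = A (v (m - 1)) (v 0)"
        using chain_shift(2)[OF c, of j "m - 1" "v 0"] chain_notin[OF c, of "m - 1" 0 j] True False j ci by auto
      also have "\<dots> = A x (v 0)"
        using twinsD(1)[OF tm, of "v 0"] cn[of 0 m] cn[of 0 "m - 1"] xn[of 0] ci[of 0] ci[of "m - 1"] j x_in by auto
      finally have 1: "A (v j) (v 0) = A x (v 0)" .
      have "A (v j) (v m) = A (v 0) (v m)"
        using chain_shift(2)[OF c, of 0 j "v m"] chain_notin[OF c, of j m 0] True j ci by auto
      also have "\<dots> = A (v 0) (v 1)"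
        using chain_shift(1)[OF c, of 1 m "v 0"] chain_notin[OF c, of m 0 1] False j ci by auto
      finally have 2: "A (v j) (v m) = A (v 0) (v 1)" .
      \<comment> \<open>As \<open>v 1\<close> and \<open>x\<close> are not twins in
        \<open>S\<close>, the excepted vertex \<open>v 0\<close> separates them; this negation
        matches the reversal of the arc between \<open>v 0\<close> and \<open>v 1\<close>.\<close>
      have "A (v 1) (v 0) \<noteq> A x (v 0)"
      proof
        assume "A (v 1) (v 0) = A x (v 0)"
        then have "twins A S (v 1) x" using t0 unfolding twins_def by auto
        then show False using no_twins xn[of 1] ci[of 1] x_in m by simp
      qed
      then show ?thesis using 1 2 asym[of "v 0" "v 1"] cn[of 0 1] ci m by auto
    next
      case odd: False
      then have m3: "3 \<le> m" using j False by (cases "m = 2") auto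
      have "A (v j) (v m) = A (v 1) (v m)"
        using chain_shift(2)[OF c, of 1 j "v m"] chain_notin[OF c, of j m 1] odd j ci by auto
      also have "\<dots> = A x (v m)"
        using twinsD(1)[OF t0, of "v m"] cn[of m 0] cn[of m 1] xn[of m] ci[of m] ci[of 1] m3 x_in by auto
      finally have 1: "A (v j) (v m) = A x (v m)" .
      have "A (v j) (v 0) = A (v m) (v 0)"
        using chain_shift(2)[OF c, of j m "v 0"] chain_notin[OF c, of m 0 j] odd False j ci by auto
      also have "\<dots> = A (v m) (v (m - 1))"
        using chain_shift(1)[OF c, of 0 "m - 1" "v m"] chain_notin[OF c, of "m - 1" m 0] False j ci by auto
      finally have 2: "A (v j) (v 0) = A (v m) (v (m - 1))" .
      have "A (v (m - 1)) (v m) \<noteq> A x (v m)"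
      proof
        assume "A (v (m - 1)) (v m) = A x (v m)"
        then have "twins A S (v (m - 1)) x" using tm unfolding twins_def by auto
        then show False using no_twins xn[of "m - 1"] ci[of "m - 1"] x_in m by simp
      qed
      then show ?thesis using 1 2 asym[of "v m" "v (m - 1)"] cn[of m "m - 1"] ci m by auto
    qed
    then have "A (v 0) w = A (v m) w" if "w \<in> S - {x} - {v 0, v m}" for w
    proof -
      have "w \<in> v ` {..m}" using that Sx by blast
      then obtain j where j: "w = v j" "j \<le> m" by auto
      have "j \<noteq> 0" "j \<noteq> m" using that j by (metis DiffD2 insertI1 insertI2)+
      then have "0 < j" "j < m" using j by auto
      then have "A w (v 0) = A w (v m)" using j \<open>\<And>j. _ \<Longrightarrow> _ \<Longrightarrow> A (v j) (v 0) = A (v j) (v m)\<close> by simp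
      then show ?thesis using asym[of w "v 0"] asym[of w "v m"] that ci by auto
    qed
    then have "twins A (S - {x}) (v 0) (v m)" unfolding twins_def by blast
    then show False
      using ind_no_twins[OF ind_del, of "v 0" "v m"] card_del[of x] ci[of 0] ci[of m] xn[of 0] xn[of m] cn[of 0 m] m by auto
  qed
qed

end

text \<open>A source of \<open>S - {a m}\<close> is not a source of the indecomposable
  \<open>S\<close>, which explains the final arc. Sink arms are source arms of the converse
  relation, so facts about arms dualise by instantiation.\<close>

definition source_arm :: "('a \<Rightarrow> 'a \<Rightarrow> bool) \<Rightarrow> 'a set \<Rightarrow> 'a \<Rightarrow> nat \<Rightarrow> (nat \<Rightarrow> 'a) \<Rightarrow> bool" where
  "source_arm A S x m a \<longleftrightarrow> chain A S m a \<and> a 0 = x \<and> 1 \<le> m \<and>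
     source A (S - {a m}) (a (m - 1)) \<and> A (a m) (a (m - 1))"

abbreviation sink_arm :: "('a \<Rightarrow> 'a \<Rightarrow> bool) \<Rightarrow> 'a set \<Rightarrow> 'a \<Rightarrow> nat \<Rightarrow> (nat \<Rightarrow> 'a) \<Rightarrow> bool" where
  "sink_arm A \<equiv> source_arm (\<lambda>x y. A y x)"

section \<open>Longest paths of edges and the arms they form\<close>

context critical_except
begin

definition path :: "nat \<Rightarrow> (nat \<Rightarrow> 'a) \<Rightarrow> bool" where
  "path m v \<longleftrightarrow> inj_on v {..m} \<and> v ` {..m} \<subseteq> S - {x} \<and> (\<forall>i<m. edge (v i) (v (i + 1)))"

lemma path_in: "path m v \<Longrightarrow> i \<le> m \<Longrightarrow> v i \<in> S \<and> v i \<noteq> x"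
  unfolding path_def by auto

lemma path_edge: "path m v \<Longrightarrow> i < m \<Longrightarrow> edge (v i) (v (i + 1))"
  unfolding path_def by auto

lemma path_neq: "path m v \<Longrightarrow> i \<le> m \<Longrightarrow> j \<le> m \<Longrightarrow> i \<noteq> j \<Longrightarrow> v i \<noteq> v j"
  unfolding path_def inj_on_def by auto

lemma path_chain: assumes p: "path m v" shows "chain A S m v"
  unfolding chain_def
proof (intro conjI allI impI)
  show "inj_on v {..m}" "v ` {..m} \<subseteq> S" using p unfolding path_def by auto
  fix i assume i: "i + 2 \<le> m"
  have "edge (v i) (v (i + 1))" "edge (v (i + 1)) (v (i + 1 + 1))" using p i unfolding path_def by auto
  moreover have "v i \<noteq> v (i + 2)" using path_neq[OF p, of i "i + 2"] i by auto
  moreover have "v (i + 1) \<noteq> x" using path_in[OF p, of "i + 1"] i by simp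
  ultimately show "twins A (S - {v (i + 1)}) (v i) (v (i + 2))"
    using edge_unique[of "v (i + 1)" "v i" "v (i + 2)"] edge_sym by simp
qed

lemma path_Suc:
  assumes p: "path m v" and u: "u \<in> S" "u \<noteq> x" "u \<notin> v ` {..m}" "edge u (v 0)"
  shows "path (Suc m) (case_nat u v)"
  unfolding path_def
proof (intro conjI allI impI)
  show "inj_on (case_nat u v) {..Suc m}"
    using p u(3) unfolding path_def inj_on_def by (auto split: nat.splits)
  show "case_nat u v ` {..Suc m} \<subseteq> S - {x}" using p u unfolding path_def by (fastforce split: nat.splits)
  fix i assume "i < Suc m"
  then show "edge (case_nat u v i) (case_nat u v (i + 1))" using p u unfolding path_def by (auto split: nat.splits)
qed

lemma path_rev: assumes p: "path m v" shows "path m (\<lambda>i. v (m - i))"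
  unfolding path_def
proof (intro conjI allI impI)
  show "inj_on (\<lambda>i. v (m - i)) {..m}"
  proof (rule inj_onI)
    fix i j assume ij: "i \<in> {..m}" "j \<in> {..m}" "v (m - i) = v (m - j)"
    have "inj_on v {..m}" using p unfolding path_def by simp
    then have "m - i = m - j" using ij by (auto dest: inj_onD)
    then show "i = j" using ij by auto
  qed
  show "(\<lambda>i. v (m - i)) ` {..m} \<subseteq> S - {x}"
  proof
    fix y assume "y \<in> (\<lambda>i. v (m - i)) ` {..m}"
    then obtain i where "y = v (m - i)" by blast
    then show "y \<in> S - {x}" using path_in[OF p, of "m - i"] by simp
  qed
  fix i assume i: "i < m"
  then have "edge (v (m - (i + 1))) (v (m - (i + 1) + 1))" using p unfolding path_def by auto
  moreover have "m - (i + 1) + 1 = m - i" using i by simp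
  ultimately show "edge (v (m - i)) (v (m - (i + 1)))" using edge_sym by simp
qed

lemma rev_image: "(\<lambda>i. v (m - i)) ` {..m} = v ` {..m::nat}"
proof -
  have "(\<lambda>i. m - i) ` {..m} = {..m}"
  proof (intro set_eqI iffI)
    fix i assume "i \<in> {..m}"
    then show "i \<in> (\<lambda>i. m - i) ` {..m}" by (intro image_eqI[of _ _ "m - i"]) auto
  qed auto
  then show ?thesis by (metis image_image)
qed

text \<open>For a path that cannot be prolonged at \<open>v 0\<close>. By \<open>edge_cases\<close>
  a twin of \<open>v 1\<close> yields a second edge at \<open>v 0\<close>; it leads to
  \<open>x\<close> or back to the path, and there only to \<open>v m\<close>, since an inner vertex
  would get three edges.\<close>

lemma path_end:
  assumes p: "path m v" "1 \<le> m" and cl: "\<And>u. edge (v 0) u \<Longrightarrow> u \<noteq> x \<Longrightarrow> u \<in> v ` {..m}"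
  obtains "source A (S - {v 0}) (v 1) \<or> sink A (S - {v 0}) (v 1)"
  | "twins A (S - {v 0}) (v 1) x" | "2 \<le> m" "edge (v 0) (v m)"
proof -
  have e: "edge (v 0) (v 1)" and n: "v 0 \<noteq> x" using p path_in[OF p(1), of 0] unfolding path_def by auto
  from e n show ?thesis
  proof (cases rule: edge_cases)
    case (3 u)
    show ?thesis
    proof (cases "u = x")
      case False
      then obtain j where j: "u = v j" "j \<le> m" using cl 3 by auto
      then have j2: "2 \<le> j" using 3 by (cases j; cases "j - 1") auto
      show ?thesis
      proof (cases "j = m")
        case False
        have "edge (v (j - 1)) (v (j - 1 + 1))" "edge (v j) (v (j + 1))"
          using path_edge[OF p(1), of "j - 1"] path_edge[OF p(1), of j] j j2 False by auto
        then have "edge (v j) (v (j - 1))" "edge (v j) (v (j + 1))" "edge (v j) (v 0)" using edge_sym j j2 3 by auto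
        moreover have "v (j - 1) \<noteq> v (j + 1)" "v (j - 1) \<noteq> v 0" "v (j + 1) \<noteq> v 0"
          using chain_neq[OF path_chain[OF p(1)]] j j2 False by auto
        ultimately show ?thesis using edge_no_three[of "v j" "v (j - 1)" "v (j + 1)" "v 0"] path_in[OF p(1) j(2)] by auto
      qed (use that(3) 3 j j2 in auto)
    qed (use that(2) 3 in auto)
  qed (use that in auto)
qed

text \<open>Since no edge leaves it except towards \<open>x\<close>, two such arms are disjoint or have the same
  vertices.\<close>

definition closed_arm :: "nat \<Rightarrow> (nat \<Rightarrow> 'a) \<Rightarrow> bool" where
  "closed_arm m a \<longleftrightarrow> 2 \<le> m \<and> (source_arm A S x m a \<or> sink_arm A S x m a) \<and>
     (\<forall>i\<in>{1..m}. \<forall>u. edge (a i) u \<longrightarrow> u \<noteq> x \<longrightarrow> u \<in> a ` {1..m}) \<and>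
     (\<forall>i. 1 \<le> i \<longrightarrow> i < m \<longrightarrow> edge (a i) (a (i + 1)))"

text \<open>Putting \<open>x\<close> in front prolongs the chain because \<open>x\<close> and
  \<open>v 1\<close> are twins up to \<open>v 0\<close>. The final arc is forced since
  \<open>S\<close> has neither a source nor a sink.\<close>

lemma closed_arm_of_path:
  assumes p: "path m v" "1 \<le> m" and cl: "\<And>i u. i \<le> m \<Longrightarrow> edge (v i) u \<Longrightarrow> u \<noteq> x \<Longrightarrow> u \<in> v ` {..m}"
    and t: "twins A (S - {v 0}) (v 1) x" and s: "source A (S - {v m}) (v (m - 1)) \<or> sink A (S - {v m}) (v (m - 1))"
  shows "closed_arm (Suc m) (case_nat x v)"
proof -
  let ?a = "case_nat x v"
  have im: "?a ` {1..Suc m} = v ` {..m}"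
  proof -
    have "{1..Suc m} = Suc ` {..m}" by (simp add: image_Suc_atMost)
    then show ?thesis by (simp add: image_image)
  qed
  have c: "chain A S m v" by (rule path_chain[OF p(1)])
  have "chain A S (Suc m) ?a"
    unfolding chain_def
  proof (intro conjI allI impI)
    show "inj_on ?a {..Suc m}"
      using p(1) unfolding path_def inj_on_def by (auto split: nat.splits)
    show "?a ` {..Suc m} \<subseteq> S" using path_in[OF p(1)] x_in by (auto split: nat.splits)
    fix i assume "i + 2 \<le> Suc m"
    then show "twins A (S - {?a (i + 1)}) (?a i) (?a (i + 2))"
      using t c twins_sym unfolding chain_def by (auto split: nat.splits)
  qed
  moreover have "?a (Suc m) = v m" "?a (Suc m - 1) = v (m - 1)" using p(2) by (auto split: nat.splits)
  moreover have "A (v m) (v (m - 1))" if "source A (S - {v m}) (v (m - 1))"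
  proof (rule ccontr)
    assume "\<not> A (v m) (v (m - 1))"
    then have "A (v (m - 1)) (v m)"
      using asym[of "v m" "v (m - 1)"] chain_neq[OF c, of m "m - 1"] chain_in[OF c] p(2) by auto
    then have "source A S (v (m - 1))" using that unfolding source_def by auto
    then show False using no_source chain_in[OF c] by auto
  qed
  moreover have "A (v (m - 1)) (v m)" if "sink A (S - {v m}) (v (m - 1))"
  proof (rule ccontr)
    assume "\<not> A (v (m - 1)) (v m)"
    then have "A (v m) (v (m - 1))"
      using asym[of "v m" "v (m - 1)"] chain_neq[OF c, of m "m - 1"] chain_in[OF c] p(2) by auto
    then have "sink A S (v (m - 1))" using that unfolding source_def by auto
    then show False using no_sink chain_in[OF c] by auto
  qed
  ultimately have "source_arm A S x (Suc m) ?a \<or> sink_arm A S x (Suc m) ?a"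
    using s chain_dual unfolding source_arm_def by auto
  moreover have "u \<in> ?a ` {1..Suc m}" if "i \<in> {1..Suc m}" "edge (?a i) u" "u \<noteq> x" for i u
    unfolding im using cl[of "i - 1" u] that by (cases i) auto
  moreover have "edge (?a i) (?a (i + 1))" if "1 \<le> i" "i < Suc m" for i
    using p(1) that unfolding path_def by (cases i) auto
  ultimately show ?thesis unfolding closed_arm_def using p(2) by auto
qed

text \<open>A longest path through \<open>c\<close> is closed under edges except towards
  \<open>x\<close>: at its ends by maximality, inside because no vertex has three edges. Closed
  paths, two extreme ends and two returns to \<open>x\<close> are excluded, so one end returns to
  \<open>x\<close> and the other is extreme.\<close>

lemma closed_arm_exists:
  assumes e: "edge c d" and x: "c \<noteq> x" "d \<noteq> x"
  obtains m a where "closed_arm m a" "c \<in> a ` {1..m}"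
proof -
  define P where "P = (\<lambda>(m, v). path m v \<and> 1 \<le> m \<and> c \<in> v ` {..m})"
  have P1: "P (1, \<lambda>i. if i = 0 then c else d)"
    using e x unfolding P_def path_def edge_def by (auto simp: inj_on_def atMost_Suc)
  have "m \<le> card S" if "path m v" for m v
  proof -
    have "inj_on v {..m}" "v ` {..m} \<subseteq> S" using that unfolding path_def by auto
    then show ?thesis using card_inj_on_le[of v "{..m}" S] fin by simp
  qed
  then have "\<forall>y. P y \<longrightarrow> fst y < Suc (card S)" unfolding P_def by (auto simp: less_Suc_eq_le)
  then obtain m v where P: "P (m, v)" and mx: "\<And>m' v'. P (m', v') \<Longrightarrow> m' \<le> m"
    using ex_has_greatest_nat[of P _ fst "Suc (card S)", OF P1] by fastforce
  have p: "path m v" "1 \<le> m" and cv: "c \<in> v ` {..m}" using P P_def by auto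
  note ch = path_chain[OF p(1)]
  have no_ext: "u \<in> w ` {..m}" if pw: "path m w" "w ` {..m} = v ` {..m}" "edge (w 0) u" "u \<noteq> x" for u w
  proof (rule ccontr)
    assume "u \<notin> w ` {..m}"
    then have "path (Suc m) (case_nat u w)" using path_Suc[of m w u] pw edge_sym unfolding edge_def by blast
    moreover have "c \<in> case_nat u w ` {..Suc m}"
    proof -
      have "c \<in> w ` {..m}" using cv pw(2) by simp
      then obtain i where "c = w i" "i \<le> m" by auto
      then show ?thesis by (auto intro!: image_eqI[of _ _ "Suc i"])
    qed
    ultimately have "P (Suc m, case_nat u w)" unfolding P_def by simp
    then show False using mx by fastforce
  qed
  let ?r = "\<lambda>i. v (m - i)"
  note pr = path_rev[OF p(1)] and ri = rev_image[of v m]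
  have cl: "u \<in> v ` {..m}" if "i \<le> m" "edge (v i) u" "u \<noteq> x" for i u
  proof (rule ccontr)
    assume u: "u \<notin> v ` {..m}"
    consider "i = 0" | "i = m" | "0 < i" "i < m" using \<open>i \<le> m\<close> by linarith
    then show False
    proof cases
      case 1 then show ?thesis using no_ext[OF p(1) refl] that u by blast
    next
      case 2 then show ?thesis using no_ext[OF pr ri, of u] that u ri by simp
    next
      case 3
      then have "edge (v (i - 1)) (v (i - 1 + 1))" "edge (v i) (v (i + 1))"
        using path_edge[OF p(1), of "i - 1"] path_edge[OF p(1), of i] by auto
      then have "edge (v i) (v (i - 1))" "edge (v i) (v (i + 1))" using edge_sym 3 by auto
      moreover have "v (i - 1) \<noteq> v (i + 1)" using chain_neq[OF ch, of "i - 1" "i + 1"] 3 by auto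
      moreover have "v (i - 1) \<noteq> u" "v (i + 1) \<noteq> u" using u 3 by auto
      ultimately show ?thesis
        using edge_no_three[of "v i" "v (i - 1)" "v (i + 1)" u] that path_in[OF p(1), of i] by auto
    qed
  qed
  have xv: "x \<notin> v ` {..m}" using path_in[OF p(1)] by auto
  have not_closed: "\<not> (2 \<le> m \<and> edge (v 0) (v m))"
  proof
    assume *: "2 \<le> m \<and> edge (v 0) (v m)"
    have "edge (v 0) (v 1)" "edge (v (m - 1)) (v (m - 1 + 1))"
      using path_edge[OF p(1), of 0] path_edge[OF p(1), of "m - 1"] * by auto
    then have "edge (v 0) (v 1)" "edge (v m) (v (m - 1))" using edge_sym p by auto
    then have "twins A (S - {v 0}) (v 1) (v m)" "twins A (S - {v m}) (v (m - 1)) (v 0)"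
      using edge_unique[of "v 0" "v 1" "v m"] edge_unique[of "v m" "v (m - 1)" "v 0"] * edge_sym
        chain_neq[OF ch, of 1 m] chain_neq[OF ch, of "m - 1" 0] path_in[OF p(1)] by auto
    then show False using no_cycle[OF ch _ xv] * by blast
  qed
  have 0: "(source A (S - {v 0}) (v 1) \<or> sink A (S - {v 0}) (v 1)) \<or> twins A (S - {v 0}) (v 1) x"
    using path_end[OF p] cl[of 0] not_closed by (metis le0)
  have nr: "\<not> (2 \<le> m \<and> edge (?r 0) (?r m))" using not_closed edge_sym by simp
  have cr: "u \<in> ?r ` {..m}" if "edge (?r 0) u" "u \<noteq> x" for u
    unfolding ri by (rule cl[of m]) (use that in auto)
  have "(source A (S - {v (m - 0)}) (v (m - 1)) \<or> sink A (S - {v (m - 0)}) (v (m - 1))) \<or> twins A (S - {v (m - 0)}) (v (m - 1)) x"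
    by (rule path_end[OF pr p(2)]) (use nr cr in \<open>(assumption | blast)+\<close>)
  then have 1: "(source A (S - {v m}) (v (m - 1)) \<or> sink A (S - {v m}) (v (m - 1))) \<or> twins A (S - {v m}) (v (m - 1)) x"
    by simp
  \<comment> \<open>The two remaining combinations are mirror images; the second is stated for the
    reversed path.\<close>
  consider "twins A (S - {v 0}) (v 1) x" "source A (S - {v m}) (v (m - 1)) \<or> sink A (S - {v m}) (v (m - 1))"
    | "twins A (S - {?r 0}) (?r 1) x" "source A (S - {?r m}) (?r (m - 1)) \<or> sink A (S - {?r m}) (?r (m - 1))"
  proof -
    have "m - 0 = m" "m - m = 0" "m - (m - 1) = 1" using p(2) by auto
    then show ?thesis
      using that 0 1 no_two_extreme_ends[OF ch p(2) xv] no_cycle_through_x[OF ch p(2) xv] by metis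
  qed
  then show ?thesis
  proof cases
    case 1
    have "c \<in> case_nat x v ` {1..Suc m}"
    proof -
      obtain i where "c = v i" "i \<le> m" using cv by auto
      then show ?thesis by (auto intro!: image_eqI[of _ _ "Suc i"])
    qed
    moreover have "closed_arm (Suc m) (case_nat x v)"
      by (rule closed_arm_of_path[OF p _ 1]) (rule cl)
    ultimately show ?thesis using that by blast
  next
    case 2
    have "c \<in> case_nat x ?r ` {1..Suc m}"
    proof -
      obtain i where "c = ?r i" "i \<le> m" using cv ri by (metis (no_types, lifting) atMost_iff imageE)
      then show ?thesis by (auto intro!: image_eqI[of _ _ "Suc i"])
    qed
    moreover have "closed_arm (Suc m) (case_nat x ?r)"
    proof (rule closed_arm_of_path[OF pr p(2) _ 2])
      fix i u assume "edge (?r i) u" "u \<noteq> x"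
      then show "u \<in> ?r ` {..m}" unfolding ri using cl[of "m - i" u] by simp
    qed
    ultimately show ?thesis using that by blast
  qed
qed

text \<open>Consecutive vertices of \<open>b\<close> form edges, and no edge leaves \<open>a\<close>
  except towards \<open>x\<close>, so membership in \<open>a\<close> is constant along
  \<open>b\<close>.\<close>

lemma closed_arms_disjoint:
  assumes a: "closed_arm m a" and b: "closed_arm l b" and n: "b k \<notin> a ` {1..m}" and k: "k \<in> {1..l}"
  shows "a ` {1..m} \<inter> b ` {1..l} = {}"
proof -
  have step: "b i \<in> a ` {1..m} \<longleftrightarrow> b (i + 1) \<in> a ` {1..m}" if i: "1 \<le> i" "i < l" for i
  proof -
    have "edge (b i) (b (i + 1))" using b i unfolding closed_arm_def by auto
    moreover have "b i \<noteq> x" "b (i + 1) \<noteq> x"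
    proof -
      have "chain A S l b" "b 0 = x" using b chain_dual unfolding closed_arm_def source_arm_def by auto
      then show "b i \<noteq> x" "b (i + 1) \<noteq> x" using chain_neq[of l b _ 0] i by auto
    qed
    ultimately show ?thesis using a edge_sym unfolding closed_arm_def by (metis imageE)
  qed
  have "b (1 + i) \<in> a ` {1..m} \<longleftrightarrow> b 1 \<in> a ` {1..m}" if "1 + i \<le> l" for i
    using that by (induction i) (use step in auto)
  then have *: "b i \<in> a ` {1..m} \<longleftrightarrow> b 1 \<in> a ` {1..m}" if "1 \<le> i" "i \<le> l" for i
    using that by (metis le_Suc_ex)
  have "b i \<notin> a ` {1..m}" if "i \<in> {1..l}" for i
    using n k that *[of i] *[of k] by simp
  then have "y \<notin> a ` {1..m}" if "y \<in> b ` {1..l}" for y using that by (metis imageE)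
  then show ?thesis by blast
qed

end

section \<open>Arcs along an arm\<close>

context tour
begin

context
  fixes x m a
  assumes arm: "source_arm A S x m a"
begin

lemma arm_chain: "chain A S m a" and arm_0: "a 0 = x" and arm_pos: "1 \<le> m"
  and arm_source: "source A (S - {a m}) (a (m - 1))" and arm_last: "A (a m) (a (m - 1))"
  using arm unfolding source_arm_def by auto

lemma arm_in: "i \<le> m \<Longrightarrow> a i \<in> S"
  by (rule chain_in[OF arm_chain])

lemma arm_neq: "i \<le> m \<Longrightarrow> j \<le> m \<Longrightarrow> i \<noteq> j \<Longrightarrow> a i \<noteq> a j"
  by (rule chain_neq[OF arm_chain])

lemma arm_same:
  assumes "i \<le> m" "j \<le> m" "even (i + j)" "w \<in> S" "w \<notin> a ` {..m}"
  shows "A w (a i) = A w (a j)" "A (a i) w = A (a j) w"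
proof -
  have *: "A w (a i) = A w (a j) \<and> A (a i) w = A (a j) w" if "i \<le> j" "j \<le> m" "even (i + j)" for i j
  proof -
    have "w \<notin> a ` {i..j}" using that assms by auto
    then show ?thesis using chain_shift[OF arm_chain that assms(4)] by blast
  qed
  show "A w (a i) = A w (a j)" "A (a i) w = A (a j) w"
  proof -
    have "even (j + i)" using assms(3) by (simp add: add.commute)
    then have "A w (a i) = A w (a j) \<and> A (a i) w = A (a j) w"
      using *[of i j] *[of j i] assms(1-3) by (cases i j rule: linorder_le_cases) blast+
    then show "A w (a i) = A w (a j)" "A (a i) w = A (a j) w" by blast+
  qed
qed

text \<open>Such an index has the parity of \<open>m - 1\<close>, and \<open>a (m - 1)\<close> is
  the source up to \<open>a m\<close>.\<close>

lemma arm_out: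
  assumes "i \<le> m" "odd (i + m)" "w \<in> S" "w \<notin> a ` {..m}"
  shows "A (a i) w"
proof -
  have "even (i + (m - 1))" using assms arm_pos by (cases m) auto
  then have "A (a i) w = A (a (m - 1)) w" using arm_same(2)[of i "m - 1" w] assms by auto
  moreover have "w \<noteq> a m" "w \<noteq> a (m - 1)" using assms by auto
  ultimately show ?thesis using arm_source assms unfolding source_def by auto
qed

text \<open>Either the larger index shifts to \<open>m - 1\<close>, the source, or the larger shifts
  to \<open>m\<close> and the smaller to \<open>m - 1\<close>, where the final arc of the arm
  decides.\<close>

lemma arm_arc:
  assumes ij: "i < j" "j \<le> m" and p: "odd (i + m) \<or> odd (j + m)"
  shows "A (a j) (a i)"
proof (cases "odd (j + m)")
  case True
  then have "A (a j) (a i) = A (a (m - 1)) (a i)"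
    using chain_shift(2)[OF arm_chain, of j "m - 1" "a i"] chain_notin[OF arm_chain, of "m - 1" i j] ij arm_in[of i]
    by (cases "j = m") auto
  moreover have "j \<noteq> m" using True by auto
  then have "a i \<noteq> a m" "a i \<noteq> a (m - 1)" using arm_neq[of i m] arm_neq[of i "m - 1"] ij by auto
  then have "A (a (m - 1)) (a i)" using arm_source arm_in[of i] ij unfolding source_def by auto
  ultimately show ?thesis by simp
next
  case False
  then have i: "odd (i + m)" using p by blast
  have "A (a j) (a i) = A (a m) (a i)"
    using chain_shift(2)[OF arm_chain, of j m "a i"] chain_notin[OF arm_chain, of m i j] ij False arm_in[of i] by auto
  also have "\<dots> = A (a m) (a (m - 1))"
    using chain_shift(1)[OF arm_chain, of i "m - 1" "a m"] chain_notin[OF arm_chain, of "m - 1" m i] ij i arm_in[of m]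
    by auto
  finally show ?thesis using arm_last by simp
qed

text \<open>The arcs that \<open>arm_arc\<close> leaves open form a single bit: both indices shift
  down to \<open>s\<close> and \<open>s + 2\<close>, with \<open>s\<close> the least index of the
  parity of \<open>m\<close>.\<close>

lemma arm_bit:
  assumes ij: "i < j" "j \<le> m" and p: "even (i + m)" "even (j + m)" and s: "s \<le> 1" "even (s + m)"
  shows "A (a i) (a j) = A (a s) (a (s + 2))"
proof -
  have si: "s \<le> i" "even (s + i)" "s + 2 \<le> j" "even (s + 2 + j)"
  proof -
    show e: "even (s + i)" "even (s + 2 + j)" using p s by auto
    show si: "s \<le> i" using e s by (cases i) auto
    have "even (i + j)" using p by auto
    then have "i + 2 \<le> j" using ij by (cases "j = i + 1") auto
    then show "s + 2 \<le> j" using si by simp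
  qed
  have "A (a i) (a j) = A (a s) (a j)"
    using chain_shift(2)[OF arm_chain, of s i "a j"] chain_notin[OF arm_chain, of i j s] si ij arm_in[of j] by auto
  also have "\<dots> = A (a s) (a (s + 2))"
    using chain_shift(1)[OF arm_chain, of "s + 2" j "a s"] chain_notin[OF arm_chain, of j s "s + 2"] si ij arm_in[of s]
    by auto
  finally show ?thesis .
qed

text \<open>Two vertices are added at a time: the next one has the parity of \<open>m - 1\<close>
  and is a source of the set built so far, and the one after it copies its predecessor by two. This
  is the situation of \<open>ind_extend_pair_source\<close>, whatever the bit of the arm.\<close>

lemma ind_arm_extend:
  assumes s: "even (s + m)" "s \<le> m" and Z: "ind A Z" "3 \<le> card Z" "Z \<subseteq> S" "a s \<in> Z"
    and d: "\<And>i. s < i \<Longrightarrow> i \<le> m \<Longrightarrow> a i \<notin> Z"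
  shows "ind A (Z \<union> a ` {s..m})"
proof -
  have "ind A (Z \<union> a ` {s..s + 2 * t})" if "s + 2 * t \<le> m" for t
    using that
  proof (induction t)
    case 0
    have "Z \<union> a ` {s..s + 2 * 0} = Z" using Z by auto
    then show ?case using Z by simp
  next
    case (Suc t)
    let ?j = "s + 2 * t"
    let ?Z = "Z \<union> a ` {s..?j}"
    have fZ: "finite ?Z" using Z fin finite_subset by auto
    have in_Z: "a i \<in> ?Z \<Longrightarrow> i \<le> m \<Longrightarrow> i \<le> ?j" for i
    proof (rule ccontr)
      assume i: "a i \<in> ?Z" "i \<le> m" "\<not> i \<le> ?j"
      then have "a i \<notin> Z" using d by auto
      then obtain i' where "a i = a i'" "i' \<le> ?j" using i by auto
      then show False using arm_neq[of i i'] i Suc.prems by auto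
    qed
    have "ind A (insert (a (?j + 1)) (insert (a (?j + 2)) ?Z))"
    proof (rule ind_extend_pair_source[where w = "a ?j"])
      show "ind A ?Z" using Suc by simp
      show "3 \<le> card ?Z" using Z(2) card_mono[OF fZ, of Z] by simp
      show "?Z \<subseteq> S" using Z arm_in Suc.prems by auto
      show "a ?j \<in> ?Z" by simp
      show "a (?j + 1) \<in> S" "a (?j + 2) \<in> S" using arm_in Suc.prems by auto
      show "a (?j + 1) \<notin> ?Z" "a (?j + 2) \<notin> ?Z" using in_Z[of "?j + 1"] in_Z[of "?j + 2"] Suc.prems by auto
      show "source A ?Z (a (?j + 1))"
        unfolding source_def
      proof
        fix z assume z: "z \<in> ?Z - {a (?j + 1)}"
        show "A (a (?j + 1)) z"
        proof (cases "z \<in> a ` {..m}")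
          case True
          then obtain i where i: "z = a i" "i \<le> m" by auto
          have "a i \<in> ?Z" using z i(1) by simp
          then have "i \<le> ?j" using in_Z i(2) by blast
          then show ?thesis using arm_arc[of i "?j + 1"] i Suc.prems s by auto
        next
          case False
          moreover have "z \<in> S" using z Z arm_in Suc.prems by auto
          ultimately show ?thesis using arm_out[of "?j + 1" z] Suc.prems s by auto
        qed
      qed
      have "twins A (S - {a (?j + 1)}) (a ?j) (a (?j + 2))" using arm_chain Suc.prems unfolding chain_def by auto
      then have "twins A (S - {a (?j + 1)}) (a (?j + 2)) (a ?j)" using twins_sym by blast
      moreover have "?Z - {a ?j} \<subseteq> S - {a (?j + 1)}" using Z arm_in Suc.prems in_Z[of "?j + 1"] by auto
      ultimately show "twins A (?Z - {a ?j}) (a (?j + 2)) (a ?j)" by (rule twins_mono)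
      show "A (a (?j + 2)) (a (?j + 1))" using arm_arc[of "?j + 1" "?j + 2"] Suc.prems s by auto
      show "a (?j + 1) \<noteq> a (?j + 2)" using arm_neq Suc.prems by auto
    qed
    moreover have "{s..s + 2 * Suc t} = insert (?j + 1) (insert (?j + 2) {s..?j})" by auto
    ultimately show ?case by simp
  qed
  moreover obtain t where "m = s + 2 * t"
  proof -
    have "even (m - s)" using s by simp
    then show ?thesis using that[of "(m - s) div 2"] s(2) by simp
  qed
  ultimately show ?thesis by simp
qed

text \<open>Deleting an inner vertex makes its two neighbours on the arm twins; deleting the last
  one leaves the source \<open>a (m - 1)\<close>.\<close>

lemma arm_critical:
  assumes "4 \<le> card S" "1 \<le> i" "i \<le> m" shows "\<not> ind A (S - {a i})"
proof
  assume i: "ind A (S - {a i})"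
  have c: "3 \<le> card (S - {a i})" using assms arm_in[of i] fin by simp
  show False
  proof (cases "i = m")
    case True
    then show False
      using ind_no_source[OF i c, of "a (m - 1)"] arm_source arm_in[of "m - 1"] arm_neq[of "m - 1" m] arm_pos by auto
  next
    case False
    then have "i - 1 + 2 \<le> m" "i - 1 + 1 = i" using assms by auto
    then have "twins A (S - {a i}) (a (i - 1)) (a (i - 1 + 2))" using arm_chain unfolding chain_def by metis
    moreover have "i - 1 + 2 = i + 1" using assms by simp
    ultimately show False
      using ind_no_twins[OF i c, of "a (i - 1)" "a (i + 1)"] False assms arm_in
        arm_neq[of "i - 1" "i + 1"] arm_neq[of "i - 1" i] arm_neq[of i "i + 1"] by auto
  qed
qed

end

lemmas sink_arm_in = tour.arm_in[OF dual_tour]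
lemmas sink_arm_0 = tour.arm_0[OF dual_tour]
lemmas sink_arm_pos = tour.arm_pos[OF dual_tour]
lemmas sink_arm_neq = tour.arm_neq[OF dual_tour]
lemmas sink_arm_same = tour.arm_same[OF dual_tour]
lemmas sink_arm_out = tour.arm_out[OF dual_tour]
lemmas sink_arm_arc = tour.arm_arc[OF dual_tour]
lemmas sink_arm_bit = tour.arm_bit[OF dual_tour]

lemma ind_sink_arm_extend:
  assumes b: "sink_arm A S x l b" and s: "even (s + l)" "s \<le> l" and Z: "ind A Z" "3 \<le> card Z" "Z \<subseteq> S" "b s \<in> Z"
    and d: "\<And>i. s < i \<Longrightarrow> i \<le> l \<Longrightarrow> b i \<notin> Z"
  shows "ind A (Z \<union> b ` {s..l})"
proof -
  interpret D: tour S "\<lambda>x y. A y x" by (rule dual_tour)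
  have "Z \<union> b ` {s..l} \<subseteq> S" using Z sink_arm_in[OF b] by auto
  moreover have "ind (\<lambda>x y. A y x) (Z \<union> b ` {s..l})"
    using D.ind_arm_extend[OF b s _ Z(2-4) d] ind_dual Z by blast
  ultimately show ?thesis using ind_dual by blast
qed

lemma sink_arm_critical:
  assumes "sink_arm A S x l b" "4 \<le> card S" "1 \<le> i" "i \<le> l" shows "\<not> ind A (S - {b i})"
  using tour.arm_critical[OF dual_tour assms] ind_dual[of "S - {b i}"] by auto

end

section \<open>The three shapes\<close>

context tour
begin

lemma asymD: "A p q \<Longrightarrow> p \<in> S \<Longrightarrow> q \<in> S \<Longrightarrow> p \<noteq> q \<Longrightarrow> \<not> A q p"
  using asym by blast

text \<open>A common seed for four sets of six vertices. Here \<open>p\<close> is a source of the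
  3-cycle and \<open>q\<close> copies \<open>c1\<close>, which gives five vertices. The arcs at
  \<open>v\<close> differ between the four sets; the disjunctions say just enough to keep
  \<open>v\<close> from being a twin of \<open>c1\<close>, \<open>c3\<close> or
  \<open>p\<close>.\<close>

lemma ind_six:
  assumes dist: "distinct [c1, c2, c3, p, q, v]" and inS: "{c1, c2, c3, p, q, v} \<subseteq> S"
    and c: "A c1 c2" "A c2 c3" "A c3 c1" and p: "A p c1" "A p c2" "A p c3"
    and q: "A q p" "A q c2" "A c3 q" and v: "A v c1" "A p v"
    and v_c1: "A c2 v \<or> A v c3 \<or> A v q \<and> A q c1" and v_c3: "A v c2 \<or> A q v" and v_p: "A v q \<or> A c2 v \<or> A c3 v"
  shows "ind A {c1, c2, c3, p, q, v}" "card {c1, c2, c3, p, q, v} = 6"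
proof -
  let ?Z = "insert p (insert q {c1, c2, c3})"
  have n: "\<not> A y x" if "A x y" "x \<in> {c1, c2, c3, p, q, v}" "y \<in> {c1, c2, c3, p, q, v}" "x \<noteq> y" for x y
    using asymD that inS by blast
  have nc: "\<not> A c2 c1" "\<not> A c3 c2" "\<not> A c1 c3" "\<not> A p q" "\<not> A q c3" "\<not> A c1 v" "\<not> A v p"
    using n[OF c(1)] n[OF c(2)] n[OF c(3)] n[OF q(1)] n[OF q(3)] n[OF v(1)] n[OF v(2)] dist by auto
  have "ind A {c1, c2, c3}"
    by (rule ind_cycle) (use c dist inS in auto)
  then have Z: "ind A ?Z"
    by (rule ind_extend_pair_source[where w = c1])
      (use dist inS c p q nc in \<open>auto simp: source_def twins_def\<close>)
  have "ind A (insert v ?Z)"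
  proof (rule ind_insert[OF Z])
    show "3 \<le> card ?Z" "?Z \<subseteq> S" "v \<in> S" "v \<notin> ?Z" using dist inS by auto
    show "\<not> source A ?Z v" "\<not> sink A ?Z v" using v nc dist unfolding source_def by auto
    have c1: "\<not> A v c2 \<or> A v c3 \<or> A v q \<and> \<not> A c1 q" and c3: "A v c2 \<or> \<not> A v q" and p: "A v q \<or> \<not> A v c2 \<or> \<not> A v c3"
      using v_c1 v_c3 v_p n[of c2 v] n[of q c1] n[of q v] n[of c3 v] dist by auto
    fix u assume "u \<in> ?Z"
    then consider "u = c1" | "u = c2" | "u = c3" | "u = p" | "u = q" by blast
    then show "\<not> twins A ?Z v u"
    proof cases
      case 1 then show ?thesis unfolding twins_def using c1 c(1) nc(3) dist by auto
    next
      case 2 then show ?thesis unfolding twins_def using v(1) nc(1) dist by auto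
    next
      case 3 then show ?thesis unfolding twins_def using c3 q(3) nc(2) dist by auto
    next
      case 4 then show ?thesis unfolding twins_def using p assms(6-8) nc(4) dist by auto
    next
      case 5 then show ?thesis unfolding twins_def using q(1) nc(7) dist by auto
    qed
  qed
  moreover have "insert v ?Z = {c1, c2, c3, p, q, v}" by auto
  ultimately show "ind A {c1, c2, c3, p, q, v}" by simp
  show "card {c1, c2, c3, p, q, v} = 6" using distinct_card[OF dist] by simp
qed

end

text \<open>Both arms start in \<open>x\<close>, so they are disjoint only from index 1 on.\<close>

locale two_arms = tour +
  fixes x m a l b
  assumes a_arm: "source_arm A S x m a" and b_arm: "sink_arm A S x l b"
    and arms_disjoint: "a ` {1..m} \<inter> b ` {1..l} = {}"
begin

lemmas a_in = arm_in[OF a_arm] and b_in = sink_arm_in[OF b_arm]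
lemmas a_neq = arm_neq[OF a_arm] and b_neq = sink_arm_neq[OF b_arm]
lemmas a_0 = arm_0[OF a_arm] and b_0 = sink_arm_0[OF b_arm]
lemmas a_pos = arm_pos[OF a_arm] and b_pos = sink_arm_pos[OF b_arm]
lemmas a_same = arm_same[OF a_arm] and b_same = sink_arm_same[OF b_arm]
lemmas a_out = arm_out[OF a_arm] and b_out = sink_arm_out[OF b_arm]
lemmas a_arc = arm_arc[OF a_arm] and b_arc = sink_arm_arc[OF b_arm]
lemmas a_bit = arm_bit[OF a_arm] and b_bit = sink_arm_bit[OF b_arm]

lemma x_in_S: "x \<in> S"
  using a_in[of 0] a_0 by simp

lemma a_neq_x: "1 \<le> i \<Longrightarrow> i \<le> m \<Longrightarrow> a i \<noteq> x"
  using a_neq[of i 0] a_0 by auto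

lemma b_neq_x: "1 \<le> j \<Longrightarrow> j \<le> l \<Longrightarrow> b j \<noteq> x"
  using b_neq[of j 0] b_0 by auto

lemma x_notin_arms: "x \<notin> a ` {1..m}" "x \<notin> b ` {1..l}"
  using a_neq_x b_neq_x by (metis atLeastAtMost_iff imageE)+

lemma ab_neq: "1 \<le> i \<Longrightarrow> i \<le> m \<Longrightarrow> 1 \<le> j \<Longrightarrow> j \<le> l \<Longrightarrow> a i \<noteq> b j"
  using arms_disjoint by (metis IntI atLeastAtMost_iff empty_iff image_eqI)

lemmas ba_neq = ab_neq[symmetric]

lemma b_notin_a: assumes "1 \<le> j" "j \<le> l" shows "b j \<notin> a ` {..m}"
proof
  assume "b j \<in> a ` {..m}"
  then obtain i where i: "b j = a i" "i \<le> m" by auto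
  then show False using ab_neq[of i j] b_neq_x[of j] a_0 assms by (cases "i = 0") auto
qed

lemma a_notin_b: assumes "1 \<le> i" "i \<le> m" shows "a i \<notin> b ` {..l}"
proof
  assume "a i \<in> b ` {..l}"
  then obtain j where j: "a i = b j" "j \<le> l" by auto
  then show False using ab_neq[of i j] a_neq_x[of i] b_0 assms by (cases "j = 0") auto
qed

lemma a_out_b: "i \<le> m \<Longrightarrow> odd (i + m) \<Longrightarrow> 1 \<le> j \<Longrightarrow> j \<le> l \<Longrightarrow> A (a i) (b j)"
  by (rule a_out) (use b_notin_a b_in in auto)

lemma a_into_b: "j \<le> l \<Longrightarrow> odd (j + l) \<Longrightarrow> 1 \<le> i \<Longrightarrow> i \<le> m \<Longrightarrow> A (a i) (b j)"
  by (rule b_out) (use a_notin_b a_in in auto)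

text \<open>Index 0 is excluded because it stands for \<open>x\<close>, which lies on both arms,
  while a shift along one arm needs a vertex off that arm.\<close>

lemma ab_same:
  assumes "1 \<le> i" "i \<le> m" "1 \<le> i'" "i' \<le> m" "even (i + i')" "1 \<le> j" "j \<le> l" "1 \<le> j'" "j' \<le> l" "even (j + j')"
  shows "A (a i) (b j) = A (a i') (b j')" "A (b j) (a i) = A (b j') (a i')"
  using a_same[of i i' "b j"] b_same[of j j' "a i'"] b_notin_a a_notin_b a_in b_in assms by auto

lemma two_arms_subset: "insert x (a ` {1..m} \<union> b ` {1..l}) \<subseteq> S"
  using x_in_S a_in b_in by auto

lemma card_two_arms: "card (insert x (a ` {1..m} \<union> b ` {1..l})) = m + l + 1"
proof -
  have "inj_on a {1..m}" "inj_on b {1..l}"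
    using a_neq b_neq by (intro inj_onI; metis atLeastAtMost_iff)+
  then have "card (a ` {1..m} \<union> b ` {1..l}) = m + l"
    using card_Un_disjoint[of "a ` {1..m}" "b ` {1..l}"] arms_disjoint by (simp add: card_image)
  then show ?thesis using x_notin_arms by simp
qed

lemma a_critical: "4 \<le> card S \<Longrightarrow> i \<in> {1..m} \<Longrightarrow> \<not> ind A (S - {a i})"
  using arm_critical[OF a_arm] by auto

lemma b_critical: "4 \<le> card S \<Longrightarrow> j \<in> {1..l} \<Longrightarrow> \<not> ind A (S - {b j})"
  using sink_arm_critical[OF b_arm] by auto

text \<open>The growth along \<open>b\<close> starts from the result of the growth along
  \<open>a\<close>, which is possible because the arms share only \<open>x\<close>.\<close>

lemma ind_extend_arms:
  assumes Z: "ind A Z" "3 \<le> card Z" "Z \<subseteq> S"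
    and s: "even (s + m)" "s \<le> m" "a s \<in> Z" "\<And>i. s < i \<Longrightarrow> i \<le> m \<Longrightarrow> a i \<notin> Z"
    and t: "even (t + l)" "t \<le> l" "b t \<in> Z" "\<And>j. t < j \<Longrightarrow> j \<le> l \<Longrightarrow> b j \<notin> Z"
  shows "ind A (Z \<union> a ` {s..m} \<union> b ` {t..l})"
proof (rule ind_sink_arm_extend[OF b_arm t(1,2)])
  show "ind A (Z \<union> a ` {s..m})" using ind_arm_extend[OF a_arm s(1,2) Z s(3,4)] .
  have "finite (Z \<union> a ` {s..m})" using Z(3) fin finite_subset by auto
  then show "3 \<le> card (Z \<union> a ` {s..m})" using Z(2) card_mono[of "Z \<union> a ` {s..m}" Z] by simp
  show "Z \<union> a ` {s..m} \<subseteq> S" using Z a_in by auto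
  show "b t \<in> Z \<union> a ` {s..m}" using t by simp
  fix j assume j: "t < j" "j \<le> l"
  then have "b j \<notin> a ` {..m}" using b_notin_a by auto
  then show "b j \<notin> Z \<union> a ` {s..m}" using t(4) j by auto
qed

end

text \<open>The shape of \<open>E\<close> and \<open>F\<close>. With the opposite arc between
  \<open>a 1\<close> and \<open>b 1\<close>, the vertices of \<open>a\<close> other than
  \<open>x\<close> would dominate all others and form an interval.\<close>

locale odd_odd = two_arms +
  assumes odd_ml: "odd m" "odd l"
    and S_eq: "S = insert x (a ` {1..m} \<union> b ` {1..l})"
    and b1_a1: "A (b 1) (a 1)"
begin

lemma a_x: "1 \<le> i \<Longrightarrow> i \<le> m \<Longrightarrow> A (a i) x"
  using a_arc[of 0 i] a_0 odd_ml by auto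

lemma x_b: "1 \<le> j \<Longrightarrow> j \<le> l \<Longrightarrow> A x (b j)"
  using b_arc[of 0 j] b_0 odd_ml by auto

lemma b_a: "i \<le> m \<Longrightarrow> j \<le> l \<Longrightarrow> odd i \<Longrightarrow> odd j \<Longrightarrow> A (b j) (a i)"
  using ab_same(2)[of i 1 j 1] b1_a1 a_pos b_pos odd_pos[of i] odd_pos[of j] by auto

text \<open>The seed is the 3-cycle on \<open>x\<close>, \<open>b 1\<close> and \<open>a 1\<close>;
  both arms grow from index 1, which has the parity of their lengths.\<close>

lemma ind_all: "ind A S"
proof -
  have ne: "a 1 \<noteq> x" "b 1 \<noteq> x" "a 1 \<noteq> b 1" using a_neq_x b_neq_x ab_neq a_pos b_pos by auto
  have "ind A {x, b 1, a 1}"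
    by (rule ind_cycle) (use x_in_S a_in b_in a_pos b_pos a_x x_b b1_a1 ne in auto)
  moreover have "card {x, b 1, a 1} = 3" using ne by auto
  moreover have "a i \<notin> {x, b 1, a 1}" if "1 < i" "i \<le> m" for i
    using a_neq[of i 1] a_neq_x[of i] ab_neq[of i 1] b_pos that by auto
  moreover have "b j \<notin> {x, b 1, a 1}" if "1 < j" "j \<le> l" for j
    using b_neq[of j 1] b_neq_x[of j] ab_neq[of 1 j] a_pos that by auto
  ultimately have "ind A ({x, b 1, a 1} \<union> a ` {1..m} \<union> b ` {1..l})"
    using odd_ml a_pos b_pos a_in[of 1] b_in[of 1] x_in_S
    by (intro ind_extend_arms) simp_all
  moreover have "{x, b 1, a 1} \<union> a ` {1..m} \<union> b ` {1..l} = S" using S_eq a_pos b_pos by auto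
  ultimately show ?thesis by simp
qed

lemma critical_all:
  assumes "v \<in> S" "v \<noteq> x" "4 \<le> card S" shows "\<not> ind A (S - {v})"
  using assms a_critical b_critical S_eq by auto

text \<open>The seed is \<open>ind_six\<close> on the first three vertices of each arm, built on the
  3-cycle \<open>a 1\<close>, \<open>b 2\<close>, \<open>b 3\<close>. The assumption fixes the bit
  of \<open>b\<close>; that of \<open>a\<close> stays free.\<close>

lemma ind_del_x:
  assumes ml: "3 \<le> m" "3 \<le> l" and lin: "A (b 1) (b 3)"
  shows "ind A (S - {x})"
proof -
  let ?Z = "{a 1, b 2, b 3, a 2, a 3, b 1}"
  have Z: "?Z \<subseteq> S" using a_in b_in ml by auto
  have "distinct [a 1, b 2, b 3, a 2, a 3, b 1]"
    using a_neq b_neq ab_neq ba_neq ml by simp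
  then have "ind A ?Z" "card ?Z = 6"
    by (intro ind_six; use Z a_arc[of 1 2] a_arc[of 2 3] b_arc[of 1 2] b_arc[of 2 3] a_into_b[of 2 1]
        a_into_b[of 2 3] a_out_b[of 2] b_a lin ml odd_ml in simp)+
  moreover have "a i \<notin> ?Z" if "3 < i" "i \<le> m" for i
    using a_neq[of i 1] a_neq[of i 2] a_neq[of i 3] ab_neq[of i] ml that by auto
  moreover have "b j \<notin> ?Z" if "3 < j" "j \<le> l" for j
    using b_neq[of j 1] b_neq[of j 2] b_neq[of j 3] ab_neq[of _ j] ml that by (auto dest!: sym[of "b j"])
  ultimately have "ind A (?Z \<union> a ` {3..m} \<union> b ` {3..l})"
    using odd_ml ml Z
    by (intro ind_extend_arms) simp_all
  moreover have "?Z \<union> a ` {3..m} \<union> b ` {3..l} = S - {x}"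
  proof -
    have "{1..m} = insert 1 (insert 2 {3..m})" "{1..l} = insert 1 (insert 2 {3..l})" using ml by auto
    moreover have "S - {x} = a ` {1..m} \<union> b ` {1..l}" using S_eq x_notin_arms by auto
    ultimately show ?thesis using ml by auto
  qed
  ultimately show ?thesis by simp
qed

end

text \<open>The shape of \<open>G\<close>. The arc \<open>r_a1\<close> closes a 3-cycle on
  \<open>x\<close>, \<open>r\<close> and \<open>a 1\<close>; the arc from \<open>x\<close> to
  \<open>r\<close> is automatic because \<open>m\<close> is odd.\<close>

locale odd_even = two_arms +
  fixes r
  assumes parity_ml: "odd m" "even l"
    and r_in: "r \<in> S" "r \<noteq> x" "r \<notin> a ` {1..m}" "r \<notin> b ` {1..l}"
    and S_eq: "S = insert r (insert x (a ` {1..m} \<union> b ` {1..l}))"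
    and r_a1: "A r (a 1)"
begin

lemma l_ge_2: "2 \<le> l"
  using b_pos parity_ml by (cases "l = 1") auto

lemma r_notin: "r \<notin> a ` {..m}" "r \<notin> b ` {..l}"
proof -
  have "a ` {..m} \<subseteq> insert x (a ` {1..m})" "b ` {..l} \<subseteq> insert x (b ` {1..l})"
    using a_0 b_0 by (auto simp: image_iff) (metis One_nat_def Suc_leI atLeastAtMost_iff neq0_conv)+
  then show "r \<notin> a ` {..m}" "r \<notin> b ` {..l}" using r_in by blast+
qed

lemma r_neq: "i \<le> m \<Longrightarrow> r \<noteq> a i" "j \<le> l \<Longrightarrow> r \<noteq> b j"
  using r_notin by auto

lemma a_x: "1 \<le> i \<Longrightarrow> i \<le> m \<Longrightarrow> A (a i) x"
  using a_arc[of 0 i] a_0 parity_ml by auto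

lemma x_out: "w \<in> S \<Longrightarrow> w \<notin> a ` {..m} \<Longrightarrow> A x w"
  using a_out[of 0 w] a_0 parity_ml by auto

lemma x_b: "1 \<le> j \<Longrightarrow> j \<le> l \<Longrightarrow> A x (b j)"
  using x_out[of "b j"] b_notin_a b_in by auto

lemma x_r: "A x r"
  using x_out r_in r_notin by blast

text \<open>For even \<open>l\<close> the vertex \<open>x\<close>, being \<open>b 0\<close>, takes
  part in the bit of \<open>b\<close>, and the odd arm \<open>a\<close> makes \<open>x\<close>
  dominate everything off \<open>a\<close>; so the bit is determined.\<close>

lemma b_linear: assumes "i < j" "j \<le> l" shows "A (b i) (b j)"
proof (cases "odd (i + l) \<or> odd (j + l)")
  case True then show ?thesis using b_arc assms by blast
next
  case False
  then have "A (b j) (b i) = A (b 2) (b 0)" using b_bit[of i j 0] assms parity_ml by (simp add: numeral_2_eq_2)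
  moreover have "\<not> A (b 2) (b 0)"
    using x_b[of 2] b_0 asym[of x "b 2"] x_in_S b_in[of 2] b_neq_x[of 2] l_ge_2 by auto
  ultimately show ?thesis using asym[of "b i" "b j"] b_in b_neq assms by auto
qed

lemma a_b: assumes "1 \<le> i" "i \<le> m" "1 \<le> j" "j \<le> l" shows "A (a i) (b j)"
proof (cases "odd j")
  case True then show ?thesis using a_into_b assms parity_ml by auto
next
  case False
  then have "A (a i) (b j) = A (a i) (b 0)"
    using b_same(2)[of j 0 "a i"] a_notin_b a_in assms by auto
  then show ?thesis using a_x b_0 assms by simp
qed

lemma r_a: "odd i \<Longrightarrow> i \<le> m \<Longrightarrow> A r (a i)"
  using a_same(1)[of i 1 r] r_a1 r_in r_notin a_pos by auto

lemma a_r: "even i \<Longrightarrow> i \<le> m \<Longrightarrow> A (a i) r"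
  using a_out[of i r] r_in r_notin parity_ml by auto

lemma r_b: "odd j \<Longrightarrow> j \<le> l \<Longrightarrow> A r (b j)"
  using b_out[of j r] r_in r_notin parity_ml by auto

lemma b_r: "even j \<Longrightarrow> j \<le> l \<Longrightarrow> A (b j) r"
  using b_same(1)[of j 0 r] r_in r_notin x_r b_0 by auto

lemma ind_all: "ind A S"
proof -
  have ne: "a 1 \<noteq> x" "r \<noteq> x" "a 1 \<noteq> r" using a_neq_x r_in r_neq(1)[of 1] a_pos by auto
  have "ind A {x, r, a 1}"
    by (rule ind_cycle) (use x_in_S a_in a_pos r_in a_x x_r r_a1 ne in auto)
  moreover have "card {x, r, a 1} = 3" using ne by auto
  moreover have "a i \<notin> {x, r, a 1}" if "1 < i" "i \<le> m" for i
    using a_neq[of i 1] a_neq_x[of i] r_neq(1)[of i] that by auto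
  moreover have "b j \<notin> {x, r, a 1}" if "0 < j" "j \<le> l" for j
    using b_neq_x[of j] ab_neq[of 1 j] r_neq(2)[of j] a_pos that by auto
  ultimately have "ind A ({x, r, a 1} \<union> a ` {1..m} \<union> b ` {0..l})"
    using parity_ml a_pos b_0 a_in[of 1] r_in x_in_S
    by (intro ind_extend_arms) simp_all
  moreover have "{x, r, a 1} \<union> a ` {1..m} \<union> b ` {0..l} = S"
  proof -
    have "{0..l} = insert 0 {1..l}" by auto
    then show ?thesis using S_eq a_pos b_0 by auto
  qed
  ultimately show ?thesis by simp
qed

text \<open>Without \<open>r\<close>, all other vertices dominate the arm \<open>b\<close> stripped
  of \<open>x\<close>, which is then an interval of at least two vertices.\<close>

lemma critical_r: "\<not> ind A (S - {r})"
proof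
  assume i: "ind A (S - {r})"
  have sub: "b ` {1..l} \<subseteq> S - {r}" "x \<in> S - {r}" "x \<notin> b ` {1..l}"
    using b_in r_in x_in_S x_notin_arms by auto
  have out: "A w (b j)" if "w \<in> S - {r}" "w \<notin> b ` {1..l}" "1 \<le> j" "j \<le> l" for w j
    using that S_eq x_b a_b by auto
  have "intv A (S - {r}) (b ` {1..l})"
    unfolding intv_def
  proof (intro conjI ballI sub)
    fix p q w assume pq: "p \<in> b ` {1..l}" "q \<in> b ` {1..l}" "w \<in> S - {r} - b ` {1..l}"
    then have "A w p" "A w q" using out by auto
    then show "A p w = A q w" using asym[of w p] asym[of w q] pq sub by blast
  qed
  then have "b ` {1..l} = S - {r}"
    using indD[OF i, of "b ` {1..l}" "b 1" "b 2"] b_neq[of 1 2] l_ge_2 by auto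
  then show False using sub by blast
qed

lemma critical_all:
  assumes "v \<in> S" "v \<noteq> x" "4 \<le> card S" shows "\<not> ind A (S - {v})"
  using assms a_critical b_critical critical_r S_eq by auto

text \<open>The seed is \<open>ind_six\<close> on the 3-cycle \<open>b 1\<close>,
  \<open>b 2\<close>, \<open>r\<close> with \<open>a 2\<close>, \<open>a 3\<close> and
  \<open>a 1\<close>; the arms grow from indices 3 and 2. With the opposite bit, \<open>a 1\<close>
  and \<open>b 1\<close> would be twins in \<open>T - x\<close>.\<close>

lemma ind_del_x:
  assumes m: "3 \<le> m" and bit: "A (a 1) (a 3)"
  shows "ind A (S - {x})"
proof -
  note l = l_ge_2
  let ?Z = "{b 1, b 2, r, a 2, a 3, a 1}"
  have Z: "?Z \<subseteq> S" using a_in b_in r_in m l by auto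
  have "distinct [b 1, b 2, r, a 2, a 3, a 1]"
    using a_neq b_neq ba_neq r_neq r_neq(2)[symmetric] m l by simp
  then have "ind A ?Z" "card ?Z = 6"
    by (intro ind_six; use Z a_arc[of 1 2] a_arc[of 2 3] b_linear[of 1 2] a_b r_a r_b[of 1] b_r[of 2] a_r[of 2]
        bit m l parity_ml in simp)+
  moreover have "a i \<notin> ?Z" if "3 < i" "i \<le> m" for i
    using a_neq[of i 1] a_neq[of i 2] a_neq[of i 3] ab_neq[of i] r_neq(1)[of i] l that by auto
  moreover have "b j \<notin> ?Z" if "2 < j" "j \<le> l" for j
    using b_neq[of j 1] b_neq[of j 2] ab_neq[of _ j] r_neq(2)[of j] m that by (auto dest!: sym[of "b j"])
  ultimately have "ind A (?Z \<union> a ` {3..m} \<union> b ` {2..l})"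
    using parity_ml m l Z
    by (intro ind_extend_arms) simp_all
  moreover have "?Z \<union> a ` {3..m} \<union> b ` {2..l} = S - {x}"
  proof -
    have "{1..m} = insert 1 (insert 2 {3..m})" "{1..l} = insert 1 {2..l}" using m l by auto
    moreover have "S - {x} = insert r (a ` {1..m} \<union> b ` {1..l})" using S_eq x_notin_arms r_in by auto
    ultimately show ?thesis using m l by auto
  qed
  ultimately show ?thesis by simp
qed

end

locale two_even_arms = two_arms +
  assumes parity_ml: "even m" "even l" and x_b2: "A x (b 2)"
begin

lemma m_ge_2: "2 \<le> m"
  using a_pos parity_ml by (cases "m = 1") auto

lemma l_ge_2: "2 \<le> l"
  using b_pos parity_ml by (cases "l = 1") auto

lemma b_linear: assumes "i < j" "j \<le> l" shows "A (b i) (b j)"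
proof (cases "odd (i + l) \<or> odd (j + l)")
  case True then show ?thesis using b_arc assms by blast
next
  case False
  then have "A (b j) (b i) = A (b 2) (b 0)" using b_bit[of i j 0] assms parity_ml by (simp add: numeral_2_eq_2)
  moreover have "\<not> A (b 2) (b 0)"
    using x_b2 b_0 asym[of x "b 2"] x_in_S b_in[of 2] b_neq_x[of 2] l_ge_2 by auto
  ultimately show ?thesis using asym[of "b i" "b j"] b_in b_neq assms by auto
qed

text \<open>From \<open>b 2\<close> the vertices \<open>a 2\<close> and \<open>x\<close> look alike,
  and from \<open>a 2\<close> the vertices \<open>b 2\<close> and \<open>x\<close> do. So the bits
  of two even arms determine each other.\<close>

lemma a2_x: "A (a 2) x"
proof -
  have "A (a 2) (b 2) = A (a 0) (b 2)" using a_same(2)[of 2 0 "b 2"] b_notin_a[of 2] b_in[of 2] l_ge_2 m_ge_2 by auto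
  moreover have "A (a 2) (b 2) = A (a 2) (b 0)" using b_same(2)[of 2 0 "a 2"] a_notin_b[of 2] a_in[of 2] l_ge_2 m_ge_2 by auto
  ultimately show ?thesis using x_b2 a_0 b_0 by simp
qed

lemma a_linear: assumes "i < j" "j \<le> m" shows "A (a j) (a i)"
proof (cases "odd (i + m) \<or> odd (j + m)")
  case True then show ?thesis using a_arc assms by blast
next
  case False
  then have "A (a i) (a j) = A (a 0) (a 2)" using a_bit[of i j 0] assms parity_ml by (simp add: numeral_2_eq_2)
  moreover have "\<not> A (a 0) (a 2)"
    using a2_x a_0 asym[of x "a 2"] x_in_S a_in[of 2] a_neq_x[of 2] m_ge_2 by auto
  ultimately show ?thesis using asym[of "a i" "a j"] a_in a_neq assms by auto
qed

lemma a_x: "1 \<le> i \<Longrightarrow> i \<le> m \<Longrightarrow> A (a i) x"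
  using a_linear[of 0 i] a_0 by auto

lemma x_b: "1 \<le> j \<Longrightarrow> j \<le> l \<Longrightarrow> A x (b j)"
  using b_linear[of 0 j] b_0 by auto

lemma a_b: assumes "1 \<le> i" "i \<le> m" "1 \<le> j" "j \<le> l" shows "A (a i) (b j)"
proof (cases "odd j")
  case True then show ?thesis using a_into_b assms parity_ml by auto
next
  case False
  then have "A (a i) (b j) = A (a i) (b 0)"
    using b_same(2)[of j 0 "a i"] a_notin_b a_in assms by auto
  then show ?thesis using a_x b_0 assms by simp
qed

end

text \<open>The shape of \<open>H\<close>. The two arms alone form a transitive tournament, so a
  3-cycle through \<open>x\<close> has to be supplied by \<open>r\<close> and
  \<open>r'\<close>.\<close>

locale even_even = two_even_arms +
  fixes r r'
  assumes r_in: "r \<in> S" "r \<noteq> x" "r \<notin> a ` {1..m}" "r \<notin> b ` {1..l}"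
    and r'_in: "r' \<in> S" "r' \<noteq> x" "r' \<notin> a ` {1..m}" "r' \<notin> b ` {1..l}"
    and S_eq: "S = insert r (insert r' (insert x (a ` {1..m} \<union> b ` {1..l})))"
    and x_r: "A x r" and r_r': "A r r'" and r'_x: "A r' x"
begin

lemma r_notin: "r \<notin> a ` {..m}" "r \<notin> b ` {..l}" "r' \<notin> a ` {..m}" "r' \<notin> b ` {..l}"
proof -
  have "a ` {..m} \<subseteq> insert x (a ` {1..m})" "b ` {..l} \<subseteq> insert x (b ` {1..l})"
    using a_0 b_0 by (auto simp: image_iff) (metis One_nat_def Suc_leI atLeastAtMost_iff neq0_conv)+
  then show "r \<notin> a ` {..m}" "r \<notin> b ` {..l}" "r' \<notin> a ` {..m}" "r' \<notin> b ` {..l}" using r_in r'_in by blast+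
qed

lemma r_neq: "i \<le> m \<Longrightarrow> r \<noteq> a i" "j \<le> l \<Longrightarrow> r \<noteq> b j" "i \<le> m \<Longrightarrow> r' \<noteq> a i" "j \<le> l \<Longrightarrow> r' \<noteq> b j" "r \<noteq> r'"
proof -
  show "r \<noteq> r'" using x_r r'_x asym[of x r] x_in_S r_in by auto
qed (use r_notin in auto)

lemma a_r: assumes "i \<le> m" shows "A (a i) r"
proof (cases "odd i")
  case True then show ?thesis using a_out[of i r] r_in r_notin parity_ml assms by auto
next
  case False
  then show ?thesis using a_same(2)[of i 0 r] x_r r_in r_notin a_0 assms by auto
qed

lemma a_r': "odd i \<Longrightarrow> i \<le> m \<Longrightarrow> A (a i) r'" and r'_a: "even i \<Longrightarrow> i \<le> m \<Longrightarrow> A r' (a i)"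
  using a_out[of i r'] a_same(1)[of i 0 r'] r'_x r'_in r_notin a_0 parity_ml by auto

lemma r'_b: assumes "j \<le> l" shows "A r' (b j)"
proof (cases "odd j")
  case True then show ?thesis using b_out[of j r'] r'_in r_notin parity_ml assms by auto
next
  case False
  then show ?thesis using b_same(2)[of j 0 r'] r'_x r'_in r_notin b_0 assms by auto
qed

lemma r_b: "odd j \<Longrightarrow> j \<le> l \<Longrightarrow> A r (b j)" and b_r: "even j \<Longrightarrow> j \<le> l \<Longrightarrow> A (b j) r"
  using b_out[of j r] b_same(1)[of j 0 r] x_r r_in r_notin b_0 parity_ml by auto

lemma ind_all: "ind A S"
proof -
  have ne: "r \<noteq> x" "r' \<noteq> x" "r \<noteq> r'" using r_in r'_in r_neq by auto
  have "ind A {x, r, r'}"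
    by (rule ind_cycle) (use x_in_S r_in r'_in x_r r_r' r'_x ne in auto)
  moreover have "card {x, r, r'} = 3" using ne by auto
  moreover have "a i \<notin> {x, r, r'}" if "0 < i" "i \<le> m" for i
    using a_neq_x[of i] r_neq(1,3)[of i] that by auto
  moreover have "b j \<notin> {x, r, r'}" if "0 < j" "j \<le> l" for j
    using b_neq_x[of j] r_neq(2,4)[of j] that by auto
  ultimately have "ind A ({x, r, r'} \<union> a ` {0..m} \<union> b ` {0..l})"
    using parity_ml a_0 b_0 r_in r'_in x_in_S
    by (intro ind_extend_arms) simp_all
  moreover have "{x, r, r'} \<union> a ` {0..m} \<union> b ` {0..l} = S"
  proof -
    have "{0..l} = insert 0 {1..l}" "{0..m} = insert 0 {1..m}" by auto
    then show ?thesis using S_eq a_0 b_0 by auto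
  qed
  ultimately show ?thesis by simp
qed

text \<open>Without \<open>r\<close>, the vertex \<open>r'\<close> and the arm \<open>a\<close>
  stripped of \<open>x\<close> together dominate everything else.\<close>

lemma critical_r: "\<not> ind A (S - {r})"
proof
  assume i: "ind A (S - {r})"
  let ?J = "insert r' (a ` {1..m})"
  have sub: "?J \<subseteq> S - {r}" "x \<in> S - {r}" "x \<notin> ?J"
    using a_in r'_in r_in x_in_S x_notin_arms r_neq by auto
  have "A p w = True" if "p \<in> ?J" "w \<in> S - {r} - ?J" for p w
    using that S_eq a_x a_b r'_x r'_b by auto
  then have "intv A (S - {r}) ?J" using sub unfolding intv_def by simp
  then have "?J = S - {r}"
    using indD[OF i, of ?J "a 1" "a 2"] a_neq[of 1 2] m_ge_2 by auto
  then show False using sub by blast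
qed

lemma critical_r': "\<not> ind A (S - {r'})"
proof
  assume i: "ind A (S - {r'})"
  let ?J = "insert r (b ` {1..l})"
  have sub: "?J \<subseteq> S - {r'}" "x \<in> S - {r'}" "x \<notin> ?J"
    using b_in r'_in r_in x_in_S x_notin_arms r_neq by auto
  have out: "A w p" if "p \<in> ?J" "w \<in> S - {r'} - ?J" for p w
    using that S_eq x_b a_b x_r a_r by auto
  have "intv A (S - {r'}) ?J"
    unfolding intv_def
  proof (intro conjI ballI sub)
    fix p q w assume pq: "p \<in> ?J" "q \<in> ?J" "w \<in> S - {r'} - ?J"
    then have "A w p" "A w q" using out by blast+
    then show "A p w = A q w" using asym[of w p] asym[of w q] pq sub by blast
  qed
  then have "?J = S - {r'}"
    using indD[OF i, of ?J "b 1" "b 2"] b_neq[of 1 2] l_ge_2 by auto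
  then show False using sub by blast
qed

lemma critical_all:
  assumes "v \<in> S" "v \<noteq> x" "4 \<le> card S" shows "\<not> ind A (S - {v})"
  using assms a_critical b_critical critical_r critical_r' S_eq by auto

text \<open>The seed is \<open>ind_six\<close> on the 3-cycle \<open>b 2\<close>, \<open>r\<close>,
  \<open>r'\<close> with \<open>a 1\<close>, \<open>a 2\<close> and \<open>b 1\<close>; both arms
  grow from index 2.\<close>

lemma ind_del_x: "ind A (S - {x})"
proof -
  note l = l_ge_2 and m = m_ge_2
  let ?Z = "{b 2, r, r', a 1, a 2, b 1}"
  have Z: "?Z \<subseteq> S" using a_in b_in r_in r'_in m l by auto
  have "distinct [b 2, r, r', a 1, a 2, b 1]"
    using a_neq b_neq ab_neq ba_neq r_neq r_neq(2,4)[symmetric] m l by simp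
  then have "ind A ?Z" "card ?Z = 6"
    by (intro ind_six; use Z a_linear[of 1 2] b_linear[of 1 2] a_b a_r a_r'[of 1] r'_a[of 2] r_b[of 1] b_r[of 2]
        r'_b r_r' m l in simp)+
  moreover have "a i \<notin> ?Z" if "2 < i" "i \<le> m" for i
    using a_neq[of i 1] a_neq[of i 2] ab_neq[of i] r_neq(1,3)[of i] l that by auto
  moreover have "b j \<notin> ?Z" if "2 < j" "j \<le> l" for j
    using b_neq[of j 1] b_neq[of j 2] ab_neq[of _ j] r_neq(2,4)[of j] m that by (auto dest!: sym[of "b j"])
  ultimately have "ind A (?Z \<union> a ` {2..m} \<union> b ` {2..l})"
    using parity_ml m l Z
    by (intro ind_extend_arms) simp_all
  moreover have "?Z \<union> a ` {2..m} \<union> b ` {2..l} = S - {x}"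
  proof -
    have "{1..m} = insert 1 {2..m}" "{1..l} = insert 1 {2..l}" using m l by auto
    moreover have "S - {x} = insert r (insert r' (a ` {1..m} \<union> b ` {1..l}))" using S_eq x_notin_arms r_in r'_in by auto
    ultimately show ?thesis using m l by auto
  qed
  ultimately show ?thesis by simp
qed

end

section \<open>The classification\<close>

lemma in_image_not_first:
  assumes "z \<in> f ` {1..n::nat}" "z \<noteq> f 1" shows "\<exists>j. z = f j \<and> 1 < j \<and> j \<le> n"
proof -
  obtain j where "z = f j" "1 \<le> j" "j \<le> n" using assms by auto
  then show ?thesis using assms(2) by (cases "j = 1") auto
qed

context critical_except
begin

text \<open>If \<open>x\<close> lay on no 3-cycle, its in-neighbours would dominate all other
  vertices. Their complement would be an interval containing \<open>x\<close> and, as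
  \<open>x\<close> is no sink, a second vertex; so there would be no in-neighbours and
  \<open>x\<close> would be a source.\<close>

lemma cycle_exists:
  obtains y y' where "y \<in> S" "y' \<in> S" "y \<noteq> x" "y' \<noteq> x" "y \<noteq> y'" "A x y" "A y y'" "A y' x"
proof (rule ccontr)
  assume "\<not> thesis"
  then have no: "\<not> (y \<in> S \<and> y' \<in> S \<and> y \<noteq> x \<and> y' \<noteq> x \<and> y \<noteq> y' \<and> A x y \<and> A y y' \<and> A y' x)" for y y'
    using that by blast
  define N where "N = {y\<in>S - {x}. A y x}"
  have xy: "A x y" if "y \<in> S - N" "y \<noteq> x" for y
    using that asym[of x y] x_in unfolding N_def by blast
  have out: "A w p" if "w \<in> N" "p \<in> S - N" for w p
  proof (cases "p = x")
    case False
    have "\<not> A p w" using no[of p w] xy[OF that(2) False] that False unfolding N_def by blast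
    then show ?thesis using asym[of p w] that unfolding N_def by blast
  qed (use that N_def in auto)
  have "intv A S (S - N)"
    unfolding intv_def
  proof (intro conjI ballI)
    fix p q w assume "p \<in> S - N" "q \<in> S - N" "w \<in> S - (S - N)"
    then show "A p w = A q w" using out[of w p] out[of w q] asym[of w p] asym[of w q] by blast
  qed blast
  moreover have xN: "x \<in> S - N" using x_in N_def by blast
  moreover have "\<exists>y\<in>S - N. y \<noteq> x"
  proof (rule ccontr)
    assume "\<not> ?thesis"
    then have "sink A S x" unfolding source_def N_def by blast
    then show False using no_sink x_in by blast
  qed
  ultimately have "N = {}" using intv_trivial[of "S - N" x] unfolding N_def by blast
  then have "source A S x" using xy unfolding source_def by blast
  then show False using no_source x_in by blast
qed

lemma card_cycle_ind:
  assumes "y \<in> S" "y' \<in> S" "y \<noteq> x" "y' \<noteq> x" "y \<noteq> y'" "A x y" "A y y'" "A y' x"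
  shows "ind A {x, y, y'}" "card {x, y, y'} = 3" "{x, y, y'} \<subseteq> S"
  using ind_cycle[of x y y'] assms x_in by auto

lemma odd_card: "odd (card S)"
proof -
  obtain y y' where y: "y \<in> S" "y' \<in> S" "y \<noteq> x" "y' \<noteq> x" "y \<noteq> y'" "A x y" "A y y'" "A y' x"
    using cycle_exists .
  note c = card_cycle_ind[OF this]
  have "even (card (S - {x, y, y'}))" using parity c by simp
  moreover have "card (S - {x, y, y'}) = card S - 3" using card_Diff_subset[of "{x, y, y'}" S] c by auto
  ultimately show ?thesis using card_S by simp
qed

lemma closed_arm_x: "closed_arm m a \<Longrightarrow> chain A S m a \<and> a 0 = x"
  unfolding closed_arm_def source_arm_def using chain_dual by auto

lemma closed_arm_neq_x: "closed_arm m a \<Longrightarrow> 1 \<le> i \<Longrightarrow> i \<le> m \<Longrightarrow> a i \<noteq> x"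
  using closed_arm_x[of m a] chain_neq[of m a i 0] by force

lemma closed_arm_in: "closed_arm m a \<Longrightarrow> i \<le> m \<Longrightarrow> a i \<in> S"
  using closed_arm_x chain_in by blast

text \<open>The way arms are found: as long as an indecomposable set through \<open>x\<close> is not
  all of \<open>S\<close>, some edge lies outside it, and the arm of that edge reaches beyond the
  set.\<close>

lemma closed_arm_outside:
  assumes Z: "ind A Z" "x \<in> Z" "Z \<subseteq> S" "3 \<le> card Z" "Z \<noteq> S"
  obtains m a k where "closed_arm m a" "k \<in> {1..m}" "a k \<notin> Z"
proof -
  obtain c d where cd: "c \<in> S - Z" "d \<in> S - Z" "edge c d" using edge_outside[OF Z] by blast
  then have "c \<noteq> x" "d \<noteq> x" using Z by auto
  from closed_arm_exists[OF cd(3) this] obtain m a where "closed_arm m a" "c \<in> a ` {1..m}" .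
  then show ?thesis using that cd by blast
qed

lemma closed_arms_notin:
  assumes "closed_arm m a" "closed_arm l b" "k \<in> {1..l}" "b k \<notin> a ` {1..m}" "1 \<le> j" "j \<le> l"
  shows "b j \<notin> a ` {..m}"
proof
  assume "b j \<in> a ` {..m}"
  then obtain i where i: "b j = a i" "i \<le> m" by auto
  have "b j \<noteq> a 0" using closed_arm_neq_x closed_arm_x assms by metis
  then have "b j \<in> a ` {1..m}" using i by (cases "i = 0") auto
  moreover have "b j \<in> b ` {1..l}" using assms(5,6) by auto
  ultimately show False using closed_arms_disjoint[OF assms(1,2,4,3)] by blast
qed

text \<open>Disjointness with the roles exchanged: \<open>c\<close> is known to leave
  \<open>v\<close>, and the conclusion concerns a vertex of \<open>v\<close>.\<close>

lemma closed_arm_first_notin: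
  assumes v: "closed_arm q v" and c: "closed_arm n c" "k \<in> {1..n}" "c k \<notin> v ` {1..q}"
  shows "v 1 \<notin> c ` {..n}"
proof
  assume "v 1 \<in> c ` {..n}"
  then obtain i where i: "v 1 = c i" "i \<le> n" by auto
  have q: "2 \<le> q" using v unfolding closed_arm_def by simp
  have "v 1 \<noteq> x" using closed_arm_neq_x[OF v, of 1] q by auto
  then have "i \<noteq> 0" using i closed_arm_x[OF c(1)] by (cases i) auto
  moreover have "v 1 \<in> v ` {..q}" using q by auto
  ultimately show False using closed_arms_notin[OF v c, of i] i by simp
qed

lemma source_arm_first:
  assumes "closed_arm m a" "source_arm A S x m a" shows "A (a 1) x"
  using arm_arc[OF assms(2), of 0 1] arm_0[OF assms(2)] assms(1) unfolding closed_arm_def by auto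

text \<open>An odd source arm makes \<open>x\<close> dominate every vertex off the arm, so every
  further arm is a sink arm. If the arm \<open>b\<close> found next is odd, no vertex off both arms
  is possible; if it is even, exactly one is left.\<close>

lemma odd_source_arm_cases:
  assumes ca: "closed_arm m a" and a: "source_arm A S x m a" and m: "odd m"
  shows "(\<exists>l b. odd_odd S A x m a l b \<and> 3 \<le> m \<and> 3 \<le> l \<and> \<not> (A (a 1) (a 3) \<and> A (b 3) (b 1))) \<or>
    (\<exists>l b r. odd_even S A x m a l b r \<and> 3 \<le> m \<and> A (a 1) (a 3))"
proof -
  have m3: "3 \<le> m" using ca m unfolding closed_arm_def by (cases "m = 2") auto
  note a0 = arm_0[OF a] and a_in = arm_in[OF a] and a_neq = arm_neq[OF a] and a_arc = arm_arc[OF a]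
  have x_out: "A x w" if "w \<in> S" "w \<notin> a ` {..m}" for w using arm_out[OF a, of 0 w] a0 m that by auto
  have a_x: "A (a i) x" if "1 \<le> i" "i \<le> m" for i using a_arc[of 0 i] a0 m that by auto
  have odd_bit: "A (a i) (a j) = A (a 1) (a 3)" if "odd i" "odd j" "i < j" "j \<le> m" for i j
    using arm_bit[OF a, of i j 1] that m by (simp add: numeral_3_eq_3)
  have asymA: "\<not> A q p" if "A p q" "p \<in> S" "q \<in> S" "p \<noteq> q" for p q using asymD that .
  \<comment> \<open>Otherwise the whole arm dominates its complement, so it is all of
    \<open>S\<close>, and \<open>x\<close> is a sink.\<close>
  have "\<exists>w\<in>S - a ` {..m}. A w (a 1)"
  proof (rule ccontr)
    assume no: "\<not> ?thesis"
    have "A (a i) w = True" if i: "i \<le> m" and w: "w \<in> S - a ` {..m}" for i w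
    proof (cases "odd i")
      case True
      have "A (a i) w = A (a 1) w" using arm_same(2)[OF a, of i 1 w] i w True m3 by auto
      moreover have "\<not> A w (a 1)" using no w by blast
      moreover have "w \<noteq> a 1" using w m3 by auto
      ultimately show ?thesis using asym[of w "a 1"] w a_in[of 1] m3 by auto
    qed (use arm_out[OF a, of i w] i w m in auto)
    then have "intv A S (a ` {..m})" using a_in by (intro intvI_const) auto
    moreover have "a 0 \<noteq> a 1" using a_neq[of 0 1] m3 by auto
    ultimately have S: "w \<in> a ` {..m}" if "w \<in> S" for w using intv_trivial[of _ "a 0" "a 1" w] that m3 by auto
    have "sink A S x"
      unfolding source_def
    proof
      fix w assume w: "w \<in> S - {x}"
      then obtain i where "w = a i" "i \<le> m" using S by blast
      then show "A w x" using a_x[of i] w a0 by (cases i) auto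
    qed
    then show False using no_sink x_in by blast
  qed
  then obtain w where w: "w \<in> S" "w \<notin> a ` {..m}" "A w (a 1)" by blast
  have wn: "w \<noteq> a i" if "i \<le> m" for i using w that by auto
  have w_a: "A w (a i)" if "odd i" "i \<le> m" for i using arm_same(1)[OF a, of i 1 w] w that m3 by auto
  have a_w: "A (a i) w" if "even i" "i \<le> m" for i using arm_out[OF a, of i w] w that m by auto
  have xw: "A x w" using x_out w by blast
  have a1x: "a 1 \<noteq> x" using a_neq[of 1 0] a0 m3 by auto
  have wx: "w \<noteq> x" using wn[of 0] a0 by auto
  have "ind A {x, w, a 1}" "card {x, w, a 1} = 3"
    using card_cycle_ind[of w "a 1"] w wx a1x wn[of 1] a_in[of 1] xw a_x[of 1] m3 by auto
  moreover have "a i \<notin> {x, w, a 1}" if "1 < i" "i \<le> m" for i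
    using a_neq[of i 1] a_neq[of i 0] wn[of i] that a0 by auto
  ultimately have "ind A ({x, w, a 1} \<union> a ` {1..m})"
    using ind_arm_extend[OF a, of 1 "{x, w, a 1}"] m m3 x_in w a_in[of 1] by auto
  moreover have "{x, w, a 1} \<union> a ` {1..m} = insert w (a ` {..m})"
  proof -
    have "{..m} = insert 0 {1..m}" by auto
    then show ?thesis using a0 m3 by auto
  qed
  ultimately have indZ: "ind A (insert w (a ` {..m}))" by simp
  let ?Z = "insert w (a ` {..m})"
  have Z: "x \<in> ?Z" "?Z \<subseteq> S" "3 \<le> card ?Z"
  proof -
    show "x \<in> ?Z" using a0 by force
    show "?Z \<subseteq> S" using w a_in by auto
    have "card ({x, w, a 1}) \<le> card ?Z" using a0 m3 by (intro card_mono) auto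
    then show "3 \<le> card ?Z" using \<open>card {x, w, a 1} = 3\<close> by simp
  qed
  have c4: "3 \<le> card (S - {x})" using card_del[of x] by simp
  have a1S: "a 1 \<in> S - {x}" "a 1 \<in> S" using a_in[of 1] a1x m3 by auto
  \<comment> \<open>If the arm and \<open>w\<close> were everything, \<open>T - x\<close> would be
    decomposable for either bit: \<open>a 1\<close> and \<open>w\<close> would be twins, or
    \<open>a 1\<close> a sink.\<close>
  have ZS: "?Z \<noteq> S"
  proof
    assume ZS: "?Z = S"
    have Sx: "z = w \<or> (\<exists>j. z = a j \<and> 1 \<le> j \<and> j \<le> m)" if z: "z \<in> S - {x}" for z
    proof (cases "z = w")
      case False
      then obtain j where "z = a j" "j \<le> m" using z ZS by auto
      then show ?thesis using z a0 by (cases j) auto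
    qed simp
    show False
    proof (cases "A (a 1) (a 3)")
      case True
      have "A (a 1) z = A w z" if z: "z \<in> S - {x} - {a 1, w}" for z
      proof -
        obtain j where "z = a j" "1 \<le> j" "j \<le> m" using Sx z by blast
        moreover from this have "j \<noteq> 1" using z by auto
        ultimately have j: "z = a j" "1 < j" "j \<le> m" by auto
        show ?thesis
        proof (cases "odd j")
          case True
          then show ?thesis using odd_bit[of 1 j] w_a[of j] j \<open>A (a 1) (a 3)\<close> by auto
        next
          case False
          have "\<not> A (a 1) (a j)" using asymA[OF a_arc[of 1 j]] a_in a_neq[of j 1] j m False by auto
          moreover have "\<not> A w (a j)" using asymA[OF a_w[of j]] False j w a_in wn[of j] by auto
          ultimately show ?thesis using j by simp
        qed
      qed
      then have "twins A (S - {x}) (a 1) w" unfolding twins_def by blast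
      then show False using ind_no_twins[OF ind_del c4 a1S(1), of w] w wx wn[of 1] m3 by auto
    next
      case False
      have "A z (a 1)" if z: "z \<in> S - {x} - {a 1}" for z
      proof (cases "z = w")
        case nw: False
        obtain j where "z = a j" "1 \<le> j" "j \<le> m" using Sx z nw by blast
        moreover from this have "j \<noteq> 1" using z by auto
        ultimately have j: "z = a j" "1 < j" "j \<le> m" by auto
        show ?thesis
        proof (cases "odd j")
          case True
          then have "\<not> A (a 1) (a j)" using odd_bit[of 1 j] j False by auto
          then show ?thesis using asym[of "a 1" "a j"] a_in a_neq[of j 1] j by auto
        qed (use a_arc[of 1 j] j m in auto)
      qed (use w in simp)
      then have "sink A (S - {x}) (a 1)" unfolding source_def by blast
      then show False using ind_no_sink[OF ind_del c4 a1S(1)] by blast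
    qed
  qed
  obtain l b k where b: "closed_arm l b" "k \<in> {1..l}" "b k \<notin> ?Z"
    using closed_arm_outside[OF indZ Z ZS] .
  have l2: "2 \<le> l" using b unfolding closed_arm_def by simp
  have bka: "b k \<notin> a ` {1..m}" using b by auto
  note disj = closed_arms_disjoint[OF ca b(1) bka b(2)]
  have b_out_a: "b j \<notin> a ` {..m}" if "1 \<le> j" "j \<le> l" for j
    using closed_arms_notin[OF ca b(1,2) bka that] .
  have xb1: "\<not> A (b 1) x"
    using asymA[OF x_out[of "b 1"]] b_out_a[of 1] closed_arm_in[OF b(1), of 1] closed_arm_neq_x[OF b(1), of 1] l2 x_in by auto
  have b_sink: "sink_arm A S x l b"
    using source_arm_first[OF b(1)] xb1 b unfolding closed_arm_def by blast
  interpret two_arms S A x m a l b by unfold_locales (use a b_sink disj in auto)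
  show ?thesis
  proof (cases "odd l")
    case l: True
    then have l3: "3 \<le> l" using l2 by (cases "l = 2") auto
    \<comment> \<open>A vertex off both arms would be dominated by \<open>x\<close> because
      \<open>m\<close> is odd and would dominate \<open>x\<close> because \<open>l\<close> is
      odd.\<close>
    have S_eq: "S = insert x (a ` {1..m} \<union> b ` {1..l})"
    proof (rule antisym[OF _ two_arms_subset])
      show "S \<subseteq> insert x (a ` {1..m} \<union> b ` {1..l})"
      proof (rule ccontr)
        assume "\<not> ?thesis"
        then obtain y where y: "y \<in> S" "y \<noteq> x" "y \<notin> a ` {1..m}" "y \<notin> b ` {1..l}" by blast
        have "{..m} = insert 0 {1..m}" "{..l} = insert 0 {1..l}" by auto
        then have "y \<notin> a ` {..m}" "y \<notin> b ` {..l}" using y a_0 b_0 by auto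
        then have "A x y" "A y x" using x_out b_out[of 0 y] b_0 l y by auto
        then show False using asym[of x y] y x_in by auto
      qed
    qed
    have "w \<in> b ` {1..l}" using S_eq w wx by auto
    then obtain j where j: "w = b j" "1 \<le> j" "j \<le> l" by auto
    have "odd j"
    proof (rule ccontr)
      assume "\<not> odd j"
      then have "A (a 1) (b j)" using a_into_b[of j 1] j l m3 by auto
      then show False using asymA[of "a 1" "b j"] w j a1S b_in[of j] wn[of 1] m3 by auto
    qed
    then have "A (b 1) (a 1)" using ab_same(2)[of 1 1 1 j] w j m3 l3 by auto
    then interpret odd_odd S A x m a l b by unfold_locales (use m l S_eq in auto)
    \<comment> \<open>The one forbidden pair of bits makes \<open>a 1\<close> and \<open>b 1\<close>
      twins in \<open>T - x\<close>.\<close>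
    have "\<not> (A (a 1) (a 3) \<and> A (b 3) (b 1))"
    proof
      assume bits: "A (a 1) (a 3) \<and> A (b 3) (b 1)"
      have "A (a 1) z = A (b 1) z" if z: "z \<in> S - {x} - {a 1, b 1}" for z
      proof -
        consider j where "z = a j" "1 < j" "j \<le> m" | j where "z = b j" "1 < j" "j \<le> l"
        proof -
          have "z \<in> a ` {1..m} \<or> z \<in> b ` {1..l}" using z S_eq by blast
          then show ?thesis using that z in_image_not_first[of z a m] in_image_not_first[of z b l] by blast
        qed
        then show ?thesis
        proof cases
          case (1 j)
          show ?thesis
          proof (cases "odd j")
            case True
            then show ?thesis using odd_bit[of 1 j] b_a[of j 1] 1 bits l3 by auto
          next
            case False
            have "\<not> A (a 1) (a j)" using asymA[OF a_arc[of 1 j]] a_in a_neq[of j 1] 1 m False by auto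
            moreover have "\<not> A (b 1) (a j)"
              using asymA[OF a_out_b[of j 1]] a_in b_in ab_neq[of j 1] 1 m False l3 by auto
            ultimately show ?thesis using 1 by simp
          qed
        next
          case (2 j)
          show ?thesis
          proof (cases "odd j")
            case True
            have "\<not> A (a 1) (b j)"
              using asymA[OF b_a[of 1 j]] a_in[of 1] b_in[of j] ab_neq[of 1 j] 2 True m3 by auto
            moreover have "\<not> A (b 1) (b j)"
              using b_bit[of 1 j 1] asymA[of "b j" "b 1"] 2 True l b_in b_neq bits l3 by (auto simp: numeral_3_eq_3)
            ultimately show ?thesis using 2 by simp
          next
            case False
            then show ?thesis using a_into_b[of j 1] b_arc[of 1 j] 2 l m3 by auto
          qed
        qed
      qed
      then have "twins A (S - {x}) (a 1) (b 1)" unfolding twins_def by blast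
      then show False
        using ind_no_twins[OF ind_del c4 a1S(1), of "b 1"] b_in[of 1] b_neq_x[of 1] ab_neq[of 1 1] m3 l3 by auto
    qed
    then show ?thesis using odd_odd_axioms m3 l3 by blast
  next
    case l: False
    \<comment> \<open>On an even arm \<open>b\<close> all vertices are dominated by
      \<open>a 1\<close>, whereas \<open>w\<close> dominates \<open>a 1\<close>.\<close>
    have w_b: "w \<notin> b ` {1..l}"
    proof
      assume "w \<in> b ` {1..l}"
      then obtain j where j: "w = b j" "1 \<le> j" "j \<le> l" by auto
      have "A (a 1) (b j)"
      proof (cases "odd j")
        case True then show ?thesis using a_into_b[of j 1] j l m3 by auto
      next
        case False
        then show ?thesis using b_same(2)[of j 0 "a 1"] a_notin_b[of 1] a_in[of 1] a_x[of 1] b_0 j m3 by auto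
      qed
      then show False using asymA[of "a 1" "b j"] w j a1S b_in[of j] wn[of 1] m3 by auto
    qed
    have indM: "ind A (?Z \<union> b ` {0..l})"
    proof (rule ind_sink_arm_extend[OF b_sink _ _ indZ Z(3,2)])
      show "b 0 \<in> ?Z" using Z b_0 by simp
      fix j assume "0 < j" "j \<le> l"
      then show "b j \<notin> ?Z" using b_out_a[of j] w_b by auto
    qed (use l in auto)
    have M: "?Z \<union> b ` {0..l} = insert w (insert x (a ` {1..m} \<union> b ` {1..l}))"
    proof -
      have "{..m} = insert 0 {1..m}" "{0..l} = insert 0 {1..l}" by auto
      then show ?thesis using a_0 b_0 by auto
    qed
    let ?M = "insert w (insert x (a ` {1..m} \<union> b ` {1..l}))"
    \<comment> \<open>A further arm \<open>c\<close> is a sink arm like \<open>b\<close>. If it is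
      odd, \<open>b 1\<close> would dominate \<open>x\<close>; if it is even, \<open>b 1\<close> and
      \<open>c 1\<close> would dominate each other.\<close>
    have S_eq: "S = ?M"
    proof (rule ccontr)
      assume "S \<noteq> ?M"
      moreover have "?M \<subseteq> S" using two_arms_subset w by auto
      moreover have "3 \<le> card ?M"
        using Z(3) card_mono[of ?M ?Z] M by (metis Un_upper1 finite.insertI finite_Un finite_atLeastAtMost finite_imageI order_trans)
      ultimately obtain n c i where c: "closed_arm n c" "i \<in> {1..n}" "c i \<notin> ?M"
        using closed_arm_outside[of ?M] indM M by (metis insertCI)
      have n2: "2 \<le> n" using c unfolding closed_arm_def by simp
      have ci: "c i \<notin> a ` {1..m}" "c i \<notin> b ` {1..l}" using c by auto
      have c1: "c 1 \<notin> a ` {..m}" "c 1 \<notin> b ` {..l}" "c 1 \<in> S" "c 1 \<noteq> x"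
        using closed_arms_notin[OF ca c(1,2) ci(1), of 1] closed_arms_notin[OF b(1) c(1,2) ci(2), of 1]
          closed_arm_in[OF c(1), of 1] closed_arm_neq_x[OF c(1), of 1] n2 by auto
      have "A x (c 1)" using x_out c1 by blast
      then have "\<not> source_arm A S x n c" using source_arm_first[OF c(1)] asymA[of x "c 1"] c1 x_in by auto
      then have cs: "sink_arm A S x n c" using c(1) unfolding closed_arm_def by blast
      have b1c: "b 1 \<notin> c ` {..n}" using closed_arm_first_notin[OF b(1) c(1,2) ci(2)] .
      show False
      proof (cases "odd n")
        case True
        then have "A (b 1) x" using sink_arm_out[OF cs, of 0 "b 1"] b1c b_in[of 1] sink_arm_0[OF cs] l2 by auto
        then show False using xb1 by blast
      next
        case False
        then have "A (b 1) (c 1)" using sink_arm_out[OF cs, of 1 "b 1"] b1c b_in[of 1] l2 n2 by auto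
        moreover have "A (c 1) (b 1)" using b_out[of 1 "c 1"] c1 l l2 by auto
        moreover have "b 1 \<noteq> c 1" using b1c n2 by auto
        ultimately show False using asymA[of "b 1" "c 1"] b_in[of 1] c1 l2 by auto
      qed
    qed
    interpret odd_even S A x m a l b w
      by unfold_locales (use m l w wx w_b S_eq in auto)
    \<comment> \<open>With the other bit, \<open>a 1\<close> and \<open>b 1\<close> would be twins
      in \<open>T - x\<close>.\<close>
    have "A (a 1) (a 3)"
    proof (rule ccontr)
      assume bit: "\<not> A (a 1) (a 3)"
      have "A (a 1) z = A (b 1) z" if z: "z \<in> S - {x} - {a 1, b 1}" for z
      proof -
        consider "z = w" | j where "z = a j" "1 < j" "j \<le> m" | j where "z = b j" "1 < j" "j \<le> l"
        proof -
          have "z = w \<or> z \<in> a ` {1..m} \<or> z \<in> b ` {1..l}" using z S_eq by blast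
          then show ?thesis using that z in_image_not_first[of z a m] in_image_not_first[of z b l] by blast
        qed
        then show ?thesis
        proof cases
          case 1
          have "\<not> A (a 1) w" "\<not> A (b 1) w"
            using asymA[OF w(3)] asymA[OF r_b[of 1]] w a_in[of 1] b_in[of 1] wn[of 1] r_neq(2)[of 1] m3 l2 by auto
          then show ?thesis using 1 by simp
        next
          case (2 j)
          have "\<not> A (a 1) (a j)"
            using asymA[OF a_arc[of 1 j]] odd_bit[of 1 j] a_in a_neq[of j 1] 2 m bit by (cases "odd j") auto
          moreover have "\<not> A (b 1) (a j)"
            using asymA[OF a_b[of j 1]] a_in b_in ab_neq[of j 1] 2 l2 by auto
          ultimately show ?thesis using 2 by simp
        next
          case (3 j)
          then show ?thesis using a_b[of 1 j] b_linear[of 1 j] m3 by auto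
        qed
      qed
      then have "twins A (S - {x}) (a 1) (b 1)" unfolding twins_def by blast
      then show False
        using ind_no_twins[OF ind_del c4 a1S(1), of "b 1"] b_in[of 1] b_neq_x[of 1] ab_neq[of 1 1] m3 l2 by auto
    qed
    then show ?thesis using odd_even_axioms m3 by blast
  qed
qed

end

section \<open>The case of even arms only\<close>

context critical_except
begin

text \<open>Edges are defined through indecomposability, which is invariant under reversal of
  arcs.\<close>

lemma closed_arm_dual: "critical_except.closed_arm S (\<lambda>x y. A y x) x m a \<longleftrightarrow> closed_arm m a"
proof -
  interpret D: critical_except S "\<lambda>x y. A y x" x by (rule dual_critical_except)
  have "D.edge p q = edge p q" for p q
    unfolding D.edge_def edge_def using ind_dual[of "S - {p, q}"] by blast
  then show ?thesis unfolding D.closed_arm_def closed_arm_def by auto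
qed

text \<open>Some 3-cycle through \<open>x\<close> avoids the rest of the arm \<open>b\<close>. The
  arm found outside the set grown from it cannot be a sink arm, as the first vertices of two even
  sink arms would dominate each other.\<close>

lemma even_sink_arm_partner:
  assumes even: "\<And>m a. closed_arm m a \<Longrightarrow> even m"
    and cb: "closed_arm l b" and b: "sink_arm A S x l b"
  obtains m a where "closed_arm m a" "source_arm A S x m a" "a ` {1..m} \<inter> b ` {1..l} = {}"
proof -
  have l: "even l" "2 \<le> l" using even[OF cb] cb unfolding closed_arm_def by auto
  note b0 = sink_arm_0[OF b] and b_in = sink_arm_in[OF b] and b_neq = sink_arm_neq[OF b]
    and b_arc = sink_arm_arc[OF b]
  have asymA: "\<not> A q p" if "A p q" "p \<in> S" "q \<in> S" "p \<noteq> q" for p q using asymD that .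
  define Y where "Y = S - b ` {..l}"
  have y_b: "A y (b j)" if "y \<in> Y" "odd j" "j \<le> l" for y j
    using sink_arm_out[OF b, of j y] that l unfolding Y_def by auto
  have y_same: "A y (b j) = A y x" "A (b j) y = A x y" if "y \<in> Y" "even j" "j \<le> l" for y j
    using sink_arm_same[OF b, of j 0 y] that b0 unfolding Y_def by auto
  have yx: "y \<noteq> x" "y \<noteq> b j" if "y \<in> Y" "j \<le> l" for y j using that b0 unfolding Y_def by auto
  have yS: "y \<in> S" if "y \<in> Y" for y using that unfolding Y_def by auto
  have b1x: "b 1 \<noteq> x" using b_neq[of 1 0] b0 l by auto
  have c4: "3 \<le> card (S - {x})" using card_del[of x] by simp
  have b1S: "b 1 \<in> S - {x}" "b 1 \<in> S" using b_in[of 1] b1x l by auto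
  have xb: "x \<in> b ` {..l}" using b0 by force
  \<comment> \<open>The argument of \<open>cycle_exists\<close> off the arm. Without such a cycle
    \<open>Y\<close> is an interval, so it has at most one vertex, and the odd size of
    \<open>S\<close> empties it; then \<open>b 1\<close> is a source of
    \<open>T - x\<close>.\<close>
  have "\<exists>y\<in>Y. \<exists>y'\<in>Y. A x y \<and> A y y' \<and> A y' x"
  proof (rule ccontr)
    assume no: "\<not> ?thesis"
    define N where "N = {y\<in>Y. A y x}"
    have xy: "A x y" if "y \<in> Y - N" for y
      using that asym[of x y] yx[of y 0] yS[of y] x_in unfolding N_def by blast
    have out: "A w p" if w: "w \<in> N" and p: "p \<in> S - N" for w p
    proof (cases "p \<in> Y")
      case True
      then have "\<not> A p w" using no xy[of p] w p unfolding N_def by blast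
      then show ?thesis using asym[of p w] w p yS unfolding N_def by blast
    next
      case False
      then obtain j where "p = b j" "j \<le> l" using p unfolding Y_def by auto
      then show ?thesis using y_b[of w j] y_same(1)[of w j] w unfolding N_def by (cases "odd j") auto
    qed
    have "intv A S (S - N)"
      unfolding intv_def
    proof (intro conjI ballI)
      fix p q w assume "p \<in> S - N" "q \<in> S - N" "w \<in> S - (S - N)"
      then show "A p w = A q w" using out[of w p] out[of w q] asym[of w p] asym[of w q] by blast
    qed blast
    moreover have "x \<in> S - N" "b 1 \<in> S - N" using x_in b1S xb l unfolding N_def Y_def by auto
    ultimately have "v \<in> S - N" if "v \<in> S" for v using intv_trivial[of "S - N" x "b 1" v] b1x that by blast
    then have N: "N = {}" unfolding N_def Y_def by blast
    have const: "A w p = A w q" if pqw: "p \<in> Y" "q \<in> Y" "w \<in> b ` {..l}" for p q w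
    proof -
      obtain j where j: "w = b j" "j \<le> l" using pqw by auto
      have "A w p = even j" if "p \<in> Y" for p
        using xy[of p] y_b[of p j] y_same(2)[of p j] N that j asym[of "b j" p] yx(2)[of p j] yS b_in by (cases "odd j") auto
      then show ?thesis using pqw by simp
    qed
    have "intv A S Y"
      unfolding intv_def
    proof (intro conjI ballI)
      fix p q w assume *: "p \<in> Y" "q \<in> Y" "w \<in> S - Y"
      then have "w \<in> b ` {..l}" unfolding Y_def by blast
      then show "A p w = A q w" using const[of p q w] asym[of w p] asym[of w q] * yS by blast
    qed (use Y_def in blast)
    then have "y = y'" if "y \<in> Y" "y' \<in> Y" for y y'
      using intv_trivial[of Y y y' x] that x_in yx(1)[of x] by blast
    then have "card Y \<le> 1" using card_le_Suc0_iff_eq[of Y] fin unfolding Y_def by auto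
    moreover have cS: "card S = card Y + (l + 1)"
    proof -
      have "inj_on b {..l}" using b_neq by (intro inj_onI) (metis atMost_iff)
      then have "card (b ` {..l}) = l + 1" by (simp add: card_image)
      moreover have "b ` {..l} \<subseteq> S" using b_in by auto
      ultimately show ?thesis
        unfolding Y_def using card_Diff_subset[of "b ` {..l}" S] card_mono[of S "b ` {..l}"] fin by simp
    qed
    ultimately have "card Y = 0" using odd_card l by (cases "card Y") auto
    then have S: "S = b ` {..l}" using fin b_in unfolding Y_def by auto
    have "A (b 1) z" if z: "z \<in> S - {x} - {b 1}" for z
    proof -
      obtain j where j: "z = b j" "j \<le> l" using S z by auto
      have "z \<noteq> b 0" "z \<noteq> b 1" using z b0 by auto
      then have "j \<noteq> 0" "j \<noteq> 1" using j by metis+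
      then show ?thesis using b_arc[of 1 j] j l by auto
    qed
    then have "source A (S - {x}) (b 1)" unfolding source_def by blast
    then show False using ind_no_source[OF ind_del c4 b1S(1)] by blast
  qed
  then obtain y y' where y: "y \<in> Y" "y' \<in> Y" "A x y" "A y y'" "A y' x" by blast
  have yn: "y \<in> S" "y' \<in> S" "y \<noteq> x" "y' \<noteq> x" using y yS yx(1) by blast+
  have yy: "y \<noteq> y'" using asymA[OF y(3)] y yn x_in by auto
  note cyc = card_cycle_ind[OF yn yy y(3-5)]
  let ?Z = "{x, y, y'} \<union> b ` {0..l}"
  have indZ: "ind A ?Z"
  proof (rule ind_sink_arm_extend[OF b])
    fix i assume "0 < i" "i \<le> l"
    then show "b i \<notin> {x, y, y'}" using yx(2)[OF y(1), of i] yx(2)[OF y(2), of i] b_neq[of i 0] b0 by auto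
  qed (use cyc l b0 in auto)
  have Z: "x \<in> ?Z" "?Z \<subseteq> S" "3 \<le> card ?Z"
  proof -
    show "?Z \<subseteq> S" using cyc b_in by auto
    then show "3 \<le> card ?Z" using card_mono[of ?Z "{x, y, y'}"] cyc(2) fin finite_subset[of ?Z S] by auto
  qed simp
  \<comment> \<open>Otherwise \<open>y'\<close> and \<open>b 1\<close> would be twins in
    \<open>T - x\<close>.\<close>
  have "?Z \<noteq> S"
  proof
    assume S: "?Z = S"
    have "A y' z = A (b 1) z" if z: "z \<in> S - {x} - {y', b 1}" for z
    proof (cases "z = y")
      case True
      have "\<not> A y' y" "\<not> A (b 1) y"
        using asymA[OF y(4)] asymA[OF y_b[OF y(1), of 1]] yn yy b1S yx(2)[OF y(1), of 1] l by auto
      then show ?thesis using True by simp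
    next
      case False
      then have "z \<in> b ` {0..l}" using z S by auto
      then obtain j where j: "z = b j" "j \<le> l" by auto
      have "z \<noteq> b 0" "z \<noteq> b 1" using z b0 by auto
      then have "j \<noteq> 0" "j \<noteq> 1" using j by metis+
      then have "A (b 1) (b j)" using b_arc[of 1 j] j l by auto
      moreover have "A y' (b j)" using y_b[OF y(2), of j] y_same(1)[OF y(2), of j] y(5) j by (cases "odd j") auto
      ultimately show ?thesis using j by simp
    qed
    then have "twins A (S - {x}) y' (b 1)" unfolding twins_def by blast
    then show False using ind_no_twins[OF ind_del c4 _ b1S(1)] yn yx(2)[OF y(2), of 1] l by auto
  qed
  from closed_arm_outside[OF indZ Z this] obtain m a k where a: "closed_arm m a" "k \<in> {1..m}" "a k \<notin> ?Z" .
  have m: "2 \<le> m" using a unfolding closed_arm_def by simp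
  have akb: "a k \<notin> b ` {1..l}" using a by auto
  have a1: "a 1 \<notin> b ` {..l}" "a 1 \<in> S" using closed_arms_notin[OF cb a(1,2) akb, of 1] closed_arm_in[OF a(1), of 1] m by auto
  have "\<not> sink_arm A S x m a"
  proof
    assume as: "sink_arm A S x m a"
    have "b 1 \<notin> a ` {..m}" using closed_arm_first_notin[OF cb a(1,2) akb] .
    then have "A (b 1) (a 1)" using sink_arm_out[OF as, of 1 "b 1"] even[OF a(1)] m b1S by auto
    moreover have "A (a 1) (b 1)" using sink_arm_out[OF b, of 1 "a 1"] l a1 by auto
    moreover have "a 1 \<noteq> b 1" using a1 l by auto
    ultimately show False using asymA[of "a 1" "b 1"] a1 b1S by auto
  qed
  then have "source_arm A S x m a" using a(1) unfolding closed_arm_def by blast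
  moreover have "a ` {1..m} \<inter> b ` {1..l} = {}" using closed_arms_disjoint[OF cb a(1) akb a(2)] by blast
  ultimately show ?thesis using that a(1) by blast
qed

text \<open>The arc between \<open>x\<close> and \<open>b 2\<close> decides. One orientation
  produces a 3-cycle of \<open>x\<close> with two vertices off the arms; the other leaves no vertex
  off the arms and ends with \<open>a 1\<close> and \<open>b 1\<close> as twins in
  \<open>T - x\<close>.\<close>

lemma even_arms_even_even:
  assumes even: "\<And>m a. closed_arm m a \<Longrightarrow> even m"
    and ca: "closed_arm m a" "source_arm A S x m a" and cb: "closed_arm l b" "sink_arm A S x l b"
    and disj: "a ` {1..m} \<inter> b ` {1..l} = {}"
  obtains r r' where "even_even S A x m a l b r r'"
proof -
  interpret two_arms S A x m a l b by unfold_locales (use ca cb disj in auto)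
  have m: "even m" "2 \<le> m" and l: "even l" "2 \<le> l" using even ca cb unfolding closed_arm_def by auto
  have asymA: "\<not> A q p" if "A p q" "p \<in> S" "q \<in> S" "p \<noteq> q" for p q using asymD that .
  have c4: "3 \<le> card (S - {x})" using card_del[of x] by simp
  have a1S: "a 1 \<in> S - {x}" and b1S: "b 1 \<in> S - {x}" using a_in[of 1] a_neq_x[of 1] b_in[of 1] b_neq_x[of 1] m l by auto
  have img: "{..m} = insert 0 {1..m}" "{..l} = insert 0 {1..l}" by auto
  let ?M = "insert x (a ` {1..m} \<union> b ` {1..l})"
  define R where "R = S - ?M"
  have R_notin: "r \<notin> a ` {..m}" "r \<notin> b ` {..l}" "r \<in> S" "r \<noteq> x" if "r \<in> R" for r
    using that a_0 b_0 img unfolding R_def by auto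
  have Rn: "r \<noteq> a i" "r \<noteq> b j" if "r \<in> R" "i \<le> m" "j \<le> l" for r i j using R_notin[OF that(1)] that by auto
  have a_r: "A (a i) r" if "r \<in> R" "odd i" "i \<le> m" for r i using a_out[of i r] R_notin[of r] that m by auto
  have r_b: "A r (b j)" if "r \<in> R" "odd j" "j \<le> l" for r j using b_out[of j r] R_notin[of r] that l by auto
  have a_same_x: "A r (a i) = A r x" "A (a i) r = A x r" if "r \<in> R" "even i" "i \<le> m" for r i
    using a_same[of i 0 r] R_notin[of r] a_0 that by auto
  have b_same_x: "A r (b j) = A r x" "A (b j) r = A x r" if "r \<in> R" "even j" "j \<le> l" for r j
    using b_same[of j 0 r] R_notin[of r] b_0 that by auto
  have S_cases: "z = x \<or> z \<in> R \<or> z \<in> a ` {1..m} \<or> z \<in> b ` {1..l}" if "z \<in> S" for z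
    using that unfolding R_def by blast
  show ?thesis
  proof (cases "A x (b 2)")
    case True
    interpret two_even_arms S A x m a l b by unfold_locales (use True m l in auto)
    \<comment> \<open>Otherwise the arm \<open>a\<close> stripped of \<open>x\<close>, together with
      the vertices of \<open>R\<close> dominating \<open>x\<close>, would dominate everything else
      and form an interval missing \<open>x\<close>.\<close>
    have "\<exists>r\<in>R. \<exists>r'\<in>R. A x r \<and> A r r' \<and> A r' x"
    proof (rule ccontr)
      assume no: "\<not> ?thesis"
      define J where "J = a ` {1..m} \<union> {r\<in>R. A r x}"
      have "A p w = True" if p: "p \<in> J" and w: "w \<in> S - J" for p w
      proof -
        have "w = x \<or> (w \<in> R \<and> A x w) \<or> w \<in> b ` {1..l}"
          using w S_cases[of w] R_notin[of w] asym[of x w] x_in unfolding J_def by blast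
        moreover have ?thesis if "w = x" using p that a_x unfolding J_def by auto
        moreover have ?thesis if wr: "w \<in> R" "A x w"
        proof (cases "p \<in> R")
          case True
          then have "A p x" using p R_notin(1)[OF True] unfolding J_def by auto
          then have "\<not> A w p" using no wr True by blast
          moreover have "p \<noteq> w" using p w by blast
          ultimately show ?thesis using asym[of w p] R_notin(3)[OF True] R_notin(3)[OF wr(1)] by blast
        next
          case False
          then obtain i where "p = a i" "i \<le> m" using p unfolding J_def by auto
          then show ?thesis using a_r[OF wr(1), of i] a_same_x(2)[OF wr(1), of i] wr(2) by (cases "odd i") auto
        qed
        moreover have ?thesis if wb: "w \<in> b ` {1..l}"
        proof -
          obtain j where j: "w = b j" "1 \<le> j" "j \<le> l" using wb by auto
          show ?thesis
          proof (cases "p \<in> R")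
            case True
            then have "A p x" using p R_notin(1)[OF True] unfolding J_def by auto
            then show ?thesis using r_b[OF True, of j] b_same_x(1)[OF True, of j] j by (cases "odd j") auto
          next
            case False
            then obtain i where "p = a i" "1 \<le> i" "i \<le> m" using p unfolding J_def by auto
            then show ?thesis using a_b j by auto
          qed
        qed
        ultimately show ?thesis by blast
      qed
      moreover have "J \<subseteq> S" using a_in R_notin(3) unfolding J_def by auto
      ultimately have "intv A S J" by (intro intvI_const)
      moreover have "a 1 \<in> J" "a 2 \<in> J" "a 1 \<noteq> a 2" using a_neq[of 1 2] m unfolding J_def by auto
      ultimately have "x \<in> J" using intv_trivial x_in by blast
      then show False using x_notin_arms R_notin(4) unfolding J_def by blast
    qed
    then obtain r r' where r: "r \<in> R" "r' \<in> R" "A x r" "A r r'" "A r' x" by blast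
    have rr: "r \<noteq> r'" using asymA[OF r(3)] r R_notin(3,4) x_in by metis
    note cyc = card_cycle_ind[OF R_notin(3)[OF r(1)] R_notin(3)[OF r(2)] R_notin(4)[OF r(1)] R_notin(4)[OF r(2)] rr r(3-5)]
    let ?Z = "{x, r, r'} \<union> a ` {0..m} \<union> b ` {0..l}"
    have indZ: "ind A ?Z"
    proof (rule ind_extend_arms)
      fix i assume "0 < i" "i \<le> m"
      then show "a i \<notin> {x, r, r'}" using Rn(1)[OF r(1), of i 0] Rn(1)[OF r(2), of i 0] a_neq_x[of i] by auto
    next
      fix i assume "0 < i" "i \<le> l"
      then show "b i \<notin> {x, r, r'}" using Rn(2)[OF r(1), of 0 i] Rn(2)[OF r(2), of 0 i] b_neq_x[of i] by auto
    qed (use cyc m l a_0 b_0 in auto)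
    have Zeq: "?Z = insert r (insert r' ?M)"
    proof -
      have "{0..m} = insert 0 {1..m}" "{0..l} = insert 0 {1..l}" by auto
      then show ?thesis using a_0 b_0 by auto
    qed
    have Z: "x \<in> ?Z" "?Z \<subseteq> S" "3 \<le> card ?Z"
    proof -
      show "?Z \<subseteq> S" using cyc a_in b_in by auto
      then show "3 \<le> card ?Z" using card_mono[of ?Z "{x, r, r'}"] cyc(2) fin finite_subset[of ?Z S] by auto
    qed simp
    \<comment> \<open>A third arm would be of the same kind as \<open>a\<close> or as
      \<open>b\<close>, and the first vertices of two even arms of one kind would dominate each
      other.\<close>
    have S_eq: "?Z = S"
    proof (rule ccontr)
      assume "?Z \<noteq> S"
      from closed_arm_outside[OF indZ Z this] obtain n c k where c: "closed_arm n c" "k \<in> {1..n}" "c k \<notin> ?Z" .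
      have n: "2 \<le> n" "even n" using c even unfolding closed_arm_def by auto
      have ck: "c k \<notin> a ` {1..m}" "c k \<notin> b ` {1..l}" using c by auto
      have c1: "c 1 \<notin> a ` {..m}" "c 1 \<notin> b ` {..l}" "c 1 \<in> S"
        using closed_arms_notin[OF ca(1) c(1,2) ck(1), of 1] closed_arms_notin[OF cb(1) c(1,2) ck(2), of 1]
          closed_arm_in[OF c(1), of 1] n by auto
      note nc = closed_arm_first_notin[OF _ c(1,2)]
      show False
      proof (cases "source_arm A S x n c")
        case True
        have "A (c 1) (a 1)" using arm_out[OF True, of 1 "a 1"] nc[OF ca(1) ck(1)] a1S n by auto
        moreover have "A (a 1) (c 1)" using a_out[of 1 "c 1"] c1 m by auto
        moreover have "c 1 \<noteq> a 1" using c1 m by auto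
        ultimately show False using asymA[of "c 1" "a 1"] c1 a1S by auto
      next
        case False
        then have cs: "sink_arm A S x n c" using c(1) unfolding closed_arm_def by blast
        have "A (b 1) (c 1)" using sink_arm_out[OF cs, of 1 "b 1"] nc[OF cb(1) ck(2)] b1S n by auto
        moreover have "A (c 1) (b 1)" using b_out[of 1 "c 1"] c1 l by auto
        moreover have "c 1 \<noteq> b 1" using c1 l by auto
        ultimately show False using asymA[of "c 1" "b 1"] c1 b1S by auto
      qed
    qed
    have "even_even S A x m a l b r r'"
    proof unfold_locales
      show "S = insert r (insert r' ?M)" using S_eq Zeq by simp
    qed (use r R_def in auto)
    then show ?thesis using that by blast
  next
    case False
    have a2S: "a 2 \<in> S" and b2S: "b 2 \<in> S" using a_in[of 2] b_in[of 2] m l by auto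
    have b2x: "A (b 2) x" using False asym[of x "b 2"] x_in b2S b_neq_x[of 2] l by auto
    have "A (a 2) (b 2) = A x (b 2)" using a_same(2)[of 2 0 "b 2"] b_notin_a[of 2] b2S a_0 l m by auto
    moreover have "A (a 2) (b 2) = A (a 2) x" using b_same(2)[of 2 0 "a 2"] a_notin_b[of 2] a2S b_0 l m by auto
    ultimately have na: "\<not> A (a 2) x" "\<not> A (a 2) (b 2)" using False by auto
    then have xa2: "A x (a 2)" "A (b 2) (a 2)"
      using asym[of x "a 2"] asym[of "a 2" "b 2"] x_in a2S b2S a_neq_x[of 2] ab_neq[of 2 2] m l by auto
    \<comment> \<open>Such an \<open>r\<close> would give an indecomposable set of six vertices
      containing \<open>x\<close>, whose complement has odd size.\<close>
    have no_r: "\<not> A r x" if r: "r \<in> R" for r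
    proof
      assume rx: "A r x"
      let ?Z = "{x, b 1, b 2, a 1, a 2, r}"
      have Z: "?Z \<subseteq> S" using a_in b_in m l x_in R_notin[OF r] by auto
      have "distinct [x, b 1, b 2, a 1, a 2, r]"
        using a_neq b_neq ba_neq Rn(1)[OF r, of _ 0, symmetric] Rn(2)[OF r, of 0, symmetric] R_notin(4)[OF r, symmetric]
          a_neq_x[symmetric] b_neq_x[symmetric] m l by simp
      then have "ind A ?Z" "card ?Z = 6"
        by (intro ind_six; use Z b2x xa2 rx a_arc[of 0 1] a_0 a_out_b[of 1] a_r[OF r, of 1] a_arc[of 1 2] b_arc[of 0 1] b_0
          a_into_b[of 1 2] b_arc[of 1 2] r_b[OF r, of 1] b_same_x(1)[OF r, of 2] a_same_x(1)[OF r, of 2] m l in simp)+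
      then have "even (card (S - ?Z))" "card (S - ?Z) + 6 = card S"
        using parity[of ?Z] Z fin card_Diff_subset[of ?Z S] card_mono[of S ?Z] by auto
      then show False using odd_card by (metis even_add even_numeral)
    qed
    \<comment> \<open>As \<open>x\<close> dominates all of \<open>R\<close>, the arcs between
      \<open>R\<close> and an arm depend only on the index on the arm. So \<open>R\<close> has at
      most one vertex, and none by parity.\<close>
    have "intv A S R"
      unfolding intv_def
    proof (intro conjI ballI)
      fix p q w assume pq: "p \<in> R" "q \<in> R" and w: "w \<in> S - R"
      consider "w = x" | i where "w = a i" "i \<le> m" | j where "w = b j" "j \<le> l" using S_cases[of w] w by auto
      then show "A p w = A q w"
      proof cases
        case 1 then show ?thesis using no_r pq by blast
      next
        case (2 i)
        have "\<not> A p w" if p: "p \<in> R" for p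
        proof (cases "odd i")
          case True
          then show ?thesis using asymA[OF a_r[OF p, of i]] a_in R_notin(3)[OF p] Rn(1)[OF p, of i 0] 2 by auto
        next
          case False
          then show ?thesis using a_same_x(1)[OF p, of i] no_r[OF p] 2 by auto
        qed
        then show ?thesis using pq by blast
      next
        case (3 j)
        have "A p w = odd j" if p: "p \<in> R" for p
          using r_b[OF p, of j] b_same_x(1)[OF p, of j] no_r[OF p] 3 by (cases "odd j") auto
        then show ?thesis using pq by blast
      qed
    qed (use R_def in blast)
    then have "p = q" if "p \<in> R" "q \<in> R" for p q
      using intv_trivial[of R p q x] that x_in R_notin(4) by blast
    then have "\<forall>p\<in>R. \<forall>q\<in>R. p = q" by simp
    moreover have "finite R" using fin unfolding R_def by simp
    ultimately have R1: "card R \<le> 1" using card_le_Suc0_iff_eq[of R] by simp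
    have "card S = card R + (1 + m + l)"
    proof -
      have "card ?M = 1 + m + l" using card_two_arms by simp
      then show ?thesis
        unfolding R_def using card_Diff_subset[of ?M S] card_mono[of S ?M] two_arms_subset fin by auto
    qed
    then have "card R = 0" using R1 odd_card m l by (cases "card R") auto
    then have R: "R = {}" using fin unfolding R_def by auto
    have "A (a 1) z = A (b 1) z" if z: "z \<in> S - {x} - {a 1, b 1}" for z
    proof -
      consider j where "z = a j" "1 < j" "j \<le> m" | j where "z = b j" "1 < j" "j \<le> l"
      proof -
        have "z \<in> a ` {1..m} \<or> z \<in> b ` {1..l}" using S_cases[of z] z R by auto
        then show ?thesis using that z in_image_not_first[of z a m] in_image_not_first[of z b l] by blast
      qed
      then show ?thesis
      proof cases
        case (1 j)
        have "\<not> A (a 1) (a j)" using asymA[OF a_arc[of 1 j]] a_in a_neq[of j 1] 1 m by auto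
        moreover have "\<not> A (b 1) (a j)" using asymA[OF a_into_b[of 1 j]] a_in b_in ab_neq[of j 1] 1 l by auto
        ultimately show ?thesis using 1 by simp
      next
        case (2 j)
        then show ?thesis using a_out_b[of 1 j] b_arc[of 1 j] m l by auto
      qed
    qed
    then have "twins A (S - {x}) (a 1) (b 1)" unfolding twins_def by blast
    then show ?thesis
      using ind_no_twins[OF ind_del c4 a1S b1S] ab_neq[of 1 1] m l by auto
  qed
qed

text \<open>An odd sink arm is treated in the dual tournament, which is why the shapes with an odd
  arm occur twice. With even arms only, a first arm is found outside a 3-cycle through
  \<open>x\<close> and then gets a partner of the other kind.\<close>

lemma classification:
  "(\<exists>m a l b. odd_odd S A x m a l b \<and> 3 \<le> m \<and> 3 \<le> l \<and> \<not> (A (a 1) (a 3) \<and> A (b 3) (b 1))) \<or>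
   (\<exists>m a l b r. odd_even S A x m a l b r \<and> 3 \<le> m \<and> A (a 1) (a 3)) \<or>
   (\<exists>m a l b. odd_odd S (\<lambda>x y. A y x) x m a l b \<and> 3 \<le> m \<and> 3 \<le> l \<and> \<not> (A (a 3) (a 1) \<and> A (b 1) (b 3))) \<or>
   (\<exists>m a l b r. odd_even S (\<lambda>x y. A y x) x m a l b r \<and> 3 \<le> m \<and> A (a 3) (a 1)) \<or>
   (\<exists>m a l b r r'. even_even S A x m a l b r r')"
proof (cases "\<exists>m a. closed_arm m a \<and> odd m")
  case True
  then obtain m a where a: "closed_arm m a" "odd m" by blast
  interpret D: critical_except S "\<lambda>x y. A y x" x by (rule dual_critical_except)
  consider "source_arm A S x m a" | "sink_arm A S x m a" using a unfolding closed_arm_def by blast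
  then show ?thesis
  proof cases
    case 1
    from odd_source_arm_cases[OF a(1) 1 a(2)] show ?thesis
    proof (elim disjE exE)
      fix l b assume "odd_odd S A x m a l b \<and> 3 \<le> m \<and> 3 \<le> l \<and> \<not> (A (a 1) (a 3) \<and> A (b 3) (b 1))"
      then show ?thesis by (intro disjI1 exI[of _ m] exI[of _ a] exI[of _ l] exI[of _ b])
    next
      fix l b r assume "odd_even S A x m a l b r \<and> 3 \<le> m \<and> A (a 1) (a 3)"
      then show ?thesis
        by (intro disjI2[OF disjI1] exI[of _ m] exI[of _ a] exI[of _ l] exI[of _ b] exI[of _ r])
    qed
  next
    case 2
    have "D.closed_arm m a" using a closed_arm_dual by simp
    from D.odd_source_arm_cases[OF this 2 a(2)] show ?thesis
    proof (elim disjE exE)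
      fix l b assume "odd_odd S (\<lambda>x y. A y x) x m a l b \<and> 3 \<le> m \<and> 3 \<le> l \<and> \<not> (A (a 3) (a 1) \<and> A (b 1) (b 3))"
      then show ?thesis
        by (intro disjI2[OF disjI2[OF disjI1]] exI[of _ m] exI[of _ a] exI[of _ l] exI[of _ b])
    next
      fix l b r assume "odd_even S (\<lambda>x y. A y x) x m a l b r \<and> 3 \<le> m \<and> A (a 3) (a 1)"
      then show ?thesis
        by (intro disjI2[OF disjI2[OF disjI2[OF disjI1]]] exI[of _ m] exI[of _ a] exI[of _ l] exI[of _ b] exI[of _ r])
    qed
  qed
next
  case False
  then have even: "\<And>m a. closed_arm m a \<Longrightarrow> even m" by blast
  interpret D: critical_except S "\<lambda>x y. A y x" x by (rule dual_critical_except)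
  obtain y y' where y: "y \<in> S" "y' \<in> S" "y \<noteq> x" "y' \<noteq> x" "y \<noteq> y'" "A x y" "A y y'" "A y' x"
    using cycle_exists .
  note c = card_cycle_ind[OF this]
  have "x \<in> {x, y, y'}" "3 \<le> card {x, y, y'}" "{x, y, y'} \<noteq> S" using c(2) card_S by auto
  from closed_arm_outside[OF c(1) this(1) c(3) this(2,3)]
  obtain m a k where a: "closed_arm m a" "k \<in> {1..m}" "a k \<notin> {x, y, y'}" .
  note a = a(1)
  from a consider "source_arm A S x m a" | "sink_arm A S x m a" unfolding closed_arm_def by blast
  then have "\<exists>m a l b r r'. even_even S A x m a l b r r'"
  proof cases
    case 1
    have "D.closed_arm m a" using a closed_arm_dual by simp
    from D.even_sink_arm_partner[OF _ this 1] even closed_arm_dual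
    obtain l b where "D.closed_arm l b" "sink_arm A S x l b" "b ` {1..l} \<inter> a ` {1..m} = {}" by auto
    then have b: "closed_arm l b" "sink_arm A S x l b" "a ` {1..m} \<inter> b ` {1..l} = {}"
      using closed_arm_dual by auto
    obtain r r' where "even_even S A x m a l b r r'"
      using even_arms_even_even[OF even a 1 b] .
    then show ?thesis by (intro exI)
  next
    case 2
    obtain l b where b: "closed_arm l b" "source_arm A S x l b" "b ` {1..l} \<inter> a ` {1..m} = {}"
      using even_sink_arm_partner[OF even a 2] .
    obtain r r' where "even_even S A x l b m a r r'"
      using even_arms_even_even[OF even b(1,2) a 2 b(3)] .
    then show ?thesis by (intro exI)
  qed
  then show ?thesis by (intro disjI2)
qed

end

section \<open>Transfer to tournaments\<close>

abbreviation arc :: "'a pair_pre_digraph \<Rightarrow> 'a \<Rightarrow> 'a \<Rightarrow> bool" where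
  "arc T \<equiv> \<lambda>u v. (u, v) \<in> parcs T"

lemma tournament_tour: assumes "tournament T" shows "tour (pverts T) (arc T)"
proof -
  interpret tournament T by fact
  show ?thesis by (rule tour.intro) (rule pair_finite_verts, rule exactly_one_arc)
qed

lemma tournament_arc_in:
  assumes "tournament T" "(u, v) \<in> parcs T" shows "u \<in> pverts T \<and> v \<in> pverts T \<and> u \<noteq> v"
proof -
  interpret tournament T by fact
  show ?thesis using in_arcsD1 in_arcsD2 pair_no_loops assms(2) by force
qed

lemma interval_iff: "interval T I \<longleftrightarrow> intv (arc T) (pverts T) I"
  unfolding interval_def intv_def by simp

lemma indecomposable_iff: "indecomposable T \<longleftrightarrow> ind (arc T) (pverts T)"
proof -
  have "trivial_interval T I \<longleftrightarrow> I = {} \<or> (\<exists>z. I = {z}) \<or> I = pverts T" if "interval T I" for I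
    using that unfolding interval_def trivial_interval_def by auto
  then show ?thesis unfolding indecomposable_def ind_def interval_iff by metis
qed

lemma indecomposable_delete_iff: "indecomposable (delete_vertex T v) \<longleftrightarrow> ind (arc T) (pverts T - {v})"
proof -
  let ?Z = "pverts T - {v}"
  have "intv (arc (delete_vertex T v)) ?Z J \<longleftrightarrow> intv (arc T) ?Z J" for J
    unfolding intv_def delete_vertex_def subtournament_def by auto
  moreover have "pverts (delete_vertex T v) = ?Z" unfolding delete_vertex_def subtournament_def by simp
  ultimately show ?thesis unfolding indecomposable_iff ind_def by simp
qed

lemma noncritical_vertex_iff:
  "noncritical_vertex T v \<longleftrightarrow> ind (arc T) (pverts T) \<and> v \<in> pverts T \<and> ind (arc T) (pverts T - {v})"
  using indecomposable_delete_iff[of T v] indecomposable_iff[of T]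
  unfolding noncritical_vertex_def critical_vertex_def by blast

lemma minus_one_critical_iff:
  assumes T: "tournament T"
  shows "minus_one_critical T \<longleftrightarrow> (\<exists>x. critical_except (pverts T) (arc T) x)"
proof -
  interpret tour "pverts T" "arc T" by (rule tournament_tour[OF T])
  have "critical_except (pverts T) (arc T) x \<longleftrightarrow>
    indecomposable T \<and> card (pverts T) \<ge> 5 \<and> (\<forall>v. noncritical_vertex T v \<longleftrightarrow> v = x)" for x
    unfolding critical_except_def critical_except_axioms_def noncritical_vertex_iff indecomposable_iff
    using tour_axioms by blast
  then show ?thesis using T unfolding minus_one_critical_def by (metis (no_types, lifting))
qed

section \<open>Invariance under isomorphism\<close>

lemma intv_image:
  assumes f: "inj_on f Z" and arcs: "\<And>u v. u \<in> Z \<Longrightarrow> v \<in> Z \<Longrightarrow> A u v = B (f u) (f v)" and J: "J \<subseteq> Z"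
  shows "intv B (f ` Z) (f ` J) \<longleftrightarrow> intv A Z J"
proof -
  have eq: "f ` Z - f ` J = f ` (Z - J)" using inj_on_image_set_diff[OF f, of Z J] J by auto
  have h: "B (f a) (f w) = A a w" if "a \<in> J" "w \<in> Z - J" for a w using that arcs J by auto
  have "intv B (f ` Z) (f ` J) \<longleftrightarrow> (\<forall>a\<in>J. \<forall>b\<in>J. \<forall>w\<in>Z - J. B (f a) (f w) = B (f b) (f w))"
    unfolding intv_def eq using J by (simp add: image_mono)
  also have "\<dots> \<longleftrightarrow> (\<forall>a\<in>J. \<forall>b\<in>J. \<forall>w\<in>Z - J. A a w = A b w)"
    by (intro ball_cong refl) (simp only: h)
  also have "\<dots> \<longleftrightarrow> intv A Z J" unfolding intv_def using J by simp
  finally show ?thesis .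
qed

lemma ind_image:
  assumes f: "inj_on f Z" and arcs: "\<And>u v. u \<in> Z \<Longrightarrow> v \<in> Z \<Longrightarrow> A u v = B (f u) (f v)"
  shows "ind B (f ` Z) \<longleftrightarrow> ind A Z"
proof -
  have triv: "f ` J = {} \<or> (\<exists>z. f ` J = {z}) \<or> f ` J = f ` Z \<longleftrightarrow> J = {} \<or> (\<exists>z. J = {z}) \<or> J = Z" if "J \<subseteq> Z" for J
  proof -
    have "(\<exists>z. f ` J = {z}) \<longleftrightarrow> (\<exists>z. J = {z})"
      using inj_on_subset[OF f that] by (metis card_1_singleton_iff card_image)
    then show ?thesis using inj_on_image_eq_iff[OF f that, of Z] by auto
  qed
  have sub: "intv A Z J \<Longrightarrow> J \<subseteq> Z" for J unfolding intv_def by simp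
  have "ind B (f ` Z) \<longleftrightarrow> (\<forall>J. J \<subseteq> Z \<longrightarrow> intv B (f ` Z) (f ` J) \<longrightarrow> f ` J = {} \<or> (\<exists>z. f ` J = {z}) \<or> f ` J = f ` Z)"
  proof -
    have "J' \<subseteq> f ` Z \<longleftrightarrow> (\<exists>J. J \<subseteq> Z \<and> J' = f ` J)" for J' by (rule subset_image_iff)
    moreover have "intv B (f ` Z) J' \<Longrightarrow> J' \<subseteq> f ` Z" for J' unfolding intv_def by simp
    ultimately show ?thesis unfolding ind_def by metis
  qed
  also have "\<dots> \<longleftrightarrow> ind A Z"
  proof -
    have "intv B (f ` Z) (f ` J) = intv A Z J" if "J \<subseteq> Z" for J
      by (rule intv_image[where f = f, OF f _ that]) (rule arcs)
    then show ?thesis unfolding ind_def using triv sub by metis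
  qed
  finally show ?thesis .
qed

text \<open>A digraph isomorphism carries separate maps for vertices, arcs, heads and tails. Here
  arcs are pairs with the projections as ends, so the vertex map determines the arc map.\<close>

lemma tournament_isoD:
  assumes "tournament_iso T C"
  shows "\<exists>f. bij_betw f (pverts T) (pverts C) \<and>
    (\<forall>u\<in>pverts T. \<forall>v\<in>pverts T. arc T u v = arc C (f u) (f v))"
proof -
  obtain h where h: "pre_digraph.digraph_isomorphism (with_proj T) h" "with_proj C = app_iso h (with_proj T)"
    using assms unfolding tournament_iso_def digraph_iso_def by blast
  let ?f = "iso_verts h"
  have inj: "inj_on ?f (pverts T)" and wf: "wf_digraph (with_proj T)"
    and ends: "\<And>e. e \<in> parcs T \<Longrightarrow> ?f (fst e) = iso_tail h (iso_arcs h e) \<and> ?f (snd e) = iso_head h (iso_arcs h e)"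
    using h(1) unfolding pre_digraph.digraph_isomorphism_def by auto
  have C: "pverts C = ?f ` pverts T" "parcs C = iso_arcs h ` parcs T" "iso_tail h = fst" "iso_head h = snd"
    using h(2) unfolding app_iso_def with_proj_def by auto
  have img: "iso_arcs h e = (?f (fst e), ?f (snd e))" if "e \<in> parcs T" for e
    using ends[OF that] C by (simp add: prod_eq_iff)
  show ?thesis
  proof (intro exI[of _ ?f] conjI ballI)
    show "bij_betw ?f (pverts T) (pverts C)" using inj C unfolding bij_betw_def by simp
    fix u v assume uv: "u \<in> pverts T" "v \<in> pverts T"
    show "arc T u v = arc C (?f u) (?f v)"
    proof
      assume e: "arc T u v"
      then have "iso_arcs h (u, v) = (?f u, ?f v)" using img by simp
      then show "arc C (?f u) (?f v)" using e C(2) by (metis image_eqI)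
    next
      assume "arc C (?f u) (?f v)"
      then obtain e where e: "e \<in> parcs T" "(?f u, ?f v) = iso_arcs h e" using C(2) by auto
      then have "?f u = ?f (fst e)" "?f v = ?f (snd e)" using img by auto
      moreover have "fst e \<in> pverts T" "snd e \<in> pverts T"
        using wf_digraph.tail_in_verts[OF wf, of e] wf_digraph.head_in_verts[OF wf, of e] e(1) by simp_all
      ultimately have "u = fst e" "v = snd e" using inj uv unfolding inj_on_def by blast+
      then show "arc T u v" using e by simp
    qed
  qed
qed

lemma tournament_isoI:
  assumes T: "tournament T" and C: "tournament C" and f: "bij_betw f (pverts T) (pverts C)"
    and arcs: "\<And>u v. u \<in> pverts T \<Longrightarrow> v \<in> pverts T \<Longrightarrow> arc T u v = arc C (f u) (f v)"
  shows "tournament_iso T C"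
proof -
  let ?h = "\<lparr>iso_verts = f, iso_arcs = map_prod f f, iso_head = snd, iso_tail = fst\<rparr> :: ('a, 'a \<times> 'a, 'b, 'b \<times> 'b) digraph_isomorphism"
  have inT: "u \<in> pverts T \<and> v \<in> pverts T" if "(u, v) \<in> parcs T" for u v using tournament_arc_in[OF T that] by blast
  have "wf_digraph (with_proj T)" using inT unfolding wf_digraph_def by force
  moreover have inj: "inj_on f (pverts T)" using f unfolding bij_betw_def by simp
  moreover have "inj_on (map_prod f f) (parcs T)"
    using inj inT unfolding inj_on_def by (auto simp: map_prod_def)
  ultimately have "pre_digraph.digraph_isomorphism (with_proj T) ?h"
    unfolding pre_digraph.digraph_isomorphism_def by auto
  moreover have "parcs C = map_prod f f ` parcs T"
  proof (intro set_eqI iffI)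
    fix e assume e: "e \<in> parcs C"
    obtain p q where pq: "e = (p, q)" by (cases e)
    have "p \<in> f ` pverts T" "q \<in> f ` pverts T" using tournament_arc_in[OF C] e pq f unfolding bij_betw_def by auto
    then obtain u v where "u \<in> pverts T" "v \<in> pverts T" "p = f u" "q = f v" by auto
    then show "e \<in> map_prod f f ` parcs T" using arcs[of u v] e pq by (auto simp: image_iff intro!: bexI[of _ "(u, v)"])
  next
    fix e assume "e \<in> map_prod f f ` parcs T"
    then show "e \<in> parcs C" using arcs inT by auto
  qed
  then have "with_proj C = app_iso ?h (with_proj T)"
    using f unfolding app_iso_def with_proj_def bij_betw_def by simp
  ultimately show ?thesis unfolding tournament_iso_def digraph_iso_def by blast
qed

lemma critical_except_iso:
  assumes T: "tournament T" and iso: "tournament_iso T C" and c: "critical_except (pverts C) (arc C) y"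
  shows "\<exists>x. critical_except (pverts T) (arc T) x"
proof -
  interpret C: critical_except "pverts C" "arc C" y by (rule c)
  obtain f where f: "bij_betw f (pverts T) (pverts C)"
    and arcs: "\<And>u v. u \<in> pverts T \<Longrightarrow> v \<in> pverts T \<Longrightarrow> arc T u v = arc C (f u) (f v)"
    using tournament_isoD[OF iso] by auto
  have im: "f ` pverts T = pverts C" and inj: "inj_on f (pverts T)" using f unfolding bij_betw_def by auto
  obtain x where x: "x \<in> pverts T" "y = f x" using C.x_in im by auto
  have indZ: "ind (arc C) (f ` Z) = ind (arc T) Z" if "Z \<subseteq> pverts T" for Z
    by (rule ind_image) (use inj_on_subset[OF inj that] arcs that in auto)
  have del: "f ` (pverts T - {v}) = pverts C - {f v}" if "v \<in> pverts T" for v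
    using inj_on_image_set_diff[OF inj, of "pverts T" "{v}"] that im by auto
  have "critical_except (pverts T) (arc T) x"
  proof (intro critical_except.intro tournament_tour[OF T] critical_except_axioms.intro)
    show "x \<in> pverts T" by (rule x)
    show "ind (arc T) (pverts T)" using indZ[of "pverts T"] im C.ind_S by simp
    show "ind (arc T) (pverts T - {x})" using indZ[of "pverts T - {x}"] del[of x] x C.ind_del by auto
    show "5 \<le> card (pverts T)" using C.card_S bij_betw_same_card[OF f] by simp
    fix v assume v: "v \<in> pverts T" "v \<noteq> x"
    then have "f v \<in> pverts C" "f v \<noteq> y" using im inj x unfolding inj_on_def by auto
    then show "\<not> ind (arc T) (pverts T - {v})" using C.critical indZ[of "pverts T - {v}"] del[of v] v by auto
  qed
  then show ?thesis by blast
qed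

lemma tournament_dual:
  assumes T: "tournament T" shows "tournament (dual T)"
proof -
  interpret tournament T by fact
  show ?thesis
  proof unfold_locales
    fix x y assume "x \<in> pverts (dual T)" "y \<in> pverts (dual T)" "x \<noteq> y"
    then show "(x, y) \<in> parcs (dual T) \<longleftrightarrow> (y, x) \<notin> parcs (dual T)"
      using exactly_one_arc[of x y] unfolding dual_def by simp
  qed (use pair_finite_verts pair_finite_arcs in \<open>auto simp: dual_def dest: tournament_arc_in[OF T]\<close>)
qed

lemma dual_simps: "pverts (dual T) = pverts T" "(u, v) \<in> parcs (dual T) \<longleftrightarrow> (v, u) \<in> parcs T"
  unfolding dual_def by auto

lemma tournament_iso_dual:
  assumes T: "tournament T" and C: "tournament C" and iso: "tournament_iso (dual T) C"
  shows "tournament_iso T (dual C)"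
proof -
  obtain f where f: "bij_betw f (pverts T) (pverts C)"
    and arcs: "\<And>u v. u \<in> pverts T \<Longrightarrow> v \<in> pverts T \<Longrightarrow> arc T v u = arc C (f u) (f v)"
  proof -
    from tournament_isoD[OF iso] obtain f where "bij_betw f (pverts T) (pverts C)"
      "\<forall>u\<in>pverts T. \<forall>v\<in>pverts T. arc T v u = arc C (f u) (f v)" unfolding dual_simps by auto
    then show ?thesis using that[of f] by blast
  qed
  show ?thesis
    by (rule tournament_isoI[OF T tournament_dual[OF C], of f]) (use f arcs in \<open>auto simp: dual_def\<close>)
qed

section \<open>The families\<close>

text \<open>\<open>F i j\<close> is only meaningful for \<open>i < j\<close>, where it decides between \<open>i \<rightarrow> j\<close> and \<open>j \<rightarrow> i\<close>.\<close>

definition forward_arcs :: "nat \<Rightarrow> (nat \<Rightarrow> nat \<Rightarrow> bool) \<Rightarrow> nat pair_pre_digraph \<Rightarrow> bool" where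
  "forward_arcs N F C \<longleftrightarrow> pverts C = {0..N} \<and>
     (\<forall>i j. (i, j) \<in> parcs C \<longleftrightarrow> i \<le> N \<and> j \<le> N \<and> (i < j \<and> F i j \<or> j < i \<and> \<not> F j i))"

lemma forward_arcs_tournament: assumes "forward_arcs N F C" shows "tournament C"
proof -
  have v: "pverts C = {0..N}" and a: "\<And>i j. (i, j) \<in> parcs C \<longleftrightarrow> i \<le> N \<and> j \<le> N \<and> (i < j \<and> F i j \<or> j < i \<and> \<not> F j i)"
    using assms unfolding forward_arcs_def by auto
  have "parcs C \<subseteq> {0..N} \<times> {0..N}" using a by auto
  then have "finite (parcs C)" using finite_subset by blast
  then show ?thesis by unfold_locales (use v a in auto)
qed

text \<open>The numbering \<open>g\<close> runs from numbers to vertices, so the isomorphism is its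
  inverse. Pairs with \<open>i < j\<close> suffice because both sides are tournaments.\<close>

lemma forward_arcs_iso:
  assumes C: "forward_arcs N F C" and T: "tournament T" and g: "bij_betw g {0..N} (pverts T)"
    and arcs: "\<And>i j. i < j \<Longrightarrow> j \<le> N \<Longrightarrow> arc T (g i) (g j) = F i j"
  shows "tournament_iso T C"
proof -
  interpret tour "pverts T" "arc T" by (rule tournament_tour[OF T])
  have v: "pverts C = {0..N}" and a: "\<And>i j. (i, j) \<in> parcs C \<longleftrightarrow> i \<le> N \<and> j \<le> N \<and> (i < j \<and> F i j \<or> j < i \<and> \<not> F j i)"
    using C unfolding forward_arcs_def by auto
  let ?f = "the_inv_into {0..N} g"
  have inj: "inj_on g {0..N}" and im: "g ` {0..N} = pverts T" using g unfolding bij_betw_def by auto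
  have *: "arc T (g i) (g j) = arc C i j" if "i \<le> N" "j \<le> N" for i j
  proof -
    have gS: "g i \<in> pverts T" "g j \<in> pverts T" using im that by auto
    consider "i < j" | "j < i" | "i = j" by linarith
    then show ?thesis
    proof cases
      case 1 then show ?thesis using arcs a that by auto
    next
      case 2
      have "g i \<noteq> g j" using inj_onD[OF inj, of i j] 2 that by auto
      then show ?thesis using arcs[of j i] a that asym[of "g i" "g j"] gS 2 by auto
    next
      case 3 then show ?thesis using a tournament_arc_in[OF T, of "g i" "g j"] by auto
    qed
  qed
  show ?thesis
  proof (rule tournament_isoI[OF T forward_arcs_tournament[OF C], of ?f])
    show "bij_betw ?f (pverts T) (pverts C)" using bij_betw_the_inv_into[OF g] v by simp
    fix u w assume uw: "u \<in> pverts T" "w \<in> pverts T"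
    then have "u \<in> g ` {0..N}" "w \<in> g ` {0..N}" using im by simp_all
    then obtain i j where "u = g i" "i \<le> N" "w = g j" "j \<le> N" by auto
    then show "arc T u w = arc C (?f u) (?f w)" using * the_inv_into_f_f[OF inj] by simp
  qed
qed

lemma forward_arcs_cong:
  assumes "forward_arcs N F C" "\<And>i j. i < j \<Longrightarrow> j \<le> N \<Longrightarrow> F i j = F' i j" shows "forward_arcs N F' C"
  using assms unfolding forward_arcs_def by auto

text \<open>Pairs containing \<open>2*k + 1\<close> reach the last branch, where they either fail
  the premise or are excluded by \<open>i < j\<close>; so all arcs at that vertex point
  forward.\<close>

lemma glued_forward_arcs:
  assumes k: "k < n"
    and P: "\<And>i j. (i, j) \<in> A\<^sub>P \<longleftrightarrow> i \<le> 2*k \<and> j \<le> 2*k \<and> (i < j \<and> FP i j \<or> j < i \<and> \<not> FP j i)"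
    and Q: "\<And>i j. (i, j) \<in> A\<^sub>Q \<longleftrightarrow> 2*k + 2 \<le> i \<and> 2*k + 2 \<le> j \<and> i \<le> 2*n \<and> j \<le> 2*n \<and> (i < j \<and> FQ i j \<or> j < i \<and> \<not> FQ j i)"
  shows "forward_arcs (2*n) (\<lambda>i j. if j \<le> 2*k then FP i j else if i \<le> 2*k \<and> 2*k + 2 \<le> j then \<not> B j i
      else 2*k + 2 \<le> i \<longrightarrow> FQ i j) (glued_tournament n k A\<^sub>P A\<^sub>Q B)"
    (is "forward_arcs _ ?F ?C")
proof -
  have "(i, j) \<in> parcs ?C \<longleftrightarrow> i \<le> 2*n \<and> j \<le> 2*n \<and> (i < j \<and> ?F i j \<or> j < i \<and> \<not> ?F j i)" for i j
  proof -
    have "i \<le> 2*k \<or> i = 2*k + 1 \<or> 2*k + 2 \<le> i" "j \<le> 2*k \<or> j = 2*k + 1 \<or> 2*k + 2 \<le> j" by linarith+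
    then show ?thesis
      using k by (elim disjE; auto simp: glued_tournament_def lower_part_def upper_part_def P Q)
  qed
  then show ?thesis unfolding forward_arcs_def glued_tournament_def by simp
qed

lemma linear_arcs_lower: "(i, j) \<in> linear_arcs (lower_part k) \<longleftrightarrow>
    i \<le> 2*k \<and> j \<le> 2*k \<and> (i < j \<and> True \<or> j < i \<and> \<not> True)"
  unfolding linear_arcs_def lower_part_def by auto

lemma linear_arcs_upper: "(i, j) \<in> linear_arcs (upper_part n k) \<longleftrightarrow>
    2*k + 2 \<le> i \<and> 2*k + 2 \<le> j \<and> i \<le> 2*n \<and> j \<le> 2*n \<and> (i < j \<and> True \<or> j < i \<and> \<not> True)"
  unfolding linear_arcs_def upper_part_def by auto

lemma U_arcs: "(i, j) \<in> parcs (U_tournament k) \<longleftrightarrow>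
    i \<le> 2*k \<and> j \<le> 2*k \<and> (i < j \<and> (odd i \<or> odd j) \<or> j < i \<and> \<not> (odd j \<or> odd i))"
  unfolding U_tournament_def by auto

lemma V_arcs: "(i, j) \<in> parcs (V_tournament k) \<longleftrightarrow>
    i \<le> 2*k \<and> j \<le> 2*k \<and> (i < j \<and> (j = 2*k \<longrightarrow> odd i) \<or> j < i \<and> \<not> (i = 2*k \<longrightarrow> odd j))"
  unfolding V_tournament_def by auto

lemma upper_V_arcs: "(i, j) \<in> upper_V_arcs n k \<longleftrightarrow>
    2*k + 2 \<le> i \<and> 2*k + 2 \<le> j \<and> i \<le> 2*n \<and> j \<le> 2*n \<and>
    (i < j \<and> (j = 2*n \<longrightarrow> odd i) \<or> j < i \<and> \<not> (i = 2*n \<longrightarrow> odd j))"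
  unfolding upper_V_arcs_def linear_arcs_def by auto

text \<open>The final conjunct \<open>True\<close> stays unsimplified: it is the bit of the lower
  arm, \<open>False\<close> for \<open>F\<close>, and lets both families be instances of one
  formula.\<close>

lemma E_forward_arcs:
  assumes "k < n" shows "forward_arcs (2*n) (\<lambda>i j. 2*k < i \<or> odd i \<or> odd j \<or> j \<le> 2*k \<and> True) (E_tournament n k)"
  unfolding E_tournament_def
  by (rule forward_arcs_cong[OF glued_forward_arcs[OF assms linear_arcs_lower linear_arcs_upper]]) (auto; presburger)

lemma F_forward_arcs:
  assumes "k < n" shows "forward_arcs (2*n) (\<lambda>i j. 2*k < i \<or> odd i \<or> odd j \<or> j \<le> 2*k \<and> False) (F_tournament n k)"
  unfolding F_tournament_def
  by (rule forward_arcs_cong[OF glued_forward_arcs[OF assms U_arcs linear_arcs_upper]]) (auto; presburger)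

lemma G_forward_arcs:
  assumes "k < n"
  shows "forward_arcs (2*n) (\<lambda>i j. if j = 2*n then odd i else 2*k < j \<or> odd i \<or> odd j) (G_tournament n k)"
  unfolding G_tournament_def
  by (rule forward_arcs_cong[OF glued_forward_arcs[OF assms U_arcs upper_V_arcs]]) (use assms in \<open>auto; presburger\<close>)

lemma H_forward_arcs:
  assumes "k < n"
  shows "forward_arcs (2*n) (\<lambda>i j. (j = 2*n \<longrightarrow> i < 2*k \<or> odd i) \<and> (j = 2*k \<longrightarrow> odd i)) (H_tournament n k)"
  unfolding H_tournament_def
  by (rule forward_arcs_cong[OF glued_forward_arcs[OF assms V_arcs upper_V_arcs]]) (use assms in \<open>auto; presburger\<close>)

text \<open>Only the excepted vertex lies strictly between \<open>p\<close> and
  \<open>p + 2\<close>, so every other \<open>w\<close> is on the same side of both.\<close>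

lemma forward_twins:
  assumes C: "forward_arcs N F C" and p: "p + 2 \<le> N"
    and F: "\<And>w. w < p \<Longrightarrow> F w p = F w (p + 2)" "\<And>w. p + 2 < w \<Longrightarrow> w \<le> N \<Longrightarrow> F p w = F (p + 2) w"
  shows "twins (arc C) (pverts C - {p + 1}) p (p + 2)"
  unfolding twins_def
proof
  fix w assume "w \<in> pverts C - {p + 1} - {p, p + 2}"
  then have "w < p \<or> p + 2 < w" "w \<le> N" using C unfolding forward_arcs_def by auto
  then show "arc C p w = arc C (p + 2) w" using C p F[of w] unfolding forward_arcs_def by auto
qed

lemma forward_chain_down:
  assumes C: "forward_arcs N F C" and m: "m \<le> s" "s \<le> N"
    and F: "\<And>p w. s \<le> p + m \<Longrightarrow> p + 2 \<le> s \<Longrightarrow> w < p \<Longrightarrow> F w p = F w (p + 2)"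
      "\<And>p w. s \<le> p + m \<Longrightarrow> p + 2 \<le> s \<Longrightarrow> p + 2 < w \<Longrightarrow> w \<le> N \<Longrightarrow> F p w = F (p + 2) w"
  shows "chain (arc C) (pverts C) m (\<lambda>i. s - i)"
  unfolding chain_def
proof (intro conjI allI impI)
  show "inj_on (\<lambda>i. s - i) {..m}" using m by (auto simp: inj_on_def)
  show "(\<lambda>i. s - i) ` {..m} \<subseteq> pverts C" using C m unfolding forward_arcs_def by auto
  fix i assume i: "i + 2 \<le> m"
  let ?p = "s - (i + 2)"
  have "twins (arc C) (pverts C - {?p + 1}) ?p (?p + 2)"
    by (rule forward_twins[OF C]) (use F[of ?p] m i in auto)
  moreover have "?p + 2 = s - i" "?p + 1 = s - (i + 1)" using i m by auto
  ultimately show "twins (arc C) (pverts C - {s - (i + 1)}) (s - i) (s - (i + 2))"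
    unfolding twins_def by auto
qed

lemma forward_chain_up:
  assumes C: "forward_arcs N F C" and m: "s + m \<le> N"
    and F: "\<And>p w. s \<le> p \<Longrightarrow> p + 2 \<le> s + m \<Longrightarrow> w < p \<Longrightarrow> F w p = F w (p + 2)"
      "\<And>p w. s \<le> p \<Longrightarrow> p + 2 \<le> s + m \<Longrightarrow> p + 2 < w \<Longrightarrow> w \<le> N \<Longrightarrow> F p w = F (p + 2) w"
  shows "chain (arc C) (pverts C) m (\<lambda>i. s + i)"
  unfolding chain_def
proof (intro conjI allI impI)
  show "inj_on (\<lambda>i. s + i) {..m}" by (auto simp: inj_on_def)
  show "(\<lambda>i. s + i) ` {..m} \<subseteq> pverts C" using C m unfolding forward_arcs_def by auto
  fix i assume i: "i + 2 \<le> m"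
  have "twins (arc C) (pverts C - {s + i + 1}) (s + i) (s + i + 2)"
    by (rule forward_twins[OF C]) (use F[of "s + i"] m i in auto)
  then show "twins (arc C) (pverts C - {s + (i + 1)}) (s + i) (s + (i + 2))" by (simp add: add.assoc)
qed

lemma source_armI:
  "chain A S m a \<Longrightarrow> a 0 = x \<Longrightarrow> 1 \<le> m \<Longrightarrow> source A (S - {a m}) (a (m - 1)) \<Longrightarrow> A (a m) (a (m - 1)) \<Longrightarrow>
    source_arm A S x m a"
  unfolding source_arm_def by simp

lemma forward_arcs_tour: "forward_arcs N F C \<Longrightarrow> tour (pverts C) (arc C)"
  using forward_arcs_tournament tournament_tour by blast

section \<open>The arms inside the four families\<close>

context
  fixes n k q :: nat and C :: "nat pair_pre_digraph"
  assumes k: "1 \<le> k" and q: "1 \<le> q" and n: "n = k + q + 1"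
begin

text \<open>Here \<open>k\<close> and \<open>q\<close> are half the lengths of the arms, rounded
  down. The source arm descends from \<open>2*k + 1\<close> and the sink arm ascends from it;
  \<open>e\<close> is the bit of the source arm.\<close>

lemma odd_odd_forward:
  assumes C: "forward_arcs (2*n) (\<lambda>i j. 2*k < i \<or> odd i \<or> odd j \<or> j \<le> 2*k \<and> e) C"
  shows "odd_odd (pverts C) (arc C) (2*k+1) (2*k+1) (\<lambda>i. 2*k+1 - i) (2*q+1) (\<lambda>j. 2*k+1 + j)"
    (is "odd_odd _ _ _ _ ?a _ ?b")
proof -
  have S: "pverts C = {0..2*n}" and A: "\<And>i j. arc C i j \<longleftrightarrow> i \<le> 2*n \<and> j \<le> 2*n \<and>
    (i < j \<and> (2*k < i \<or> odd i \<or> odd j \<or> j \<le> 2*k \<and> e) \<or> j < i \<and> \<not> (2*k < j \<or> odd j \<or> odd i \<or> i \<le> 2*k \<and> e))"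
    using C unfolding forward_arcs_def by auto
  interpret tour "pverts C" "arc C" by (rule forward_arcs_tour[OF C])
  have a_chain: "chain (arc C) (pverts C) (2*k+1) ?a"
    by (rule forward_chain_down[OF C]) (use n in \<open>((cases e; auto); presburger)+\<close>)
  have a: "source_arm (arc C) (pverts C) (2*k+1) (2*k+1) ?a"
    by (rule source_armI[OF a_chain]) (use n in \<open>auto simp: A S source_def\<close>)
  have "chain (arc C) (pverts C) (2*q+1) ?b"
    by (rule forward_chain_up[OF C]) (use n in \<open>((cases e; auto); presburger)+\<close>)
  then have b_chain: "chain (\<lambda>i j. arc C j i) (pverts C) (2*q+1) ?b" using chain_dual by blast
  have b: "sink_arm (arc C) (pverts C) (2*k+1) (2*q+1) ?b"
    by (rule source_armI[OF b_chain]) (use n in \<open>auto simp: A S source_def\<close>)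
  show ?thesis
  proof unfold_locales
    show "?a ` {1..2*k+1} \<inter> ?b ` {1..2*q+1} = {}" by auto
    show "pverts C = insert (2*k+1) (?a ` {1..2*k+1} \<union> ?b ` {1..2*q+1})"
    proof (intro set_eqI iffI)
      fix v assume "v \<in> pverts C"
      then have v: "v \<le> 2*n" using S by simp
      consider "v = 2*k+1" | "v < 2*k+1" | "2*k+1 < v" by linarith
      then show "v \<in> insert (2*k+1) (?a ` {1..2*k+1} \<union> ?b ` {1..2*q+1})"
      proof cases
        case 2 then show ?thesis by (intro insertI2 UnI1 image_eqI[of _ _ "2*k+1 - v"]) auto
      next
        case 3 then show ?thesis using v n by (intro insertI2 UnI2 image_eqI[of _ _ "v - (2*k+1)"]) auto
      qed simp
    qed (use S n in auto)
    show "arc C (?b 1) (?a 1)" using n by (simp add: A)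
  qed (use a b in auto)
qed

text \<open>The ascending arm now stops at \<open>2*n - 1\<close> and leaves \<open>2*n\<close> as
  the extra vertex.\<close>

lemma odd_even_forward:
  assumes C: "forward_arcs (2*n) (\<lambda>i j. if j = 2*n then odd i else 2*k < j \<or> odd i \<or> odd j) C"
  shows "odd_even (pverts C) (arc C) (2*k+1) (2*k+1) (\<lambda>i. 2*k+1 - i) (2*q) (\<lambda>j. 2*k+1 + j) (2*n)"
    (is "odd_even _ _ _ _ ?a _ ?b _")
proof -
  have S: "pverts C = {0..2*n}" and A: "\<And>i j. arc C i j \<longleftrightarrow> i \<le> 2*n \<and> j \<le> 2*n \<and>
    (i < j \<and> (if j = 2*n then odd i else 2*k < j \<or> odd i \<or> odd j) \<or>
     j < i \<and> \<not> (if i = 2*n then odd j else 2*k < i \<or> odd j \<or> odd i))"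
    using C unfolding forward_arcs_def by auto
  interpret tour "pverts C" "arc C" by (rule forward_arcs_tour[OF C])
  have a_chain: "chain (arc C) (pverts C) (2*k+1) ?a"
    by (rule forward_chain_down[OF C]) (use n in \<open>(auto; presburger)+\<close>)
  have a: "source_arm (arc C) (pverts C) (2*k+1) (2*k+1) ?a"
    by (rule source_armI[OF a_chain]) (use n in \<open>auto simp: A S source_def\<close>)
  have "chain (arc C) (pverts C) (2*q) ?b"
    by (rule forward_chain_up[OF C]) (use n in \<open>(auto; presburger)+\<close>)
  then have b_chain: "chain (\<lambda>i j. arc C j i) (pverts C) (2*q) ?b" using chain_dual by blast
  have b: "sink_arm (arc C) (pverts C) (2*k+1) (2*q) ?b"
    by (rule source_armI[OF b_chain]) (use n q in \<open>auto simp: A S source_def\<close>)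
  show ?thesis
  proof unfold_locales
    show "?a ` {1..2*k+1} \<inter> ?b ` {1..2*q} = {}" by auto
    show "pverts C = insert (2*n) (insert (2*k+1) (?a ` {1..2*k+1} \<union> ?b ` {1..2*q}))"
    proof (intro set_eqI iffI)
      fix v assume "v \<in> pverts C"
      then have v: "v \<le> 2*n" using S by simp
      consider "v = 2*k+1" | "v < 2*k+1" | "2*k+1 < v" "v < 2*n" | "v = 2*n" using v by linarith
      then show "v \<in> insert (2*n) (insert (2*k+1) (?a ` {1..2*k+1} \<union> ?b ` {1..2*q}))"
      proof cases
        case 2 then show ?thesis by (intro insertI2 UnI1 image_eqI[of _ _ "2*k+1 - v"]) auto
      next
        case 3 then show ?thesis using n by (intro insertI2 UnI2 image_eqI[of _ _ "v - (2*k+1)"]) auto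
      qed simp_all
    qed (use S n in auto)
    show "arc C (2*n) (?a 1)" using n by (simp add: A)
    show "2*n \<in> pverts C" using S by simp
    show "2*n \<noteq> 2*k+1" by presburger
    show "2*n \<notin> ?a ` {1..2*k+1}" "2*n \<notin> ?b ` {1..2*q}" using n by auto
  qed (use a b in auto)
qed

text \<open>The descending arm jumps over \<open>2*k\<close>, which plays the part of
  \<open>r'\<close>; hence the separate value at index 0.\<close>

lemma even_even_forward:
  assumes C: "forward_arcs (2*n) (\<lambda>i j. (j = 2*n \<longrightarrow> i < 2*k \<or> odd i) \<and> (j = 2*k \<longrightarrow> odd i)) C"
  shows "even_even (pverts C) (arc C) (2*k+1) (2*k) (\<lambda>i. if i = 0 then 2*k+1 else 2*k - i) (2*q) (\<lambda>j. 2*k+1 + j) (2*n) (2*k)"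
    (is "even_even _ _ _ _ ?a _ ?b _ _")
proof -
  have S: "pverts C = {0..2*n}" and A: "\<And>i j. arc C i j \<longleftrightarrow> i \<le> 2*n \<and> j \<le> 2*n \<and>
    (i < j \<and> (j = 2*n \<longrightarrow> i < 2*k \<or> odd i) \<and> (j = 2*k \<longrightarrow> odd i) \<or>
     j < i \<and> \<not> ((i = 2*n \<longrightarrow> j < 2*k \<or> odd j) \<and> (i = 2*k \<longrightarrow> odd j)))"
    using C unfolding forward_arcs_def by auto
  interpret tour "pverts C" "arc C" by (rule forward_arcs_tour[OF C])
  have a_chain: "chain (arc C) (pverts C) (2*k) ?a"
    unfolding chain_def
  proof (intro conjI allI impI)
    show "inj_on ?a {..2*k}" by (auto simp: inj_on_def split: if_splits)
    show "?a ` {..2*k} \<subseteq> pverts C" by (rule image_subsetI) (use S n in auto)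
    fix i assume i: "i + 2 \<le> 2*k"
    show "twins (arc C) (pverts C - {?a (i + 1)}) (?a i) (?a (i + 2))"
    proof (cases "i = 0")
      case True
      \<comment> \<open>Across the jump the arm goes from \<open>2*k + 1\<close> to
        \<open>2*k - 2\<close> in two steps, which is not of the form \<open>p + 2\<close> and
        \<open>p\<close>; this twin relation is checked directly.\<close>
      obtain k' where "k = Suc k'" using k by (cases k) auto
      then show ?thesis using True n by (auto simp: twins_def S A)
    next
      case False
      have "twins (arc C) (pverts C - {2*k - (i + 2) + 1}) (2*k - (i + 2)) (2*k - (i + 2) + 2)"
        by (rule forward_twins[OF C]) (use n i False in \<open>(auto; presburger)+\<close>)
      moreover have "2*k - (i + 2) + 2 = 2*k - i" "2*k - (i + 2) + 1 = 2*k - (i + 1)" using i by auto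
      ultimately show ?thesis using False unfolding twins_def by auto
    qed
  qed
  have a: "source_arm (arc C) (pverts C) (2*k+1) (2*k) ?a"
    by (rule source_armI[OF a_chain]) (use n k in \<open>auto simp: A S source_def\<close>)
  have "chain (arc C) (pverts C) (2*q) ?b"
    by (rule forward_chain_up[OF C]) (use n in \<open>(auto; presburger)+\<close>)
  then have b_chain: "chain (\<lambda>i j. arc C j i) (pverts C) (2*q) ?b" using chain_dual by blast
  have b: "sink_arm (arc C) (pverts C) (2*k+1) (2*q) ?b"
    by (rule source_armI[OF b_chain]) (use n q in \<open>auto simp: A S source_def\<close>)
  show ?thesis
  proof unfold_locales
    show "?a ` {1..2*k} \<inter> ?b ` {1..2*q} = {}" by auto
    show "pverts C = insert (2*n) (insert (2*k) (insert (2*k+1) (?a ` {1..2*k} \<union> ?b ` {1..2*q})))"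
    proof (intro set_eqI iffI)
      fix v assume "v \<in> pverts C"
      then have v: "v \<le> 2*n" using S by simp
      consider "v = 2*k+1" | "v = 2*k" | "v < 2*k" | "2*k+1 < v" "v < 2*n" | "v = 2*n" using v by linarith
      then show "v \<in> insert (2*n) (insert (2*k) (insert (2*k+1) (?a ` {1..2*k} \<union> ?b ` {1..2*q})))"
      proof cases
        case 3 then show ?thesis by (intro insertI2 UnI1 image_eqI[of _ _ "2*k - v"]) auto
      next
        case 4 then show ?thesis using n by (intro insertI2 UnI2 image_eqI[of _ _ "v - (2*k+1)"]) auto
      qed simp_all
    qed (use S n in \<open>auto split: if_splits\<close>)
    show "2*n \<in> pverts C" "2*k \<in> pverts C" using S n by auto
    show "2*n \<noteq> 2*k+1" "2*k \<noteq> 2*k+1" by presburger+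
    show "2*n \<notin> ?a ` {1..2*k}" "2*n \<notin> ?b ` {1..2*q}" "2*k \<notin> ?a ` {1..2*k}" "2*k \<notin> ?b ` {1..2*q}"
      using n by (auto split: if_splits)
    show "arc C (2*k+1) (2*n)" "arc C (2*n) (2*k)" "arc C (2*k) (2*k+1)" "arc C (2*k+1) (?b 2)"
      using n q by (auto simp: A)
  qed (use a b in auto)
qed

end

lemma bij_betw_of_card:
  assumes "g ` {0..N::nat} = S" "card S = N + 1" shows "bij_betw g {0..N} S"
  using assms eq_card_imp_inj_on[of "{0..N}" g] unfolding bij_betw_def by simp

section \<open>Numbering the vertices of each shape\<close>

context two_arms
begin

text \<open>The vertex numbering of the four families: down the arm \<open>a\<close> to \<open>x\<close>, then up the arm \<open>b\<close>.
  The vertex \<open>r\<close> outside the arms becomes \<open>2n\<close> and \<open>r'\<close> becomes \<open>2k\<close>.\<close>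

definition position :: "nat \<Rightarrow> 'a" where
  "position i = (if i \<le> m then a (m - i) else b (i - m))"

lemma position_image: "position ` {0..m + l} = insert x (a ` {1..m} \<union> b ` {1..l})"
proof (intro set_eqI iffI)
  fix v assume "v \<in> position ` {0..m + l}"
  then obtain i where i: "v = position i" "i \<le> m + l" by auto
  consider "i < m" | "i = m" | "m < i" by linarith
  then show "v \<in> insert x (a ` {1..m} \<union> b ` {1..l})"
  proof cases
    case 1 then show ?thesis using i unfolding position_def by auto
  next
    case 2 then show ?thesis using i a_0 unfolding position_def by auto
  next
    case 3
    then have "v = b (i - m)" "i - m \<in> {1..l}" using i unfolding position_def by auto
    then show ?thesis by blast
  qed
next
  fix v assume "v \<in> insert x (a ` {1..m} \<union> b ` {1..l})"
  then consider "v = x" | i where "v = a i" "1 \<le> i" "i \<le> m" | j where "v = b j" "1 \<le> j" "j \<le> l" by auto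
  then show "v \<in> position ` {0..m + l}"
  proof cases
    case 1 then show ?thesis using a_0 unfolding position_def by (intro image_eqI[of _ _ m]) auto
  next
    case (2 i) then show ?thesis unfolding position_def by (intro image_eqI[of _ _ "m - i"]) auto
  next
    case (3 j) then show ?thesis unfolding position_def by (intro image_eqI[of _ _ "m + j"]) auto
  qed
qed

end

context odd_odd
begin

text \<open>Reversing all arcs turns source arms into sink arms, and the arc from \<open>b 1\<close>
  to \<open>a 1\<close> keeps its role once the arms are exchanged.\<close>

lemma dual_odd_odd: "odd_odd S (\<lambda>x y. A y x) x l b m a"
proof -
  interpret D: tour S "\<lambda>x y. A y x" by (rule dual_tour)
  show ?thesis
    by unfold_locales (use a_arm b_arm arms_disjoint odd_ml S_eq b1_a1 in auto)
qed

lemma critical_except_x: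
  assumes "3 \<le> m" "3 \<le> l" "A (b 1) (b 3)" "5 \<le> card S" shows "critical_except S A x"
  by unfold_locales (use x_in_S ind_all critical_all ind_del_x assms in auto)

text \<open>Descending an odd arm exchanges parities, as number \<open>i\<close> has index
  \<open>m - i\<close>. The last clause is the bit of \<open>a\<close>, the only one still
  open.\<close>

lemma position_arcs:
  assumes ml: "3 \<le> m" "3 \<le> l" and lin: "A (b 1) (b 3)" and ij: "i < j" "j \<le> m + l"
  shows "A (position i) (position j) \<longleftrightarrow> m \<le> i \<or> odd i \<or> odd j \<or> j \<le> m \<and> A (a 3) (a 1)"
proof -
  consider "j \<le> m" | "i < m" "m < j" | "m \<le> i" using ij by linarith
  then show ?thesis
  proof cases
    case 1
    let ?i = "m - i" and ?j = "m - j"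
    have ji: "?j < ?i" "?i \<le> m" and odd: "odd ?i \<longleftrightarrow> even i" "odd ?j \<longleftrightarrow> even j" using 1 ij odd_ml by auto
    have "A (a ?i) (a ?j) \<longleftrightarrow> odd i \<or> odd j \<or> A (a 3) (a 1)"
    proof (cases "odd i \<or> odd j")
      case True
      then show ?thesis using a_arc[OF ji] odd odd_ml by auto
    next
      case False
      then have "A (a ?j) (a ?i) = A (a 1) (a 3)"
        using a_bit[OF ji, of 1] odd odd_ml by (simp add: numeral_3_eq_3)
      then show ?thesis
        using False asym[of "a ?j" "a ?i"] asym[of "a 1" "a 3"] a_in a_neq[of ?j ?i] a_neq[of 1 3] ji ml by auto
    qed
    then show ?thesis using 1 ij unfolding position_def by auto
  next
    case 2
    let ?i = "m - i" and ?j = "j - m"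
    have r: "1 \<le> ?i" "?i \<le> m" "1 \<le> ?j" "?j \<le> l" and odd: "odd ?i \<longleftrightarrow> even i" "odd ?j \<longleftrightarrow> even j" using 2 ij odd_ml by auto
    have "A (a ?i) (b ?j) \<longleftrightarrow> odd i \<or> odd j"
    proof (cases "odd i \<or> odd j")
      case True
      then have "odd (?i + m) \<or> odd (?j + l)" using odd odd_ml by auto
      then show ?thesis using a_out_b[of ?i ?j] a_into_b[of ?j ?i] r True by blast
    next
      case False
      then have "A (b ?j) (a ?i)" using b_a[of ?i ?j] r odd by auto
      then show ?thesis using False asymD[of "b ?j" "a ?i"] a_in b_in ab_neq r by metis
    qed
    then show ?thesis using 2 unfolding position_def by auto
  next
    case 3
    let ?i = "i - m" and ?j = "j - m"
    have r: "?i < ?j" "?j \<le> l" using 3 ij by auto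
    have "A (b ?i) (b ?j)"
    proof (cases "odd (?i + l) \<or> odd (?j + l)")
      case True then show ?thesis using b_arc[OF r] by blast
    next
      case False
      then have "A (b ?j) (b ?i) = A (b 3) (b 1)"
        using b_bit[OF r, of 1] odd_ml by (simp add: numeral_3_eq_3)
      then show ?thesis
        using lin asym[of "b ?j" "b ?i"] asym[of "b 1" "b 3"] b_in b_neq[of ?j ?i] b_neq[of 1 3] r ml by auto
    qed
    moreover have "position i = b ?i" using 3 a_0 b_0 unfolding position_def by (cases "i = m") auto
    moreover have "position j = b ?j" using 3 ij unfolding position_def by auto
    ultimately show ?thesis using 3 by simp
  qed
qed

end

context odd_even
begin

lemma critical_except_x:
  assumes "3 \<le> m" "A (a 1) (a 3)" "5 \<le> card S" shows "critical_except S A x"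
  by unfold_locales (use x_in_S ind_all critical_all ind_del_x assms in auto)

definition position' :: "nat \<Rightarrow> 'a" where
  "position' i = (if i = m + l + 1 then r else position i)"

lemma position'_bij: "bij_betw position' {0..m + l + 1} S"
proof (rule bij_betw_of_card)
  have image: "position' ` {0..m + l} = position ` {0..m + l}" by (intro image_cong) (auto simp: position'_def)
  have "{0..m + l + 1} = insert (m + l + 1) {0..m + l}" by auto
  then have "position' ` {0..m + l + 1} = insert (position' (m + l + 1)) (position' ` {0..m + l})" by simp
  also have "\<dots> = S" unfolding image position_image using S_eq by (simp add: position'_def)
  finally show "position' ` {0..m + l + 1} = S" .
  have "card S = card (insert r (insert x (a ` {1..m} \<union> b ` {1..l})))" using S_eq by simp
  also have "\<dots> = m + l + 2" using card_two_arms r_in by simp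
  finally show "card S = m + l + 1 + 1" by simp
qed

lemma position'_arcs:
  assumes m: "3 \<le> m" and bit: "A (a 1) (a 3)" and ij: "i < j" "j \<le> m + l + 1"
  shows "A (position' i) (position' j) \<longleftrightarrow> (if j = m + l + 1 then odd i else m \<le> j \<or> odd i \<or> odd j)"
proof -
  consider "j = m + l + 1" "i \<le> m" | "j = m + l + 1" "m < i" | "j \<le> m"
    | "i < m" "m < j" "j \<le> m + l" | "m \<le> i" "j \<le> m + l" using ij by linarith
  then show ?thesis
  proof cases
    case 1
    have "even (m - i) \<longleftrightarrow> odd i" using 1 parity_ml by auto
    then have "A (a (m - i)) r \<longleftrightarrow> odd i"
      using a_r[of "m - i"] r_a[of "m - i"] asym[of "a (m - i)" r] a_in[of "m - i"] r_in r_neq(1)[of "m - i"] by auto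
    then show ?thesis using 1 unfolding position'_def position_def by auto
  next
    case 2
    have "even (i - m) \<longleftrightarrow> odd i" using 2 parity_ml by auto
    moreover have "i - m \<le> l" using 2 ij by simp
    ultimately have "A (b (i - m)) r \<longleftrightarrow> odd i"
      using b_r[of "i - m"] r_b[of "i - m"] asym[of "b (i - m)" r] b_in[of "i - m"] r_in r_neq(2)[of "i - m"] by auto
    then show ?thesis using 2 ij unfolding position'_def position_def by auto
  next
    case 3
    let ?i = "m - i" and ?j = "m - j"
    have ji: "?j < ?i" "?i \<le> m" and odd: "odd ?i \<longleftrightarrow> even i" "odd ?j \<longleftrightarrow> even j" using 3 ij parity_ml by auto
    have "A (a ?i) (a ?j) \<longleftrightarrow> odd i \<or> odd j"
    proof (cases "odd i \<or> odd j")
      case True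
      then show ?thesis using a_arc[OF ji] odd parity_ml by auto
    next
      case False
      then have "A (a ?j) (a ?i)"
        using a_bit[OF ji, of 1] odd parity_ml bit by (simp add: numeral_3_eq_3)
      then show ?thesis using False asymD[of "a ?j" "a ?i"] a_in a_neq[of ?j ?i] ji by auto
    qed
    moreover have "j = m \<Longrightarrow> odd j" using parity_ml by simp
    ultimately show ?thesis using 3 ij unfolding position'_def position_def by auto
  next
    case 4
    have "A (a (m - i)) (b (j - m))" using a_b[of "m - i" "j - m"] 4 by auto
    then show ?thesis using 4 unfolding position'_def position_def by auto
  next
    case 5
    have "A (b (i - m)) (b (j - m))" using b_linear[of "i - m" "j - m"] 5 ij by auto
    moreover have "position i = b (i - m)" using 5 a_0 b_0 unfolding position_def by (cases "i = m") auto
    moreover have "position j = b (j - m)" using 5 ij unfolding position_def by auto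
    ultimately show ?thesis using 5 ij unfolding position'_def by auto
  qed
qed

end

context even_even
begin

lemma critical_except_x: "5 \<le> card S \<Longrightarrow> critical_except S A x"
  by unfold_locales (use x_in_S ind_all critical_all ind_del_x in auto)

text \<open>Since \<open>r'\<close> occupies the number \<open>m\<close>, the vertex
  \<open>x\<close> appears as \<open>b 0\<close> at \<open>m + 1\<close>.\<close>

definition position' :: "nat \<Rightarrow> 'a" where
  "position' i = (if i < m then a (m - i) else if i = m then r' else if i = m + l + 2 then r else b (i - m - 1))"

lemma position'_bij: "bij_betw position' {0..m + l + 2} S"
proof (rule bij_betw_of_card)
  have "card S = card (insert r (insert r' (insert x (a ` {1..m} \<union> b ` {1..l}))))" using S_eq by simp
  also have "\<dots> = m + l + 3" using card_two_arms r_in r'_in r_neq(5) by simp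
  finally show "card S = m + l + 2 + 1" by simp
  show "position' ` {0..m + l + 2} = S"
  proof (intro set_eqI iffI)
    fix v assume "v \<in> position' ` {0..m + l + 2}"
    then obtain i where i: "v = position' i" "i \<le> m + l + 2" by auto
    then show "v \<in> S" using a_in b_in r_in r'_in unfolding position'_def by auto
  next
    fix v assume "v \<in> S"
    then consider "v = x" | "v = r" | "v = r'" | i where "v = a i" "1 \<le> i" "i \<le> m" | j where "v = b j" "1 \<le> j" "j \<le> l"
      using S_eq by auto
    then show "v \<in> position' ` {0..m + l + 2}"
    proof cases
      case 1 then show ?thesis using b_0 unfolding position'_def by (intro image_eqI[of _ _ "m + 1"]) auto
    next
      case 2 then show ?thesis unfolding position'_def by (intro image_eqI[of _ _ "m + l + 2"]) auto
    next
      case 3 then show ?thesis unfolding position'_def by (intro image_eqI[of _ _ m]) auto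
    next
      case (4 i) then show ?thesis unfolding position'_def by (intro image_eqI[of _ _ "m - i"]) auto
    next
      case (5 j) then show ?thesis unfolding position'_def by (intro image_eqI[of _ _ "m + j + 1"]) auto
    qed
  qed
qed

lemma position'_arcs:
  assumes ij: "i < j" "j \<le> m + l + 2"
  shows "A (position' i) (position' j) \<longleftrightarrow> (j = m + l + 2 \<longrightarrow> i < m \<or> odd i) \<and> (j = m \<longrightarrow> odd i)"
proof -
  consider "j < m" | "i < m" "j = m" | "i < m" "j = m + 1" | "i < m" "m + 1 < j" "j < m + l + 2" | "i < m" "j = m + l + 2"
    | "i = m" "j < m + l + 2" | "i = m" "j = m + l + 2" | "m < i" "j < m + l + 2" | "m < i" "j = m + l + 2"
    using ij by (cases "j < m"; cases "i < m"; cases "j = m + l + 2"; force)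
  then show ?thesis
  proof cases
    case 1 then show ?thesis using a_linear[of "m - j" "m - i"] ij unfolding position'_def by auto
  next
    case 2
    have "odd (m - i) \<longleftrightarrow> odd i" using 2 parity_ml by auto
    then have "A (a (m - i)) r' \<longleftrightarrow> odd i"
      using a_r'[of "m - i"] r'_a[of "m - i"] asym[of "a (m - i)" r'] a_in[of "m - i"] r'_in r_neq(3)[of "m - i"] by auto
    then show ?thesis using 2 unfolding position'_def by auto
  next
    case 3 then show ?thesis using a_x[of "m - i"] b_0 unfolding position'_def by auto
  next
    case 4 then show ?thesis using a_b[of "m - i" "j - m - 1"] unfolding position'_def by auto
  next
    case 5 then show ?thesis using a_r[of "m - i"] unfolding position'_def by auto
  next
    case 6 then show ?thesis using r'_b[of "j - m - 1"] ij unfolding position'_def by auto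
  next
    case 7 then show ?thesis using asymD[OF r_r'] r_in r'_in r_neq(5) parity_ml unfolding position'_def by auto
  next
    case 8 then show ?thesis using b_linear[of "i - m - 1" "j - m - 1"] ij unfolding position'_def by auto
  next
    case 9
    let ?i = "i - m - 1"
    have i: "?i \<le> l" using 9 ij by simp
    have "even ?i \<longleftrightarrow> odd i" using 9 parity_ml by auto
    then have "A (b ?i) r \<longleftrightarrow> odd i"
      using b_r[of ?i] r_b[of ?i] asym[of "b ?i" r] b_in[of ?i] r_in r_neq(2)[of ?i] i by auto
    then show ?thesis using 9 ij unfolding position'_def by auto
  qed
qed

end

section \<open>From the three shapes to the families\<close>

lemma odd_odd_iso:
  assumes T: "tournament T" and oo: "odd_odd (pverts T) (arc T) x m a l b" and ml: "3 \<le> m" "3 \<le> l"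
    and lin: "arc T (b 1) (b 3)"
  shows "\<exists>n k. 3 \<le> n \<and> 1 \<le> k \<and> k \<le> n - 2 \<and>
    tournament_iso T (if arc T (a 3) (a 1) then E_tournament n k else F_tournament n k)"
proof -
  interpret odd_odd "pverts T" "arc T" x m a l b by (rule oo)
  obtain k q where kq: "m = 2*k + 1" "l = 2*q + 1" using odd_ml by (auto elim!: oddE)
  define n where "n = k + q + 1"
  have N: "m + l = 2*n" and n: "k < n" "1 \<le> k" "1 \<le> q" "3 \<le> n" "k \<le> n - 2" using kq ml n_def by auto
  have bij: "bij_betw position {0..2*n} (pverts T)"
  proof (rule bij_betw_of_card)
    show "position ` {0..2*n} = pverts T" using position_image N S_eq by simp
    have "card (pverts T) = card (insert x (a ` {1..m} \<union> b ` {1..l}))" using S_eq by simp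
    then show "card (pverts T) = 2*n + 1" using card_two_arms N by simp
  qed
  have arcs: "arc T (position i) (position j) \<longleftrightarrow> 2*k < i \<or> odd i \<or> odd j \<or> j \<le> 2*k \<and> arc T (a 3) (a 1)"
    if "i < j" "j \<le> 2*n" for i j
  proof -
    have "j \<le> m \<longleftrightarrow> j \<le> 2*k \<or> j = 2*k + 1" "m \<le> i \<longleftrightarrow> 2*k < i" using kq by auto
    moreover have "odd (2*k + 1)" by simp
    ultimately show ?thesis using position_arcs[OF ml lin, of i j] that N by auto
  qed
  show ?thesis
  proof (cases "arc T (a 3) (a 1)")
    case True
    have "tournament_iso T (E_tournament n k)"
      by (rule forward_arcs_iso[OF E_forward_arcs[OF n(1)] T bij]) (use arcs True in blast)
    then show ?thesis using n True by auto
  next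
    case False
    have "tournament_iso T (F_tournament n k)"
      by (rule forward_arcs_iso[OF F_forward_arcs[OF n(1)] T bij]) (use arcs False in blast)
    then show ?thesis using n False by auto
  qed
qed

lemma odd_even_iso:
  assumes T: "tournament T" and oe: "odd_even (pverts T) (arc T) x m a l b r" and m: "3 \<le> m"
    and bit: "arc T (a 1) (a 3)"
  shows "\<exists>n k. 3 \<le> n \<and> 1 \<le> k \<and> k \<le> n - 2 \<and> tournament_iso T (G_tournament n k)"
proof -
  interpret odd_even "pverts T" "arc T" x m a l b r by (rule oe)
  obtain k q where kq: "m = 2*k + 1" "l = 2*q" using parity_ml by (auto elim!: oddE evenE)
  define n where "n = k + q + 1"
  have N: "m + l + 1 = 2*n" and n: "k < n" "1 \<le> k" "3 \<le> n" "k \<le> n - 2" using kq m l_ge_2 n_def by auto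
  have bij: "bij_betw position' {0..2*n} (pverts T)" using position'_bij N by simp
  have arcs: "arc T (position' i) (position' j) \<longleftrightarrow> (if j = 2*n then odd i else 2*k < j \<or> odd i \<or> odd j)"
    if "i < j" "j \<le> 2*n" for i j
  proof -
    have "m \<le> j \<longleftrightarrow> 2*k < j" using kq by auto
    then show ?thesis using position'_arcs[OF m bit, of i j] that N by simp
  qed
  have "tournament_iso T (G_tournament n k)"
    by (rule forward_arcs_iso[OF G_forward_arcs[OF n(1)] T bij arcs])
  then show ?thesis using n by blast
qed

lemma even_even_iso:
  assumes T: "tournament T" and ee: "even_even (pverts T) (arc T) x m a l b r r'"
  shows "\<exists>n k. 3 \<le> n \<and> 1 \<le> k \<and> k \<le> n - 2 \<and> tournament_iso T (H_tournament n k)"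
proof -
  interpret even_even "pverts T" "arc T" x m a l b r r' by (rule ee)
  obtain k q where kq: "m = 2*k" "l = 2*q" using parity_ml by (auto elim!: evenE)
  define n where "n = k + q + 1"
  have N: "m + l + 2 = 2*n" and n: "k < n" "1 \<le> k" "3 \<le> n" "k \<le> n - 2" using kq m_ge_2 l_ge_2 n_def by auto
  have bij: "bij_betw position' {0..2*n} (pverts T)" using position'_bij N by simp
  have arcs: "arc T (position' i) (position' j) \<longleftrightarrow> (j = 2*n \<longrightarrow> i < 2*k \<or> odd i) \<and> (j = 2*k \<longrightarrow> odd i)"
    if "i < j" "j \<le> 2*n" for i j
    using position'_arcs[of i j] that N kq by simp
  have "tournament_iso T (H_tournament n k)"
    by (rule forward_arcs_iso[OF H_forward_arcs[OF n(1)] T bij arcs])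
  then show ?thesis using n by blast
qed

abbreviation (input) families :: "nat \<Rightarrow> nat \<Rightarrow> nat pair_pre_digraph set" where
  "families n k \<equiv> {E_tournament n k, F_tournament n k, dual (F_tournament n k),
     G_tournament n k, dual (G_tournament n k), H_tournament n k}"

text \<open>Each family is recognised as one of the three shapes, and the shape supplies the
  criticality.\<close>

lemma families_critical_except:
  assumes n: "3 \<le> n" "1 \<le> k" "k \<le> n - 2"
    and C: "C \<in> {E_tournament n k, F_tournament n k, G_tournament n k, H_tournament n k}"
  shows "tournament C" "critical_except (pverts C) (arc C) (2*k + 1)"
proof -
  obtain q where q: "1 \<le> q" "n = k + q + 1" using n by (intro that[of "n - k - 1"]) auto
  have kn: "k < n" using n by simp
  have c5: "5 \<le> card (pverts C)" if "forward_arcs (2*n) F C" for F C using that n unfolding forward_arcs_def by auto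
  have oo: "critical_except (pverts C) (arc C) (2*k + 1)"
    if C: "forward_arcs (2*n) (\<lambda>i j. 2*k < i \<or> odd i \<or> odd j \<or> j \<le> 2*k \<and> e) C" for e C
  proof (rule odd_odd.critical_except_x[OF odd_odd_forward[OF n(2) q C]])
    show "arc C (2*k + 1 + 1) (2*k + 1 + 3)" using C q unfolding forward_arcs_def by auto
  qed (use n q c5[OF C] in auto)
  from C consider "C = E_tournament n k" | "C = F_tournament n k" | "C = G_tournament n k" | "C = H_tournament n k" by blast
  then have "tournament C \<and> critical_except (pverts C) (arc C) (2*k + 1)"
  proof cases
    case 1 then show ?thesis using E_forward_arcs[OF kn] forward_arcs_tournament oo by blast
  next
    case 2 then show ?thesis using F_forward_arcs[OF kn] forward_arcs_tournament oo by blast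
  next
    case 3
    note C = G_forward_arcs[OF kn, folded 3]
    have "critical_except (pverts C) (arc C) (2*k + 1)"
    proof (rule odd_even.critical_except_x[OF odd_even_forward[OF n(2) q C]])
      show "arc C (2*k + 1 - 1) (2*k + 1 - 3)" using C q n unfolding forward_arcs_def by auto
    qed (use n c5[OF C] in auto)
    then show ?thesis using forward_arcs_tournament[OF C] by blast
  next
    case 4
    note C = H_forward_arcs[OF kn, folded 4]
    show ?thesis
      using even_even.critical_except_x[OF even_even_forward[OF n(2) q C] c5[OF C]] forward_arcs_tournament[OF C] by blast
  qed
  then show "tournament C" "critical_except (pverts C) (arc C) (2*k + 1)" by blast+
qed

lemma critical_except_dual_tournament:
  assumes "critical_except (pverts C) (arc C) x" shows "critical_except (pverts (dual C)) (arc (dual C)) x"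
  using critical_except.dual_critical_except[OF assms] by (simp add: dual_simps)

lemma critical_except_noncritical_vertex:
  assumes "critical_except (pverts C) (arc C) x" shows "noncritical_vertex C v \<longleftrightarrow> v = x"
proof -
  interpret critical_except "pverts C" "arc C" x by (rule assms)
  show ?thesis unfolding noncritical_vertex_iff using ind_S ind_del critical x_in by blast
qed

lemma critical_except_imp_iso:
  assumes T: "tournament T" and c: "critical_except (pverts T) (arc T) x"
  shows "\<exists>n k. 3 \<le> n \<and> 1 \<le> k \<and> k \<le> n - 2 \<and> (\<exists>C\<in>families n k. tournament_iso T C)"
proof -
  interpret critical_except "pverts T" "arc T" x by (rule c)
  note dT = tournament_dual[OF T]
  let ?goal = "\<exists>n k. 3 \<le> n \<and> 1 \<le> k \<and> k \<le> n - 2 \<and> (\<exists>C\<in>families n k. tournament_iso T C)"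
  have dual_iso: "tournament_iso T (dual C)"
    if "3 \<le> n" "1 \<le> k" "k \<le> n - 2" "C \<in> {E_tournament n k, F_tournament n k, G_tournament n k, H_tournament n k}"
      "tournament_iso (dual T) C" for n k C
    using tournament_iso_dual[OF T families_critical_except(1)[OF that(1-4)] that(5)] .
  have odd_odd: ?goal if oo: "odd_odd (pverts T) (arc T) x m a l b" and ml: "3 \<le> m" "3 \<le> l"
    and bits: "\<not> (arc T (a 1) (a 3) \<and> arc T (b 3) (b 1))" for m a l b
  proof -
    interpret odd_odd "pverts T" "arc T" x m a l b by (rule oo)
    show ?thesis
    proof (cases "arc T (b 1) (b 3)")
      case True
      from odd_odd_iso[OF T oo ml True] show ?thesis by (auto split: if_splits)
    next
      \<comment> \<open>The excluded pair of bits now fixes the bit of \<open>a\<close>. In the dual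
        the arms are exchanged, and the values of the bits are those of \<open>F\<close>; so only
        the dual of \<open>F\<close> arises here, never that of \<open>E\<close>.\<close>
      case False
      then have "arc T (b 3) (b 1)" using asym[of "b 1" "b 3"] b_in b_neq ml by auto
      then have na: "\<not> arc T (a 1) (a 3)" using bits by blast
      then have d_lin: "arc (dual T) (a 1) (a 3)"
        using asym[of "a 1" "a 3"] a_in a_neq ml by (auto simp: dual_simps)
      have d_oo: "odd_odd (pverts (dual T)) (arc (dual T)) x l b m a"
        using dual_odd_odd by (simp add: dual_simps)
      have "\<not> arc (dual T) (b 3) (b 1)" using False by (simp add: dual_simps)
      then obtain n k where nk: "3 \<le> n" "1 \<le> k" "k \<le> n - 2"
        and iso: "tournament_iso (dual T) (F_tournament n k)"
        using odd_odd_iso[OF dT d_oo ml(2,1) d_lin] by auto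
      have "tournament_iso T (dual (F_tournament n k))" by (rule dual_iso[OF nk _ iso]) simp
      then show ?thesis using nk by blast
    qed
  qed
  from classification show ?thesis
  proof (elim disjE exE conjE)
    fix m a l b
    assume "odd_odd (pverts T) (arc T) x m a l b" "3 \<le> m" "3 \<le> l" "\<not> (arc T (a 1) (a 3) \<and> arc T (b 3) (b 1))"
    then show ?thesis by (rule odd_odd)
  next
    fix m a l b r
    assume "odd_even (pverts T) (arc T) x m a l b r" "3 \<le> m" "arc T (a 1) (a 3)"
    from odd_even_iso[OF T this] show ?thesis by blast
  next
    fix m a l b
    assume oo: "odd_odd (pverts T) (\<lambda>u v. arc T v u) x m a l b" and ml: "3 \<le> m" "3 \<le> l"
      and bits: "\<not> (arc T (a 3) (a 1) \<and> arc T (b 1) (b 3))"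
    \<comment> \<open>The converse of two odd arms is again two odd arms, so this is the first case
      with the arms exchanged.\<close>
    show ?thesis by (rule odd_odd[OF odd_odd.dual_odd_odd[OF oo] ml(2,1)]) (use bits in blast)
  next
    fix m a l b r
    assume oe: "odd_even (pverts T) (\<lambda>u v. arc T v u) x m a l b r" and m: "3 \<le> m" and bit: "arc T (a 3) (a 1)"
    have "odd_even (pverts (dual T)) (arc (dual T)) x m a l b r" "arc (dual T) (a 1) (a 3)"
      using oe bit by (simp_all add: dual_simps)
    then obtain n k where nk: "3 \<le> n" "1 \<le> k" "k \<le> n - 2" and iso: "tournament_iso (dual T) (G_tournament n k)"
      using odd_even_iso[OF dT _ m] by blast
    have "tournament_iso T (dual (G_tournament n k))" by (rule dual_iso[OF nk _ iso]) simp
    then show ?thesis using nk by blast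
  next
    fix m a l b r r'
    assume "even_even (pverts T) (arc T) x m a l b r r'"
    from even_even_iso[OF T this] show ?thesis by blast
  qed
qed

theorem theorem1p3:
  fixes T :: "'a pair_pre_digraph"
  assumes "tournament T"
  shows "(minus_one_critical T \<longleftrightarrow>
      (\<exists>n k. 3 \<le> n \<and> 1 \<le> k \<and> k \<le> n - 2 \<and>
        (\<exists>C \<in> {E_tournament n k, F_tournament n k, dual (F_tournament n k),
               G_tournament n k, dual (G_tournament n k), H_tournament n k}.
          tournament_iso T C))) \<and>
    (\<forall>n k. 3 \<le> n \<and> 1 \<le> k \<and> k \<le> n - 2 \<longrightarrow>
      (\<forall>C \<in> {E_tournament n k, F_tournament n k, dual (F_tournament n k),
             G_tournament n k, dual (G_tournament n k), H_tournament n k}.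
        \<forall>x. noncritical_vertex C x \<longleftrightarrow> x = 2*k + 1))"
proof -
  have crit: "critical_except (pverts C) (arc C) (2*k + 1)"
    if n: "3 \<le> n" "1 \<le> k" "k \<le> n - 2"
      and C: "C \<in> families n k" for n k C
  proof -
    note fam = families_critical_except(2)[OF n]
    from C consider "C \<in> {E_tournament n k, F_tournament n k, G_tournament n k, H_tournament n k}"
      | "C = dual (F_tournament n k)" | "C = dual (G_tournament n k)" by auto
    then show ?thesis
    proof cases
      case 1 then show ?thesis by (rule fam)
    next
      case 2 show ?thesis unfolding 2 by (rule critical_except_dual_tournament[OF fam]) simp
    next
      case 3 show ?thesis unfolding 3 by (rule critical_except_dual_tournament[OF fam]) simp
    qed
  qed
  have "minus_one_critical T \<longleftrightarrow>
      (\<exists>n k. 3 \<le> n \<and> 1 \<le> k \<and> k \<le> n - 2 \<and> (\<exists>C\<in>families n k. tournament_iso T C))"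
    unfolding minus_one_critical_iff[OF assms]
  proof
    assume "\<exists>x. critical_except (pverts T) (arc T) x"
    then obtain x where "critical_except (pverts T) (arc T) x" ..
    then show "\<exists>n k. 3 \<le> n \<and> 1 \<le> k \<and> k \<le> n - 2 \<and> (\<exists>C\<in>families n k. tournament_iso T C)"
      by (rule critical_except_imp_iso[OF assms])
  next
    assume "\<exists>n k. 3 \<le> n \<and> 1 \<le> k \<and> k \<le> n - 2 \<and> (\<exists>C\<in>families n k. tournament_iso T C)"
    then obtain n k C where "3 \<le> n" "1 \<le> k" "k \<le> n - 2"
      "C \<in> families n k"
      and iso: "tournament_iso T C" by blast
    from crit[OF this(1-4)] show "\<exists>x. critical_except (pverts T) (arc T) x"
      by (rule critical_except_iso[OF assms iso])
  qed
  moreover have "noncritical_vertex C x \<longleftrightarrow> x = 2*k + 1"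
    if "3 \<le> n" "1 \<le> k" "k \<le> n - 2"
      "C \<in> families n k" for n k C x
    using critical_except_noncritical_vertex[OF crit[OF that]] .
  ultimately show ?thesis by blast
qed

end
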